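(* Let $T:\mathbb{T}\to\mathbb{T}$ be a $C^4$ uniformly expanding map with transfer operator $L_T:L^1(\mathbb{T})\to L^1(\mathbb{T})$, having an invariant probability density $h_0\in W^{3,1}(\mathbb{T})$ such that $W_{h_0}=0$. Let $\delta\ge0$ and let $\phi\mapsto\psi_\phi$ be a map assigning to each $\phi\in L^1(\mathbb{T})$ a probability density $\psi_\phi\in W^{2,1}(\mathbb{T})$, such that $\sup_{\phi\in P_w}\|\psi_\phi\|_{W^{2,1}}<\infty$ and, for some $C_\psi\ge0$, $\|\psi_{\phi+g}-\psi_\phi\|_{W^{1,1}}\le C_\psi\,\delta\,\|g\|_{L^1}$ for all $\phi\in P_w$ and $g\in V_{L^1}$. Let $\tilde\phi\in L^1(\mathbb{T})$ be such that $\delta W_{\tilde\phi}>1$. Suppose that $\phi\mapsto\psi_\phi$ is differentiable at $\tilde\phi$: there is a bounded linear $\dot\psi_{\tilde\phi}:L^1\to W^{2,1}$ such that $$\lim_{g\in V_{L^1},\ \|g\|_{L^1}\to0}\frac{\|\psi_{\tilde\phi+g}-\psi_{\tilde\phi}-\dot\psi_{\tilde\phi}(g)\|_{W^{1,1}}}{\|g\|_{L^1}}=0,$$ with $\|\dot\psi_{\tilde\phi}\|_{L^1\to W^{1,1}}<1$, and suppose furthermore that $\|\dot\psi_{\tilde\phi}\|_{L^1\to W^{2,1}}<1$. Then both $h_0$ and $\psi_{\tilde\phi}$ are stable fixed points of $\mathcal{L}_\delta$ having local exponential convergence to equilibrium: there are $r,C,\lambda>0$ such that for each $g\in W^{1,1}(\mathbb{T})$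 with $\int g\,dx=0$ and $\|g\|_{W^{1,1}}\le r$, and each $n\in\mathbb{N}$, $$\|\mathcal{L}_\delta^n(h_0+g)-h_0\|_{W^{1,1}}\le Ce^{-\lambda n}\quad\text{and}\quad\|\mathcal{L}_\delta^n(\psi_{\tilde\phi}+g)-\psi_{\tilde\phi}\|_{W^{1,1}}\le Ce^{-\lambda n}.$$
   Context: $\mathbb{T}$ is the circle, parametrized as $\mathbb{R}/2\pi\mathbb{Z}$ so that $e^{ix}$ is well defined. A $C^4$ map $T$ of the circle is uniformly expanding if there is $\sigma>1$ with $|T'(x)|>\sigma$ for all $x$; its transfer operator is $L_Tf(x)=\sum_{y\in T^{-1}(x)}f(y)/|T'(y)|$. $P_w$ is the set of probability densities in $L^1(\mathbb{T})$ and $V_{L^1}=\{g\in L^1(\mathbb{T}):\int g\,dx=0\}$. For $\phi\in L^1$, $W_\phi=\left|\int_{\mathbb{T}}e^{ix}\phi(x)\,dx\right|^2$. For $\delta\ge0$ and $\phi\in L^1$ define $L_{\delta,\phi}:L^1\to L^1$ by $$L_{\delta,\phi}(f)=\begin{cases}(1-\delta W_\phi)L_T(f)+\left[\delta W_\phi\int f\,dx\right]\psi_\phi & \text{when }\delta W_\phi\le1,\\ \psi_\phi\int f\,dx & \text{when }\delta W_\phi>1,\end{cases}$$ and $\mathcal{L}_\delta(f)=L_{\delta,f}(f)$. Norms $\|\cdot\|_{L^1\to W^{j,1}}$ are operator norms.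
   Formalization: The formal theorem adds the hypothesis ψ_φ̃ = φ̃ (self-consistency); without it ψ_φ̃ need not be a fixed point of 𝓛_δ, e.g. ψ ≡ 1/(2π), δ = 1, φ̃ = M(1+cos x) with M large and T(x) = 3x + ε sin 2x. *)

theory Defs
  imports "HOL-Analysis.Analysis"
begin

section \<open>The space of integrable functions on the circle\<close>

text \<open>
  The circle is the real line modulo \<open>2 * pi\<close>; measure-theoretically it is identified with its
  fundamental domain, carrying (unnormalised) Lebesgue measure. Elements of \<open>L1\<close> are real-valued
  integrable functions modulo equality almost everywhere.
\<close>

definition circ :: "real measure" where
  "circ = restrict_space lborel {0..<2 * pi}"

definition eq_L1 :: "(real \<Rightarrow> real) \<Rightarrow> (real \<Rightarrow> real) \<Rightarrow> bool" where
  "eq_L1 f g \<longleftrightarrow> integrable circ f \<and> integrable circ g \<and> (AE x in circ. f x = g x)"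

quotient_type L1 = "real \<Rightarrow> real" / partial: eq_L1
proof (rule part_equivpI)
  show "\<exists>f. eq_L1 f f"
    by (rule exI[of _ "\<lambda>_. 0"]) (simp add: eq_L1_def)
  show "symp eq_L1"
    by (auto simp: symp_def eq_L1_def eq_commute)
  show "transp eq_L1"
    by (auto simp: transp_def eq_L1_def)
qed

instantiation L1 :: real_vector
begin

lift_definition zero_L1 :: L1 is "\<lambda>_. 0"
  by (simp add: eq_L1_def)

lift_definition plus_L1 :: "L1 \<Rightarrow> L1 \<Rightarrow> L1" is "\<lambda>f g x. f x + g x"
  by (auto simp: eq_L1_def)

lift_definition uminus_L1 :: "L1 \<Rightarrow> L1" is "\<lambda>f x. - f x"
  by (auto simp: eq_L1_def)

lift_definition minus_L1 :: "L1 \<Rightarrow> L1 \<Rightarrow> L1" is "\<lambda>f g x. f x - g x"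
  by (auto simp: eq_L1_def)

lift_definition scaleR_L1 :: "real \<Rightarrow> L1 \<Rightarrow> L1" is "\<lambda>c f x. c * f x"
  by (auto simp: eq_L1_def)

instance
proof
  fix a b c :: L1 and s t :: real
  show "a + b + c = a + (b + c)" by transfer (auto simp: eq_L1_def)
  show "a + b = b + a" by transfer (auto simp: eq_L1_def)
  show "0 + a = a" by transfer (auto simp: eq_L1_def)
  show "- a + a = 0" by transfer (auto simp: eq_L1_def)
  show "a - b = a + - b" by transfer (auto simp: eq_L1_def)
  show "s *\<^sub>R (a + b) = s *\<^sub>R a + s *\<^sub>R b"
    by transfer (auto simp: eq_L1_def algebra_simps)
  show "(s + t) *\<^sub>R a = s *\<^sub>R a + t *\<^sub>R a"
    by transfer (auto simp: eq_L1_def algebra_simps)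
  show "s *\<^sub>R t *\<^sub>R a = (s * t) *\<^sub>R a"
    by transfer (auto simp: eq_L1_def algebra_simps)
  show "1 *\<^sub>R a = a" by transfer (auto simp: eq_L1_def)
qed

end

instantiation L1 :: real_normed_vector
begin

lift_definition norm_L1 :: "L1 \<Rightarrow> real" is "\<lambda>f. LINT x|circ. \<bar>f x\<bar>"
  by (auto simp: eq_L1_def intro!: integral_cong_AE)

definition sgn_L1 :: "L1 \<Rightarrow> L1" where "sgn_L1 f = f /\<^sub>R norm f"

definition dist_L1 :: "L1 \<Rightarrow> L1 \<Rightarrow> real" where "dist_L1 f g = norm (f - g)"

definition uniformity_L1 :: "(L1 \<times> L1) filter" where
  "uniformity_L1 = (INF e\<in>{0<..}. principal {(f, g). dist f g < e})"

definition open_L1 :: "L1 set \<Rightarrow> bool" where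
  "open_L1 U \<longleftrightarrow> (\<forall>f\<in>U. eventually (\<lambda>(f', g). f' = f \<longrightarrow> g \<in> U) uniformity)"

instance
proof
  fix a b :: L1 and s :: real
  show "sgn a = a /\<^sub>R norm a" by (rule sgn_L1_def)
  show "dist a b = norm (a - b)" by (rule dist_L1_def)
  show "(uniformity :: (L1 \<times> L1) filter) = (INF e\<in>{0<..}. principal {(f, g). dist f g < e})"
    by (rule uniformity_L1_def)
  show "open U \<longleftrightarrow> (\<forall>x\<in>U. \<forall>\<^sub>F (x', y) in uniformity. x' = x \<longrightarrow> y \<in> U)" for U :: "L1 set"
    by (rule open_L1_def)
  show "norm a = 0 \<longleftrightarrow> a = 0"
    by transfer (simp add: eq_L1_def integral_nonneg_eq_0_iff_AE)
  show "norm (a + b) \<le> norm a + norm b"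
  proof transfer
    fix f g assume "eq_L1 f f" "eq_L1 g g"
    then have f: "integrable circ f" and g: "integrable circ g" by (auto simp: eq_L1_def)
    have "(LINT x|circ. \<bar>f x + g x\<bar>) \<le> (LINT x|circ. \<bar>f x\<bar> + \<bar>g x\<bar>)"
      using f g by (intro integral_mono) auto
    then show "(LINT x|circ. \<bar>f x + g x\<bar>) \<le> (LINT x|circ. \<bar>f x\<bar>) + (LINT x|circ. \<bar>g x\<bar>)"
      using f g by simp
  qed
  show "norm (s *\<^sub>R a) = \<bar>s\<bar> * norm a"
    by transfer (simp add: abs_mult)
qed

end

lift_definition mean :: "L1 \<Rightarrow> real" is "\<lambda>f. LINT x|circ. f x"
  by (auto simp: eq_L1_def intro!: integral_cong_AE)

lift_definition nonneg :: "L1 \<Rightarrow> bool" is "\<lambda>f. AE x in circ. 0 \<le> f x"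
  by (auto simp: eq_L1_def elim: AE_mp)

definition Pw :: "L1 set" where
  "Pw = {f. nonneg f \<and> mean f = 1}"

definition V_L1 :: "L1 set" where
  "V_L1 = {g. mean g = 0}"

lift_definition W :: "L1 \<Rightarrow> real" is "\<lambda>f. (cmod (LINT x|circ. cis x * of_real (f x)))\<^sup>2"
proof -
  fix f g assume "eq_L1 f g"
  then have f: "integrable circ f" and g: "integrable circ g" and ae: "AE x in circ. f x = g x"
    by (auto simp: eq_L1_def)
  have [measurable]: "f \<in> borel_measurable circ" "g \<in> borel_measurable circ"
    using f g by auto
  have "cis \<in> borel_measurable borel"
    by (intro borel_measurable_continuous_onI continuous_intros)
  then have [measurable]: "cis \<in> borel_measurable circ"
    unfolding circ_def by (intro measurable_restrict_space1) simp
  have "(LINT x|circ. cis x * complex_of_real (f x)) = (LINT x|circ. cis x * complex_of_real (g x))"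
    using ae by (intro integral_cong_AE) auto
  then show "(cmod (LINT x|circ. cis x * complex_of_real (f x)))\<^sup>2 =
      (cmod (LINT x|circ. cis x * complex_of_real (g x)))\<^sup>2"
    by simp
qed


section \<open>Sobolev spaces on the circle\<close>

definition test_function :: "(real \<Rightarrow> real) \<Rightarrow> bool" where
  "test_function u \<longleftrightarrow>
     (\<forall>x. u (x + 2 * pi) = u x) \<and> (\<forall>k x. ((deriv ^^ k) u) differentiable (at x))"

lift_definition has_weak_deriv :: "nat \<Rightarrow> L1 \<Rightarrow> L1 \<Rightarrow> bool" is
  "\<lambda>k f g. \<forall>u. test_function u \<longrightarrow>
     (LINT x|circ. f x * (deriv ^^ k) u x) = (-1) ^ k * (LINT x|circ. g x * u x)"
proof -
  fix k f f' g g' assume "eq_L1 f f'" "eq_L1 g g'"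
  then have [measurable]: "f \<in> borel_measurable circ" "f' \<in> borel_measurable circ"
      "g \<in> borel_measurable circ" "g' \<in> borel_measurable circ"
    and ae: "AE x in circ. f x = f' x" "AE x in circ. g x = g' x"
    by (auto simp: eq_L1_def)
  have eq: "(LINT x|circ. f x * (deriv ^^ k) u x) = (LINT x|circ. f' x * (deriv ^^ k) u x)"
      "(LINT x|circ. g x * u x) = (LINT x|circ. g' x * u x)" if "test_function u" for u
  proof -
    have m: "(deriv ^^ j) u \<in> borel_measurable circ" for j
    proof -
      have "continuous_on UNIV ((deriv ^^ j) u)"
        using that unfolding test_function_def
        by (intro continuous_at_imp_continuous_on ballI differentiable_imp_continuous_within) blast
      then have "(deriv ^^ j) u \<in> borel_measurable borel"
        by (rule borel_measurable_continuous_onI)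
      then show ?thesis
        unfolding circ_def by (intro measurable_restrict_space1) simp
    qed
    note [measurable] = m[of k]
    have [measurable]: "u \<in> borel_measurable circ"
      using m[of 0] by simp
    show "(LINT x|circ. f x * (deriv ^^ k) u x) = (LINT x|circ. f' x * (deriv ^^ k) u x)"
      using ae by (intro integral_cong_AE) auto
    show "(LINT x|circ. g x * u x) = (LINT x|circ. g' x * u x)"
      using ae by (intro integral_cong_AE) auto
  qed
  show "(\<forall>u. test_function u \<longrightarrow>
          (LINT x|circ. f x * (deriv ^^ k) u x) = (-1) ^ k * (LINT x|circ. g x * u x)) =
        (\<forall>u. test_function u \<longrightarrow>
          (LINT x|circ. f' x * (deriv ^^ k) u x) = (-1) ^ k * (LINT x|circ. g' x * u x))"
    using eq by simp
qed

definition weak_deriv :: "nat \<Rightarrow> L1 \<Rightarrow> L1" where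
  "weak_deriv k f = (THE g. has_weak_deriv k f g)"

definition Sobolev :: "nat \<Rightarrow> L1 set" where
  "Sobolev k = {f. \<forall>j\<le>k. \<exists>g. has_weak_deriv j f g}"

text \<open>The following is the Sobolev norm only on \<open>Sobolev k\<close>; it is meaningless elsewhere.\<close>

definition Sobolev_norm :: "nat \<Rightarrow> L1 \<Rightarrow> real" where
  "Sobolev_norm k f = (\<Sum>j\<le>k. norm (weak_deriv j f))"

text \<open>
  Operator norm from \<open>L1\<close> to \<open>Sobolev k\<close>, in the style of \<open>onorm\<close>; the quotient is \<open>0\<close> at
  \<open>f = 0\<close>, and the supremum is over a bounded set whenever \<open>A\<close> is a bounded operator.
\<close>

definition Sobolev_onorm :: "nat \<Rightarrow> (L1 \<Rightarrow> L1) \<Rightarrow> real" where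
  "Sobolev_onorm k A = (SUP f. Sobolev_norm k (A f) / norm f)"

definition bounded_linear_into_Sobolev :: "nat \<Rightarrow> (L1 \<Rightarrow> L1) \<Rightarrow> bool" where
  "bounded_linear_into_Sobolev k A \<longleftrightarrow>
     linear A \<and> range A \<subseteq> Sobolev k \<and> (\<exists>K. \<forall>f. Sobolev_norm k (A f) \<le> K * norm f)"


section \<open>Expanding circle maps and transfer operators\<close>

text \<open>
  A \<open>C^4\<close> map of the circle is given by a lift to the real line; \<open>d\<close> is its degree. Its derivative
  is the derivative of the lift.
\<close>

definition C4_circle_lift :: "(real \<Rightarrow> real) \<Rightarrow> bool" where
  "C4_circle_lift T \<longleftrightarrow>
     (\<exists>d::int. \<forall>x. T (x + 2 * pi) = T x + 2 * pi * of_int d) \<and>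
     (\<forall>k<4. \<forall>x. ((deriv ^^ k) T) differentiable (at x)) \<and>
     continuous_on UNIV ((deriv ^^ 4) T)"

definition uniformly_expanding :: "(real \<Rightarrow> real) \<Rightarrow> bool" where
  "uniformly_expanding T \<longleftrightarrow> (\<exists>\<sigma>>1. \<forall>x. \<bar>deriv T x\<bar> > \<sigma>)"

definition circ_preimage :: "(real \<Rightarrow> real) \<Rightarrow> real \<Rightarrow> real set" where
  "circ_preimage T x = {y \<in> {0..<2 * pi}. \<exists>m::int. T y = x + 2 * pi * of_int m}"

text \<open>
  The transfer operator is evaluated on an arbitrary representative. For uniformly expanding \<open>T\<close>
  the class of the result does not depend on it: the preimages are finite and the images of null
  sets are null.
\<close>

definition transfer_op :: "(real \<Rightarrow> real) \<Rightarrow> L1 \<Rightarrow> L1" where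
  "transfer_op T f = abs_L1 (\<lambda>x. \<Sum>y\<in>circ_preimage T x. rep_L1 f y / \<bar>deriv T y\<bar>)"

definition L_fam :: "(real \<Rightarrow> real) \<Rightarrow> real \<Rightarrow> (L1 \<Rightarrow> L1) \<Rightarrow> L1 \<Rightarrow> L1 \<Rightarrow> L1" where
  "L_fam T \<delta> \<psi> \<phi> f =
     (if \<delta> * W \<phi> \<le> 1
      then (1 - \<delta> * W \<phi>) *\<^sub>R transfer_op T f + (\<delta> * W \<phi> * mean f) *\<^sub>R \<psi> \<phi>
      else mean f *\<^sub>R \<psi> \<phi>)"

definition L_self :: "(real \<Rightarrow> real) \<Rightarrow> real \<Rightarrow> (L1 \<Rightarrow> L1) \<Rightarrow> L1 \<Rightarrow> L1" where
  "L_self T \<delta> \<psi> f = L_fam T \<delta> \<psi> f f"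

text \<open>
  A density \<open>\<phi>\<close> with \<open>\<delta> * W \<phi> > 1\<close> satisfies \<open>L_self T \<delta> \<psi> \<phi> = \<psi> \<phi>\<close>, so it is a fixed point exactly
  when \<open>\<psi> \<phi> = \<phi>\<close>. Without that equation \<open>\<psi> \<phi>\<close> need not be a fixed point either.
\<close>


section \<open>Stability\<close>

text \<open>Lyapunov stability under zero-average perturbations in \<open>Sobolev 1\<close>.\<close>

definition stable_fixed_point :: "(L1 \<Rightarrow> L1) \<Rightarrow> L1 \<Rightarrow> bool" where
  "stable_fixed_point F p \<longleftrightarrow> F p = p \<and>
     (\<forall>\<epsilon>>0. \<exists>\<rho>>0. \<forall>g\<in>Sobolev 1 \<inter> V_L1. Sobolev_norm 1 g \<le> \<rho> \<longrightarrow>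
        (\<forall>n. (F ^^ n) (p + g) - p \<in> Sobolev 1 \<and> Sobolev_norm 1 ((F ^^ n) (p + g) - p) \<le> \<epsilon>))"

end

theory Submission
  imports Defs
begin

text \<open>
  Everything about the transfer operator \<open>L\<close> is derived from the duality
  \<open>\<integral> (L f) u = \<integral> f (u \<circ> T)\<close> with continuous \<open>u\<close>. It yields the weak derivative
  \<open>(L f)' = L (f'/T' - f T''/T'\<^sup>2)\<close>, hence a Lasota-Yorke inequality, and it shows that \<open>L\<close> maps the
  cone \<open>|h'| \<le> a h\<close> strictly into itself. Elements of this cone are bounded below by a multiple of
  their mean, so a fixed constant can be split off in each step, which gives exponential decay
  of \<open>L\<^sup>n v\<close> in \<open>L\<^sup>1\<close> for \<open>C\<^sup>1\<close> functions \<open>v\<close> of zero mean and, by another duality argument, uniform decay on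
  the unit ball of the zero mean functions of \<open>W\<^sup>1\<^sup>,\<^sup>1\<close>. Some power of \<open>L\<close> therefore contracts these functions.

  Near \<open>h0\<close> the self-consistent operator is a quadratic perturbation of \<open>L\<close>, because \<open>W\<close> vanishes to
  second order at \<open>h0\<close>. Near a fixed point \<open>\<phi>\<close> with \<open>\<delta> W \<phi> > 1\<close> it coincides with \<open>\<psi>\<close>, whose
  derivative there is a contraction from \<open>L\<^sup>1\<close> to \<open>W\<^sup>1\<^sup>,\<^sup>1\<close>.
\<close>

section \<open>Duality with continuous functions on the circle\<close>

text \<open>The cone estimate controls \<open>L ^^ n\<close> on a C^1 function through a bound on
  its derivative, whereas a perturbation in \<open>Sobolev 1\<close> has only an integrable weak
  derivative. Passing to the observable closes this gap: for continuous \<open>u\<close> bounded by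
  1, the function \<open>u\<close> composed with \<open>T ^^ n\<close>, less its mean, has a second
  periodic antiderivative whose C^1 size is bounded independently of \<open>n\<close> and
  \<open>u\<close>, and the cone estimate is applied to that function only. This takes the place of
  a compactness argument for the unit ball, and no spectral theory enters.

  Two auxiliary facts carry the duality. Continuous functions must recover the full L1 norm, which
  rests on approximating a sign function almost everywhere. Weak derivatives are defined by smooth
  test functions, but \<open>u (T x) / T' x\<close> need not be smooth, so testing has to be
  extended to C^1 functions.

  At \<open>h0\<close> only a power of \<open>L\<close> is known to contract, while the nonlinear
  remainder is estimated for a single step; an adapted norm reconciles the two. At the other fixed
  point a single step already contracts, since the derivative of \<open>\<psi>\<close> is bounded by
  the L1 norm alone.\<close>

definition Cper :: "(real \<Rightarrow> real) set" where
  "Cper = {u. continuous_on UNIV u \<and> (\<forall>x. u (x + 2 * pi) = u x)}"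

text \<open>The chosen representative is irrelevant, because the integral ignores null sets; see
  \<open>pairing_abs_L1\<close>.\<close>

definition pairing :: "L1 \<Rightarrow> (real \<Rightarrow> real) \<Rightarrow> real" where
  "pairing f u = (LINT x|circ. rep_L1 f x * u x)"

lemma space_circ [simp]: "space circ = {0..<2 * pi}"
  by (simp add: circ_def)

lemma emeasure_circ: "emeasure circ (space circ) = ennreal (2 * pi)"
  unfolding space_circ by (simp add: circ_def emeasure_restrict_space)

lemma measure_circ [simp]: "measure circ {0..<2 * pi} = 2 * pi"
  using emeasure_circ by (simp add: measure_def)

interpretation circ: finite_measure circ
  by standard (simp add: emeasure_circ del: space_circ)

lemma measurable_circ: "u \<in> borel_measurable borel \<Longrightarrow> u \<in> borel_measurable circ"
  unfolding circ_def by (intro measurable_restrict_space1) simp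

lemma integrable_circ_iff:
  "integrable circ f \<longleftrightarrow> integrable lborel (\<lambda>x. indicator {0..<2 * pi} x * f x)"
  for f :: "real \<Rightarrow> real"
  by (simp add: circ_def integrable_restrict_space)

lemma integral_circ:
  "(LINT x|circ. f x) = (LINT x|lborel. indicator {0..<2 * pi} x * f x)" for f :: "real \<Rightarrow> real"
  by (simp add: circ_def integral_restrict_space)

lemma integral_circ_const: "(LINT x|circ. c) = 2 * pi * (c::real)"
  unfolding integral_circ by simp

lemma periodic_shift:
  fixes u :: "real \<Rightarrow> 'a"
  assumes "\<And>x. u (x + 2 * pi) = u x"
  shows "u (x + 2 * pi * of_int n) = u x"
proof -
  interpret periodic_fun_simple u "2 * pi" by standard (rule assms)
  show ?thesis using plus_of_int[of x n] by (simp add: mult.commute)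
qed

lemma fundamental_domain: "\<exists>n::int. x + 2 * pi * of_int n \<in> {0..<2 * pi}"
proof -
  define k where "k = \<lfloor>x / (2 * pi)\<rfloor>"
  have "of_int k \<le> x / (2 * pi)" "x / (2 * pi) < of_int k + 1"
    unfolding k_def by linarith+
  then have "2 * pi * of_int k \<le> x" "x < 2 * pi * of_int k + 2 * pi"
    by (simp_all add: field_simps)
  then show ?thesis by (intro exI[of _ "-k"]) simp
qed

lemma periodic_value:
  fixes u :: "real \<Rightarrow> 'a"
  assumes "\<And>x. u (x + 2 * pi) = u x"
  obtains y where "y \<in> {0..<2 * pi}" "u x = u y"
  using fundamental_domain[of x] periodic_shift[of u, OF assms] by metis

lemma CperI: "continuous_on UNIV u \<Longrightarrow> (\<And>x. u (x + 2 * pi) = u x) \<Longrightarrow> u \<in> Cper"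
  by (simp add: Cper_def)

lemma Cper_continuous: "u \<in> Cper \<Longrightarrow> continuous_on S u"
  unfolding Cper_def using continuous_on_subset by blast

lemma Cper_periodic: "u \<in> Cper \<Longrightarrow> u (x + 2 * pi) = u x"
  by (simp add: Cper_def)

lemma Cper_shift: "u \<in> Cper \<Longrightarrow> u (x + 2 * pi * of_int n) = u x"
  by (rule periodic_shift) (rule Cper_periodic)

lemma Cper_measurable: "u \<in> Cper \<Longrightarrow> u \<in> borel_measurable borel"
  by (intro borel_measurable_continuous_onI Cper_continuous)

lemma Cper_const [simp]: "(\<lambda>x. c) \<in> Cper"
  by (simp add: Cper_def)

lemma Cper_uminus: "u \<in> Cper \<Longrightarrow> (\<lambda>x. - u x) \<in> Cper"
  and Cper_abs: "u \<in> Cper \<Longrightarrow> (\<lambda>x. \<bar>u x\<bar>) \<in> Cper"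
  and Cper_add: "u \<in> Cper \<Longrightarrow> v \<in> Cper \<Longrightarrow> (\<lambda>x. u x + v x) \<in> Cper"
  and Cper_diff: "u \<in> Cper \<Longrightarrow> v \<in> Cper \<Longrightarrow> (\<lambda>x. u x - v x) \<in> Cper"
  and Cper_mult: "u \<in> Cper \<Longrightarrow> v \<in> Cper \<Longrightarrow> (\<lambda>x. u x * v x) \<in> Cper"
  by (auto simp: Cper_def intro!: continuous_intros)

lemma Cper_divide: "u \<in> Cper \<Longrightarrow> v \<in> Cper \<Longrightarrow> (\<And>x. v x \<noteq> 0) \<Longrightarrow> (\<lambda>x. u x / v x) \<in> Cper"
  by (auto simp: Cper_def intro!: continuous_intros)

lemmas Cper_intros = Cper_const Cper_uminus Cper_abs Cper_add Cper_diff Cper_mult Cper_divide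

lemma Cper_bounded:
  assumes "u \<in> Cper"
  obtains B where "B > 0" "\<And>x. \<bar>u x\<bar> \<le> B"
proof -
  have "compact (u ` {0..2 * pi})"
    by (intro compact_continuous_image Cper_continuous assms compact_Icc)
  then obtain B where B: "B > 0" "\<And>y. y \<in> {0..2 * pi} \<Longrightarrow> \<bar>u y\<bar> \<le> B"
    by (auto dest!: compact_imp_bounded simp: bounded_pos)
  show thesis
  proof (rule that[of B])
    fix x
    obtain y where "y \<in> {0..<2 * pi}" "u x = u y"
      using periodic_value Cper_periodic[OF assms] by metis
    with B(2)[of y] show "\<bar>u x\<bar> \<le> B" by simp
  qed (use B in auto)
qed

lemma integrable_mult_Cper:
  assumes f: "integrable circ f" and u: "u \<in> Cper"
  shows "integrable circ (\<lambda>x. f x * u x)"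
proof -
  obtain B where B: "B > 0" "\<And>x. \<bar>u x\<bar> \<le> B" using Cper_bounded[OF u] by metis
  have [measurable]: "f \<in> borel_measurable circ" "u \<in> borel_measurable circ"
    using f Cper_measurable[OF u] measurable_circ by auto
  show ?thesis
  proof (rule Bochner_Integration.integrable_bound)
    show "integrable circ (\<lambda>x. B * f x)" using f by simp
    show "AE x in circ. norm (f x * u x) \<le> norm (B * f x)"
    proof (intro always_eventually allI)
      fix x
      show "norm (f x * u x) \<le> norm (B * f x)"
        using mult_right_mono[OF B(2)[of x], of "\<bar>f x\<bar>"] B(1) by (simp add: abs_mult mult.commute)
    qed
  qed simp
qed

lemma integrable_Cper: "u \<in> Cper \<Longrightarrow> integrable circ u"
  using integrable_mult_Cper[of "\<lambda>_. 1" u] by simp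

section \<open>Representatives and the calculus of the pairing\<close>

lemma rep_L1_self: "eq_L1 (rep_L1 f) (rep_L1 f)"
  by (rule Quotient_rep_reflp[OF Quotient_L1])

lemma abs_rep_L1 [simp]: "abs_L1 (rep_L1 f) = f"
  by (rule Quotient_abs_rep[OF Quotient_L1])

lemma integrable_rep_L1 [simp]: "integrable circ (rep_L1 f)"
  using rep_L1_self[of f] by (simp add: eq_L1_def)

lemma eq_L1_refl: "eq_L1 f f \<longleftrightarrow> integrable circ f"
  by (simp add: eq_L1_def)

lemma L1_cases: obtains f' where "integrable circ f'" "f = abs_L1 f'"
  using that[of "rep_L1 f"] by simp

lemma rep_abs_L1: "integrable circ f \<Longrightarrow> AE x in circ. rep_L1 (abs_L1 f) x = f x"
  using Quotient_rep_abs[OF Quotient_L1, of f] by (simp add: eq_L1_def)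

lemma pairing_abs_L1:
  assumes f: "integrable circ f" and u: "u \<in> Cper"
  shows "pairing (abs_L1 f) u = (LINT x|circ. f x * u x)"
  unfolding pairing_def
proof (rule integral_cong_AE)
  have u': "u \<in> borel_measurable circ" using Cper_measurable[OF u] measurable_circ by auto
  show "(\<lambda>x. rep_L1 (abs_L1 f) x * u x) \<in> borel_measurable circ"
    by (intro borel_measurable_times u' borel_measurable_integrable integrable_rep_L1)
  show "(\<lambda>x. f x * u x) \<in> borel_measurable circ"
    by (intro borel_measurable_times u' borel_measurable_integrable f)
  show "AE x in circ. rep_L1 (abs_L1 f) x * u x = f x * u x"
    using rep_abs_L1[OF f] by auto
qed

lemma norm_abs_L1: "integrable circ f \<Longrightarrow> norm (abs_L1 f) = (LINT x|circ. \<bar>f x\<bar>)"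
  by (simp add: norm_L1.abs_eq eq_L1_refl)

lemma mean_abs_L1: "integrable circ f \<Longrightarrow> mean (abs_L1 f) = (LINT x|circ. f x)"
  by (simp add: mean.abs_eq eq_L1_refl)

lemma pairing_add_left: "u \<in> Cper \<Longrightarrow> pairing (f + g) u = pairing f u + pairing g u"
  by (cases f rule: L1_cases; cases g rule: L1_cases)
     (simp add: plus_L1.abs_eq eq_L1_refl pairing_abs_L1 distrib_right integrable_mult_Cper)

lemma pairing_diff_left: "u \<in> Cper \<Longrightarrow> pairing (f - g) u = pairing f u - pairing g u"
  by (cases f rule: L1_cases; cases g rule: L1_cases)
     (simp add: minus_L1.abs_eq eq_L1_refl pairing_abs_L1 left_diff_distrib integrable_mult_Cper)

lemma pairing_scaleR_left: "u \<in> Cper \<Longrightarrow> pairing (c *\<^sub>R f) u = c * pairing f u"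
  by (cases f rule: L1_cases)
     (simp add: scaleR_L1.abs_eq eq_L1_refl pairing_abs_L1 mult.assoc)

lemma pairing_add: "u \<in> Cper \<Longrightarrow> v \<in> Cper \<Longrightarrow> pairing f (\<lambda>x. u x + v x) = pairing f u + pairing f v"
  by (simp add: pairing_def distrib_left integrable_mult_Cper)

lemma pairing_diff: "u \<in> Cper \<Longrightarrow> v \<in> Cper \<Longrightarrow> pairing f (\<lambda>x. u x - v x) = pairing f u - pairing f v"
  by (simp add: pairing_def right_diff_distrib integrable_mult_Cper)

lemma pairing_cmult: "pairing f (\<lambda>x. c * u x) = c * pairing f u"
  by (simp add: pairing_def mult.left_commute)

lemma pairing_uminus: "pairing f (\<lambda>x. - u x) = - pairing f u"
  using pairing_cmult[of f "-1" u] by simp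

lemma pairing_one: "pairing f (\<lambda>x. 1) = mean f"
  using mean_abs_L1[OF integrable_rep_L1[of f]] by (simp add: pairing_def)

lemma pairing_const: "pairing f (\<lambda>x. c) = c * mean f"
  using pairing_cmult[of f c "\<lambda>_. 1"] by (simp add: pairing_one)

lemma norm_L1_rep: "norm f = (LINT x|circ. \<bar>rep_L1 f x\<bar>)"
  using norm_abs_L1[OF integrable_rep_L1[of f]] by simp

lemma pairing_bound:
  assumes u: "u \<in> Cper" and B: "\<And>x. \<bar>u x\<bar> \<le> B"
  shows "\<bar>pairing f u\<bar> \<le> B * norm f"
proof -
  have "\<bar>pairing f u\<bar> \<le> (LINT x|circ. \<bar>rep_L1 f x * u x\<bar>)"
    unfolding pairing_def by (rule integral_abs_bound)
  also have "\<dots> \<le> (LINT x|circ. B * \<bar>rep_L1 f x\<bar>)"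
    using B by (intro integral_mono integrable_abs integrable_mult_Cper u integrable_rep_L1 integrable_mult_right)
       (auto simp: abs_mult mult.commute intro!: mult_right_mono)
  finally show ?thesis by (simp add: norm_L1_rep)
qed

lemma pairing_abs_L1_Cper: "v \<in> Cper \<Longrightarrow> u \<in> Cper \<Longrightarrow> pairing (abs_L1 v) u = (LINT x|circ. v x * u x)"
  by (intro pairing_abs_L1 integrable_Cper)

lemma mean_add: "mean (f + g) = mean f + mean g"
  and mean_diff: "mean (f - g) = mean f - mean g"
  and mean_scaleR: "mean (c *\<^sub>R f) = c * mean f"
  by (simp_all flip: pairing_one add: pairing_add_left pairing_diff_left pairing_scaleR_left)

text \<open>Reduction modulo \<open>2 * pi\<close> makes \<open>g\<close> periodic but may create
  jumps at the multiples of \<open>2 * pi\<close>. The sine factor vanishes exactly there and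
  restores continuity; for large \<open>c\<close> it equals 1 outside a small neighbourhood of these
  points.\<close>

lemma Cper_cutoff:
  fixes g :: "real \<Rightarrow> real"
  assumes g: "continuous_on UNIV g"
  shows "(\<lambda>x. max (-1) (min 1 (g (x - 2 * pi * of_int \<lfloor>x / (2 * pi)\<rfloor>))) * min 1 (c * \<bar>sin (x / 2)\<bar>)) \<in> Cper"
    (is "?w \<in> Cper")
proof (rule CperI)
  have "isCont ?w x" for x
  proof (cases "x / (2 * pi) \<in> \<int>")
    case False
    then have "isCont (of_int \<circ> floor :: real \<Rightarrow> real) (x / (2 * pi))"
      by (rule continuous_floor)
    then have "isCont (\<lambda>x. real_of_int \<lfloor>x / (2 * pi)\<rfloor>) x"
      using continuous_at_compose[of x "\<lambda>x. x / (2 * pi)" "of_int \<circ> floor :: real \<Rightarrow> real"]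
      by (auto simp: o_def intro!: continuous_intros)
    moreover have "isCont g y" for y
      using g by (simp add: continuous_on_eq_continuous_at)
    ultimately have "isCont (\<lambda>x. g (x - 2 * pi * of_int \<lfloor>x / (2 * pi)\<rfloor>)) x"
      by (intro isCont_o2[of x _ g]) (auto intro!: continuous_intros)
    then show ?thesis by (intro continuous_intros) auto
  next
    case True
    then obtain k :: int where "x / (2 * pi) = of_int k" by (auto elim: Ints_cases)
    then have "x / 2 = pi * of_int k" by (simp add: field_simps)
    then have s: "sin (x / 2) = 0" by (simp add: sin_npi_int)
    have "((\<lambda>y. min 1 (c * \<bar>sin (y / 2)\<bar>)) \<longlongrightarrow> min 1 (c * \<bar>sin (x / 2)\<bar>)) (at x)"
      by (intro tendsto_intros) auto
    then have lim: "((\<lambda>y. min 1 (c * \<bar>sin (y / 2)\<bar>)) \<longlongrightarrow> 0) (at x)" using s by simp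
    \<comment> \<open>Nothing is known about the reduced \<open>g\<close> across the jump, but after
      clipping it is at most 1 in modulus, so the sine factor alone forces the limit.\<close>
    have "(?w \<longlongrightarrow> 0) (at x)"
    proof (rule tendsto_rabs_zero_cancel, rule Lim_null_comparison)
      show "\<forall>\<^sub>F y in at x. norm \<bar>?w y\<bar> \<le> \<bar>min 1 (c * \<bar>sin (y / 2)\<bar>)\<bar>"
      proof (intro always_eventually allI)
        fix y
        have "\<bar>max (-1) (min 1 t) * z\<bar> \<le> \<bar>z\<bar>" for t z :: real
          unfolding abs_mult by (rule mult_left_le_one_le) auto
        then show "norm \<bar>?w y\<bar> \<le> \<bar>min 1 (c * \<bar>sin (y / 2)\<bar>)\<bar>" by simp
      qed
      show "((\<lambda>y. \<bar>min 1 (c * \<bar>sin (y / 2)\<bar>)\<bar>) \<longlongrightarrow> 0) (at x)"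
        using lim by (rule tendsto_rabs_zero)
    qed
    then show ?thesis using s by (simp add: isCont_def)
  qed
  then show "continuous_on UNIV ?w" by (simp add: continuous_on_eq_continuous_at)
  fix x
  have "(x + 2 * pi) / (2 * pi) = x / (2 * pi) + 1" by (simp add: field_simps)
  then have "\<lfloor>(x + 2 * pi) / (2 * pi)\<rfloor> = \<lfloor>x / (2 * pi)\<rfloor> + 1" by simp
  moreover have "\<bar>sin ((x + 2 * pi) / 2)\<bar> = \<bar>sin (x / 2)\<bar>"
    by (simp add: add_divide_distrib)
  ultimately show "?w (x + 2 * pi) = ?w x"
    by (simp add: algebra_simps)
qed

text \<open>Continuous functions bounded by 1 are made to converge almost everywhere to the sign of
  \<open>f\<close>; dominated convergence with majorant \<open>\<bar>f\<bar>\<close> then recovers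
  the norm.\<close>

lemma norm_L1_le_dual:
  assumes K: "\<And>u. u \<in> Cper \<Longrightarrow> (\<And>x. \<bar>u x\<bar> \<le> 1) \<Longrightarrow> pairing f u \<le> K"
  shows "norm f \<le> K"
proof -
  define r where "r = rep_L1 f"
  have r: "integrable circ r" by (simp add: r_def)
  have [measurable]: "r \<in> borel_measurable circ" using r by simp
  define h where "h x = indicator {0..<2 * pi} x * sgn (r x)" for x
  have "(\<lambda>x. sgn (r x)) \<in> borel_measurable circ" by measurable
  then have "h \<in> borel_measurable borel"
    by (simp add: circ_def borel_measurable_restrict_space_iff h_def[abs_def] mult.commute)
  then have "h \<in> borel_measurable lebesgue"
    using borel_measurable_subalgebra by (simp add: measurable_completion)
  then have "h measurable_on UNIV"
    by (rule lebesgue_measurable_imp_measurable_on) auto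
  \<comment> \<open>The approximants \<open>g n\<close> are continuous on the line but neither
    bounded nor periodic, hence the cut-off versions \<open>w n\<close>.\<close>
  then obtain N g where N: "negligible N" and g: "\<And>n. continuous_on UNIV (g n)"
    and lim: "\<And>x. x \<notin> N \<Longrightarrow> (\<lambda>n. g n x) \<longlonglongrightarrow> h x"
    unfolding measurable_on_def by auto
  define w where "w n x = max (-1) (min 1 (g n (x - 2 * pi * of_int \<lfloor>x / (2 * pi)\<rfloor>))) *
      min 1 (real n * \<bar>sin (x / 2)\<bar>)" for n x
  have w: "w n \<in> Cper" for n
    unfolding w_def using Cper_cutoff[OF g] by simp
  have w1: "\<bar>w n x\<bar> \<le> 1" for n x
    unfolding w_def abs_mult by (intro mult_le_one) auto
  have "AE x in lebesgue. x \<notin> N"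
    using N by (auto simp: negligible_iff_null_sets intro: AE_not_in)
  then have "AE x in lborel. x \<notin> N"
    using AE_completion_iff[of "\<lambda>x. x \<notin> N" lborel] by simp
  then have "AE x in circ. x \<notin> N"
    unfolding circ_def by (subst AE_restrict_space_iff) auto
  \<comment> \<open>At 0 the sine factor vanishes for every \<open>n\<close>; at each other point of
    the fundamental domain it is eventually 1.\<close>
  moreover have "AE x in circ. x \<noteq> 0"
    unfolding circ_def by (subst AE_restrict_space_iff) (auto intro: AE_lborel_singleton eventually_mono)
  moreover have "AE x in circ. x \<in> {0..<2 * pi}"
    using AE_space[of circ] by simp
  ultimately have conv: "AE x in circ. (\<lambda>n. r x * w n x) \<longlonglongrightarrow> \<bar>r x\<bar>"
  proof eventually_elim
    case (elim x)
    then have "0 \<le> x / (2 * pi)" "x / (2 * pi) < 1" by auto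
    then have fl: "\<lfloor>x / (2 * pi)\<rfloor> = 0" by linarith
    have sp: "sin (x / 2) > 0" using elim by (intro sin_gt_zero) auto
    have "\<forall>\<^sub>F n in sequentially. 1 / sin (x / 2) \<le> real n"
      by real_asymp
    then have ev: "\<forall>\<^sub>F n in sequentially. min 1 (real n * \<bar>sin (x / 2)\<bar>) = 1"
      by eventually_elim (use sp in \<open>auto simp: field_simps\<close>)
    have "(\<lambda>n. max (-1) (min 1 (g n x))) \<longlonglongrightarrow> max (-1) (min 1 (h x))"
      using lim[of x] elim by (intro tendsto_intros) auto
    also have "max (-1) (min 1 (h x)) = sgn (r x)"
      using elim by (auto simp: h_def sgn_real_def)
    finally have "(\<lambda>n. max (-1) (min 1 (g n x)) * min 1 (real n * \<bar>sin (x / 2)\<bar>)) \<longlonglongrightarrow> sgn (r x) * 1"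
      by (rule tendsto_mult) (rule tendsto_eventually[OF ev])
    then have "(\<lambda>n. w n x) \<longlonglongrightarrow> sgn (r x)" by (simp add: w_def fl)
    then have "(\<lambda>n. r x * w n x) \<longlonglongrightarrow> r x * sgn (r x)" by (intro tendsto_intros)
    then show ?case by (simp add: abs_sgn)
  qed
  have [measurable]: "w n \<in> borel_measurable circ" for n
    using w Cper_measurable measurable_circ by auto
  have "(\<lambda>n. LINT x|circ. r x * w n x) \<longlonglongrightarrow> (LINT x|circ. \<bar>r x\<bar>)"
  proof (rule integral_dominated_convergence[where w = "\<lambda>x. \<bar>r x\<bar>"])
    show "AE x in circ. norm (r x * w n x) \<le> \<bar>r x\<bar>" for n
      using w1 by (auto simp: abs_mult mult_left_le)
  qed (use r conv in auto)
  moreover have "(LINT x|circ. r x * w n x) \<le> K" for n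
    using K[OF w w1] by (simp add: pairing_def r_def)
  ultimately have "(LINT x|circ. \<bar>r x\<bar>) \<le> K"
    by (intro LIMSEQ_le_const2) auto
  then show ?thesis by (simp add: norm_L1_rep r_def)
qed

lemma L1_eqI_dual:
  assumes "\<And>u. u \<in> Cper \<Longrightarrow> pairing f u = pairing g u"
  shows "f = g"
proof -
  have "norm (f - g) \<le> 0"
    by (rule norm_L1_le_dual) (simp add: pairing_diff_left assms)
  then show ?thesis by simp
qed

section \<open>Weak derivatives\<close>

text \<open>All iterated derivatives of \<open>u\<close> stay in \<open>S\<close>, so smoothness
  follows without a formula for the k-th derivative.\<close>

lemma test_function_coinduct:
  assumes per: "\<And>u x. u \<in> S \<Longrightarrow> u (x + 2 * pi) = u x"
    and der: "\<And>u. u \<in> S \<Longrightarrow> \<exists>u'\<in>S. \<forall>x. (u has_real_derivative u' x) (at x)"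
    and u: "u \<in> S"
  shows "test_function u"
proof -
  have deriv_S: "deriv v \<in> S" if v: "v \<in> S" for v
  proof -
    obtain v' where v': "v' \<in> S" "\<And>x. (v has_real_derivative v' x) (at x)" using der[OF v] by auto
    then have "deriv v = v'" by (auto intro: DERIV_imp_deriv)
    then show ?thesis using v' by simp
  qed
  have "(deriv ^^ k) u \<in> S" for k
    by (induction k) (auto simp: u deriv_S)
  then have "(deriv ^^ k) u differentiable (at x)" for k x
    using der unfolding real_differentiable_def by blast
  then show ?thesis using per[OF u] by (simp add: test_function_def)
qed

lemma test_function_DERIV: "test_function u \<Longrightarrow> (u has_real_derivative deriv u x) (at x)"
  unfolding test_function_def using funpow_0
  by (metis DERIV_deriv_iff_real_differentiable)

lemma continuous_on_DERIV:
  "(\<And>x. (u has_real_derivative u' x) (at x)) \<Longrightarrow> continuous_on UNIV u"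
  by (meson DERIV_isCont continuous_at_imp_continuous_on)

lemma test_function_Cper: "test_function u \<Longrightarrow> u \<in> Cper"
  by (intro CperI continuous_on_DERIV[OF test_function_DERIV]) (auto simp: test_function_def)

text \<open>The additive constant \<open>c\<close> lets this apply to a lift of a circle map as well
  as to a periodic function.\<close>

lemma periodic_DERIV:
  fixes u :: "real \<Rightarrow> real"
  assumes per: "\<And>x. u (x + p) = u x + c" and u: "\<And>x. (u has_real_derivative u' x) (at x)"
  shows "u' (x + p) = u' x"
proof -
  have "((\<lambda>y. u (y + p)) has_real_derivative u' (x + p)) (at x)"
    using u[of "x + p"] by (simp add: DERIV_shift)
  moreover have "((\<lambda>y. u (y + p)) has_real_derivative u' x) (at x)"
    unfolding per using u[of x] by (auto intro!: derivative_eq_intros)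
  ultimately show ?thesis by (rule DERIV_unique)
qed

lemma test_function_deriv:
  assumes "test_function u" shows "test_function (deriv u)"
proof -
  have "deriv u (x + 2 * pi) = deriv u x" for x
    using assms test_function_DERIV[OF assms]
    by (intro periodic_DERIV[of u _ 0]) (auto simp: test_function_def)
  moreover have "(deriv ^^ k) (deriv u) differentiable (at x)" for k x
    using assms unfolding test_function_def by (metis funpow_Suc_right o_apply)
  ultimately show ?thesis by (simp add: test_function_def)
qed

lemma test_functionI:
  assumes per: "\<And>x. u (x + 2 * pi) = u x"
    and der: "\<And>x. (u has_real_derivative u' x) (at x)" and u': "test_function u'"
  shows "test_function u"
proof (rule test_function_coinduct[where S = "insert u (Collect test_function)"])
  fix v assume "v \<in> insert u (Collect test_function)"
  then show "\<exists>v'\<in>insert u (Collect test_function). \<forall>x. (v has_real_derivative v' x) (at x)"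
    using der u' test_function_deriv[of v] test_function_DERIV[of v] by blast
qed (auto simp: per test_function_def)

lemma test_function_diff_const:
  assumes u: "test_function u" shows "test_function (\<lambda>x. u x - c)"
  by (rule test_functionI[OF _ _ test_function_deriv[OF u]])
     (use u in \<open>auto simp: test_function_def intro!: derivative_eq_intros test_function_DERIV[OF u]\<close>)

section \<open>Trigonometric polynomials and uniform approximation by test functions\<close>

lemma real_polynomial_function_cis_DERIV:
  assumes "real_polynomial_function (g :: complex \<Rightarrow> real)"
  shows "\<exists>g'. real_polynomial_function g' \<and> (\<forall>x. ((\<lambda>x. g (cis x)) has_real_derivative g' (cis x)) (at x))"
  using assms
proof induction
  case (linear f)
  have "bounded_linear (\<lambda>z. f (\<i> * z))"
    by (intro bounded_linear_compose[OF linear] bounded_linear_mult_right)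
  moreover have "((\<lambda>x. f (cis x)) has_real_derivative f (\<i> * cis x)) (at x)" for x
  proof -
    have "(cis has_vector_derivative (\<i> * cis x)) (at x)"
      unfolding has_vector_derivative_def
      by (auto intro!: derivative_eq_intros ext simp: scaleR_conv_of_real)
    then show ?thesis
      by (simp add: bounded_linear.has_vector_derivative[OF linear] has_real_derivative_iff_has_vector_derivative)
  qed
  ultimately show ?case by (intro exI[of _ "\<lambda>z. f (\<i> * z)"]) auto
next
  case (const c)
  show ?case by (intro exI[of _ "\<lambda>_. 0"]) auto
next
  case (add f g)
  then obtain f' g' where "real_polynomial_function f'" "real_polynomial_function g'"
    "\<And>x. ((\<lambda>x. f (cis x)) has_real_derivative f' (cis x)) (at x)"
    "\<And>x. ((\<lambda>x. g (cis x)) has_real_derivative g' (cis x)) (at x)" by blast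
  then show ?case
    by (intro exI[of _ "\<lambda>z. f' z + g' z"]) (auto intro!: derivative_eq_intros)
next
  case (mult f g)
  then obtain f' g' where "real_polynomial_function f'" "real_polynomial_function g'"
    "\<And>x. ((\<lambda>x. f (cis x)) has_real_derivative f' (cis x)) (at x)"
    "\<And>x. ((\<lambda>x. g (cis x)) has_real_derivative g' (cis x)) (at x)" by blast
  moreover from this mult(1,2) have "real_polynomial_function (\<lambda>z. f' z * g z + g' z * f z)"
    by (intro real_polynomial_function.intros(3,4))
  ultimately show ?case
    by (intro exI[of _ "\<lambda>z. f' z * g z + g' z * f z"]) (auto intro!: derivative_eq_intros)
qed

lemma cis_period: "cis (x + 2 * pi) = cis x"
  by (simp add: complex_eq_iff)

text \<open>Polynomials in \<open>cis x\<close> are closed under differentiation: a linear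
  functional \<open>f\<close> becomes \<open>f (\<i> * z)\<close>, and sums and products obey the
  usual rules.\<close>

lemma test_function_polynomial_cis:
  assumes "real_polynomial_function g" shows "test_function (\<lambda>x. g (cis x))"
proof (rule test_function_coinduct[where S = "{\<lambda>x. g (cis x) | g. real_polynomial_function g}"])
  fix u assume "u \<in> {\<lambda>x. g (cis x) | g. real_polynomial_function g}"
  then obtain g where g: "u = (\<lambda>x. g (cis x))" "real_polynomial_function g" by blast
  show "u (x + 2 * pi) = u x" for x by (simp add: g cis_period)
  show "\<exists>u'\<in>{\<lambda>x. g (cis x) | g. real_polynomial_function g}. \<forall>x. (u has_real_derivative u' x) (at x)"
    using real_polynomial_function_cis_DERIV[OF g(2)] unfolding g(1) by fast
qed (use assms in blast)

lemma Cper_cong_cis: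
  assumes u: "u \<in> Cper" and "cis x = cis y" shows "u x = u y"
proof -
  have "cos x = cos y" "sin x = sin y"
    using assms(2) by (metis cis.sel)+
  then obtain n :: int where "x = y + 2 * pi * of_int n"
    using sin_cos_eq_iff[of x y] by (auto simp: mult_ac)
  then show ?thesis using Cper_shift[OF u] by simp
qed

text \<open>\<open>Arg\<close> jumps across the negative real axis. There \<open>u (Arg z)\<close>
  is rewritten as \<open>u (Arg (- z) + pi)\<close>, which agrees by periodicity and is continuous
  because \<open>- z\<close> avoids the cut.\<close>

lemma Cper_factor_cis:
  assumes u: "u \<in> Cper"
  shows "continuous_on (sphere 0 1) (\<lambda>z. u (Arg z))"
proof (rule continuous_at_imp_continuous_on, rule ballI)
  fix z :: complex assume z: "z \<in> sphere 0 1"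
  have cont: "isCont u y" for y
    using Cper_continuous[OF u, of UNIV] by (simp add: continuous_on_eq_continuous_at)
  show "isCont (\<lambda>z. u (Arg z)) z"
  proof (cases "z \<in> \<real>\<^sub>\<le>\<^sub>0")
    case False
    then show ?thesis by (intro isCont_o2[of z Arg u] continuous_at_Arg cont)
  next
    case True
    have "- z \<notin> \<real>\<^sub>\<le>\<^sub>0"
      using True z by (auto simp: complex_nonpos_Reals_iff complex_eq_iff norm_complex_def)
    then have "isCont (\<lambda>z. Arg (- z)) z"
      by (intro isCont_o2[of z uminus Arg] continuous_at_Arg) auto
    then have 1: "isCont (\<lambda>z. u (Arg (- z) + pi)) z"
      by (intro isCont_o2[of z "\<lambda>z. Arg (- z) + pi" u] cont continuous_intros)
    have eq: "u (Arg (- w) + pi) = u (Arg w)" if "w \<noteq> 0" for w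
      by (rule Cper_cong_cis[OF u]) (use that in \<open>simp add: cis_Arg sgn_minus flip: cis_mult\<close>)
    have "\<forall>\<^sub>F w in nhds z. w \<noteq> 0"
      using z by (intro t1_space_nhds) auto
    then have "\<forall>\<^sub>F w in nhds z. u (Arg (- w) + pi) = u (Arg w)"
      by eventually_elim (rule eq)
    from isCont_cong[OF this] show ?thesis using 1 by simp
  qed
qed

text \<open>Stone-Weierstrass is applied on the unit circle of the plane, to which \<open>u\<close>
  descends; the pull-back of a polynomial by \<open>cis\<close> is automatically periodic and
  smooth.\<close>

lemma Cper_approx_test_function:
  assumes u: "u \<in> Cper" and e: "e > 0"
  obtains v where "test_function v" "\<And>x. \<bar>u x - v x\<bar> < e"
proof -
  obtain g where g: "real_polynomial_function g" "\<And>z. z \<in> sphere 0 1 \<Longrightarrow> \<bar>u (Arg z) - g z\<bar> < e"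
    using Stone_Weierstrass_real_polynomial_function[OF compact_sphere Cper_factor_cis[OF u] e] by metis
  show thesis
  proof (rule that[OF test_function_polynomial_cis[OF g(1)]])
    fix x
    have "u (Arg (cis x)) = u x"
      by (rule Cper_cong_cis[OF u]) (simp add: cis_Arg sgn_div_norm)
    then show "\<bar>u x - g (cis x)\<bar> < e" using g(2)[of "cis x"] by simp
  qed
qed

text \<open>This makes weak derivatives unique, so that \<open>weak_deriv\<close> denotes the
  intended object. Replacing \<open>u\<close> by an approximation within \<open>d\<close> changes
  the pairing with \<open>f - g\<close> by at most \<open>d * norm (f - g)\<close>.\<close>

lemma L1_eqI_test_function:
  assumes "\<And>u. test_function u \<Longrightarrow> pairing f u = pairing g u"
  shows "f = g"
proof (rule L1_eqI_dual)
  fix u assume u: "u \<in> Cper"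
  have "\<bar>pairing f u - pairing g u\<bar> \<le> e" if "e > 0" for e
  proof -
    define d where "d = e / (norm (f - g) + 1)"
    have d: "d > 0" using that by (simp add: d_def add_nonneg_pos)
    obtain v where v: "test_function v" "\<And>x. \<bar>u x - v x\<bar> < d"
      using Cper_approx_test_function[OF u d] by metis
    note v' = test_function_Cper[OF v(1)]
    have "pairing f u - pairing g u = pairing (f - g) (\<lambda>x. u x - v x)"
      using assms[OF v(1)] u v' by (simp add: pairing_diff_left pairing_diff Cper_diff)
    also have "\<bar>\<dots>\<bar> \<le> d * norm (f - g)"
      using v(2) by (intro pairing_bound Cper_diff u v') (simp add: less_imp_le)
    also have "\<dots> \<le> d * (norm (f - g) + 1)" using d by simp
    also have "\<dots> = e" unfolding d_def
      by (metis add_nonneg_pos less_irrefl nonzero_divide_eq_eq norm_ge_zero zero_less_one)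
    finally show ?thesis .
  qed
  then have "\<bar>pairing f u - pairing g u\<bar> \<le> 0" by (rule field_le_epsilon) simp
  then show "pairing f u = pairing g u" by simp
qed

lemma has_weak_deriv_iff:
  "has_weak_deriv k f g \<longleftrightarrow> (\<forall>u. test_function u \<longrightarrow> pairing f ((deriv ^^ k) u) = (-1) ^ k * pairing g u)"
  using has_weak_deriv.abs_eq[of "rep_L1 f" "rep_L1 g" k] by (simp add: eq_L1_refl pairing_def)

lemma has_weak_deriv_unique: "has_weak_deriv k f g \<Longrightarrow> has_weak_deriv k f h \<Longrightarrow> g = h"
  by (rule L1_eqI_test_function) (auto simp: has_weak_deriv_iff)

lemma weak_deriv_eqI: "has_weak_deriv k f g \<Longrightarrow> weak_deriv k f = g"
  unfolding weak_deriv_def by (blast intro: has_weak_deriv_unique)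

lemma has_weak_deriv_0: "has_weak_deriv 0 f f"
  by (simp add: has_weak_deriv_iff)

lemma has_weak_deriv_1_iff:
  "has_weak_deriv 1 f g \<longleftrightarrow> (\<forall>u. test_function u \<longrightarrow> pairing f (deriv u) = - pairing g u)"
  by (simp add: has_weak_deriv_iff)

lemma has_weak_deriv_add:
  "has_weak_deriv 1 f f' \<Longrightarrow> has_weak_deriv 1 g g' \<Longrightarrow> has_weak_deriv 1 (f + g) (f' + g')"
  by (simp add: has_weak_deriv_1_iff pairing_add_left test_function_Cper test_function_deriv del: One_nat_def)

lemma has_weak_deriv_diff:
  "has_weak_deriv 1 f f' \<Longrightarrow> has_weak_deriv 1 g g' \<Longrightarrow> has_weak_deriv 1 (f - g) (f' - g')"
  by (simp add: has_weak_deriv_1_iff pairing_diff_left test_function_Cper test_function_deriv del: One_nat_def)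

lemma has_weak_deriv_scaleR:
  "has_weak_deriv 1 f f' \<Longrightarrow> has_weak_deriv 1 (c *\<^sub>R f) (c *\<^sub>R f')"
  by (simp add: has_weak_deriv_1_iff pairing_scaleR_left test_function_Cper test_function_deriv del: One_nat_def)

section \<open>Antiderivatives and integration by parts on the circle\<close>

lemma integral_circ_FTC:
  assumes w: "w \<in> Cper" and v: "\<And>x. (v has_real_derivative w x) (at x)"
  shows "(LINT x|circ. w x) = v (2 * pi) - v 0"
proof -
  have "(LINT x|circ. w x) = (LINT x|lborel. w x * indicator {0..2 * pi} x)"
    unfolding integral_circ
  proof (rule integral_cong_AE)
    have [measurable]: "w \<in> borel_measurable borel" by (rule Cper_measurable[OF w])
    show "(\<lambda>x. indicator {0..<2 * pi} x * w x) \<in> borel_measurable lborel"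
      "(\<lambda>x. w x * indicator {0..2 * pi} x) \<in> borel_measurable lborel" by measurable
    show "AE x in lborel. indicator {0..<2 * pi} x * w x = w x * indicator {0..2 * pi} x"
      using AE_lborel_singleton[of "2 * pi"]
      by eventually_elim (auto simp: indicator_def)
  qed
  also have "\<dots> = v (2 * pi) - v 0"
    using Cper_continuous[OF w, of UNIV]
    by (intro integral_FTC_Icc_real v) (auto simp: continuous_on_eq_continuous_at)
  finally show ?thesis .
qed

lemma continuous_has_antiderivative:
  fixes f :: "real \<Rightarrow> real"
  assumes "continuous_on UNIV f"
  obtains F where "\<And>x. (F has_real_derivative f x) (at x)"
proof -
  have "\<exists>F. \<forall>x::real. -\<infinity> < x \<longrightarrow> x < \<infinity> \<longrightarrow> (F has_vector_derivative f x) (at x)"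
    using assms by (intro einterval_antiderivative) (auto simp: continuous_on_eq_continuous_at)
  then show thesis using that by (auto simp: has_real_derivative_iff_has_vector_derivative)
qed

text \<open>The increment of an antiderivative over one period is constant, because \<open>w\<close>
  is periodic, and it equals the integral of \<open>w\<close>. Zero mean thus makes the
  antiderivative periodic.\<close>

lemma Cper_antiderivative:
  assumes w: "w \<in> Cper" and mean: "(LINT x|circ. w x) = 0"
  obtains v where "v \<in> Cper" "\<And>x. (v has_real_derivative w x) (at x)" "v a = b"
proof -
  obtain F where F: "\<And>x. (F has_real_derivative w x) (at x)"
    using continuous_has_antiderivative[OF Cper_continuous[OF w]] by blast
  define v where "v x = F x - F a + b" for x
  have v: "(v has_real_derivative w x) (at x)" for x
    unfolding v_def by (auto intro!: derivative_eq_intros F)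
  have "((\<lambda>x. v (x + 2 * pi) - v x) has_real_derivative 0) (at x)" for x
  proof -
    have "((\<lambda>x. v (x + 2 * pi)) has_real_derivative w x) (at x)"
      using v[of "x + 2 * pi"] by (simp add: DERIV_shift Cper_periodic[OF w])
    then show ?thesis using v[of x] by (auto intro!: derivative_eq_intros)
  qed
  then have "v (x + 2 * pi) - v x = v (0 + 2 * pi) - v 0" for x
    using DERIV_isconst_all[of "\<lambda>x. v (x + 2 * pi) - v x" x 0] by blast
  moreover have "v (2 * pi) - v 0 = 0"
    using integral_circ_FTC[OF w v] mean by simp
  ultimately have "v \<in> Cper" by (intro CperI continuous_on_DERIV[OF v]) auto
  then show thesis using that v by (simp add: v_def)
qed

lemma integral_circ_DERIV:
  assumes "v \<in> Cper" "w \<in> Cper" "\<And>x. (v has_real_derivative w x) (at x)"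
  shows "(LINT x|circ. w x) = 0"
  using integral_circ_FTC[OF assms(2,3)] Cper_periodic[OF assms(1), of 0] by simp

lemma integral_circ_bound:
  assumes w: "w \<in> Cper" and B: "\<And>x. \<bar>w x\<bar> \<le> B"
  shows "\<bar>LINT x|circ. w x\<bar> \<le> 2 * pi * B"
proof -
  have "\<bar>LINT x|circ. w x\<bar> \<le> (LINT x|circ. \<bar>w x\<bar>)" by (rule integral_abs_bound)
  also have "\<dots> \<le> (LINT x|circ. B)"
    using B by (intro integral_mono integrable_Cper w Cper_intros) auto
  finally show ?thesis by (simp add: integral_circ_const)
qed

lemma Cper_bound_of_DERIV:
  assumes v: "v \<in> Cper" "\<And>x. (v has_real_derivative w x) (at x)" and w: "\<And>x. \<bar>w x\<bar> \<le> B"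
    and v0: "v y = 0"
  shows "\<bar>v x\<bar> \<le> 2 * pi * B"
proof -
  obtain n :: int where n: "(x - y) + 2 * pi * of_int n \<in> {0..<2 * pi}"
    using fundamental_domain[of "x - y"] by blast
  define z where "z = x + 2 * pi * of_int n"
  have z: "y \<le> z" "z - y \<le> 2 * pi" using n by (auto simp: z_def)
  have "norm (v z - v y) \<le> B * norm (z - y)"
    by (rule field_differentiable_bound[of UNIV v w B]) (use v w in auto)
  also have "\<dots> \<le> B * (2 * pi)"
    using z w[of 0] by (intro mult_left_mono) auto
  finally show ?thesis using v0 Cper_shift[OF v(1), of x n] by (simp add: z_def mult.commute)
qed

text \<open>Only \<open>v'\<close> is approximated, uniformly by a test function; its periodic
  antiderivative \<open>V\<close> is then a test function close to \<open>v\<close>, by integration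
  over one period. This enlarges the class of admissible test functions from smooth to C^1.\<close>

lemma pairing_weak_deriv_C1:
  assumes fg: "has_weak_deriv 1 f g" and v: "v \<in> Cper" and v': "v' \<in> Cper"
    and der: "\<And>x. (v has_real_derivative v' x) (at x)"
  shows "pairing f v' = - pairing g v"
proof -
  define K where "K = 2 * norm f + 4 * pi * norm g"
  have K: "K \<ge> 0" by (simp add: K_def)
  have "\<bar>pairing f v' + pairing g v\<bar> \<le> e" if "e > 0" for e
  proof -
    define d where "d = e / (K + 1)"
    have d: "d > 0" using that K by (simp add: d_def)
    obtain w where w: "test_function w" "\<And>x. \<bar>v' x - w x\<bar> < d"
      using Cper_approx_test_function[OF v' d] by metis
    \<comment> \<open>Without its mean \<open>w\<close> has a periodic antiderivative. The
      correction is harmless: \<open>v'\<close> integrates to 0, so \<open>m\<close> is no larger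
      than the approximation error \<open>d\<close>.\<close>
    define m where "m = (LINT x|circ. w x) / (2 * pi)"
    define w' where "w' x = w x - m" for x
    have w': "test_function w'" unfolding w'_def by (rule test_function_diff_const[OF w(1)])
    note wC = test_function_Cper[OF w(1)] and w'C = test_function_Cper[OF w']
    have "(LINT x|circ. w' x) = 0"
      unfolding w'_def using wC by (simp add: integrable_Cper integral_circ_const m_def)
    then obtain V where V: "V \<in> Cper" "\<And>x. (V has_real_derivative w' x) (at x)" "V 0 = v 0"
      using Cper_antiderivative[OF w'C, of 0 "v 0"] by metis
    have Vt: "test_function V"
      by (rule test_functionI[OF _ V(2) w']) (simp add: Cper_periodic[OF V(1)])
    have "(LINT x|circ. v' x - w x) = - 2 * pi * m"
      using integral_circ_DERIV[OF v v' der] v' wC by (simp add: integrable_Cper m_def)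
    then have "2 * pi * \<bar>m\<bar> \<le> 2 * pi * d"
      using integral_circ_bound[OF Cper_diff[OF v' wC], of d] w(2)
      by (simp add: abs_mult less_imp_le)
    then have m: "\<bar>m\<bar> \<le> d" by simp
    have 1: "\<bar>v' x - w' x\<bar> \<le> 2 * d" for x
      using w(2)[of x] m by (simp add: w'_def)
    have 2: "\<bar>v x - V x\<bar> \<le> 2 * pi * (2 * d)" for x
      by (rule Cper_bound_of_DERIV[where v = "\<lambda>x. v x - V x" and y = 0, OF Cper_diff[OF v V(1)] _ 1])
         (auto intro!: DERIV_diff der V(2) simp: V(3))
    have "deriv V = w'" using V(2) by (auto intro: DERIV_imp_deriv)
    then have "pairing f w' = - pairing g V" using fg Vt unfolding has_weak_deriv_1_iff by metis
    then have "pairing f v' + pairing g v = pairing f (\<lambda>x. v' x - w' x) + pairing g (\<lambda>x. v x - V x)"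
      using v v' w'C V(1) by (simp add: pairing_diff)
    also have "\<bar>\<dots>\<bar> \<le> 2 * d * norm f + 2 * pi * (2 * d) * norm g"
      using pairing_bound[OF Cper_diff[OF v' w'C] 1, of f] pairing_bound[OF Cper_diff[OF v V(1)] 2, of g]
      by linarith
    also have "\<dots> = d * K" by (simp add: K_def algebra_simps)
    also have "\<dots> \<le> e" using that K by (simp add: d_def field_simps)
    finally show ?thesis .
  qed
  then have "\<bar>pairing f v' + pairing g v\<bar> \<le> 0" by (rule field_le_epsilon) simp
  then show ?thesis by simp
qed

lemma integral_circ_by_parts:
  assumes v: "v \<in> Cper" "v' \<in> Cper" "\<And>x. (v has_real_derivative v' x) (at x)"
    and w: "w \<in> Cper" "w' \<in> Cper" "\<And>x. (w has_real_derivative w' x) (at x)"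
  shows "(LINT x|circ. v x * w' x) = - (LINT x|circ. v' x * w x)"
proof -
  have "(LINT x|circ. v' x * w x + v x * w' x) = 0"
    by (rule integral_circ_DERIV[of "\<lambda>x. v x * w x"])
       (auto intro!: Cper_intros v w derivative_eq_intros)
  then show ?thesis
    using v w by (simp add: integrable_Cper Cper_mult)
qed

lemma has_weak_deriv_C1:
  assumes v: "v \<in> Cper" "v' \<in> Cper" "\<And>x. (v has_real_derivative v' x) (at x)"
  shows "has_weak_deriv 1 (abs_L1 v) (abs_L1 v')"
  unfolding has_weak_deriv_1_iff
  using integral_circ_by_parts[OF v] v test_function_Cper test_function_deriv test_function_DERIV
  by (simp add: pairing_abs_L1_Cper)

lemma Sobolev_1_iff: "f \<in> Sobolev 1 \<longleftrightarrow> (\<exists>g. has_weak_deriv 1 f g)"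
  unfolding Sobolev_def using has_weak_deriv_0[of f] by (auto simp: le_Suc_eq)

lemma Sobolev_1_weak_deriv: "f \<in> Sobolev 1 \<Longrightarrow> has_weak_deriv 1 f (weak_deriv 1 f)"
  unfolding Sobolev_1_iff using weak_deriv_eqI by blast

lemma Sobolev_norm_1: "Sobolev_norm 1 f = norm f + norm (weak_deriv 1 f)"
  by (simp add: Sobolev_norm_def weak_deriv_eqI[OF has_weak_deriv_0])

lemma Sobolev_mono: "j \<le> k \<Longrightarrow> Sobolev k \<subseteq> Sobolev j"
  by (auto simp: Sobolev_def)

lemma Sobolev_norm_mono: "j \<le> k \<Longrightarrow> Sobolev_norm j f \<le> Sobolev_norm k f"
  unfolding Sobolev_norm_def by (intro sum_mono2) auto

lemma Sobolev_norm_nonneg: "0 \<le> Sobolev_norm k f"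
  unfolding Sobolev_norm_def by (intro sum_nonneg) auto

lemma norm_le_Sobolev_norm: "norm f \<le> Sobolev_norm 1 f"
  by (simp add: Sobolev_norm_1 del: One_nat_def)

lemma Sobolev_1_add: "f \<in> Sobolev 1 \<Longrightarrow> g \<in> Sobolev 1 \<Longrightarrow> f + g \<in> Sobolev 1"
  and Sobolev_1_diff: "f \<in> Sobolev 1 \<Longrightarrow> g \<in> Sobolev 1 \<Longrightarrow> f - g \<in> Sobolev 1"
  and Sobolev_1_scaleR: "f \<in> Sobolev 1 \<Longrightarrow> c *\<^sub>R f \<in> Sobolev 1"
  unfolding Sobolev_1_iff using has_weak_deriv_add has_weak_deriv_diff has_weak_deriv_scaleR by blast+

lemma Sobolev_norm_add:
  assumes "f \<in> Sobolev 1" "g \<in> Sobolev 1"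
  shows "Sobolev_norm 1 (f + g) \<le> Sobolev_norm 1 f + Sobolev_norm 1 g"
proof -
  have "weak_deriv 1 (f + g) = weak_deriv 1 f + weak_deriv 1 g"
    by (intro weak_deriv_eqI has_weak_deriv_add Sobolev_1_weak_deriv assms)
  then show ?thesis
    using norm_triangle_ineq[of f g] norm_triangle_ineq[of "weak_deriv 1 f" "weak_deriv 1 g"]
    by (simp add: Sobolev_norm_1 del: One_nat_def)
qed

lemma Sobolev_norm_scaleR:
  assumes "f \<in> Sobolev 1" shows "Sobolev_norm 1 (c *\<^sub>R f) = \<bar>c\<bar> * Sobolev_norm 1 f"
proof -
  have "weak_deriv 1 (c *\<^sub>R f) = c *\<^sub>R weak_deriv 1 f"
    by (intro weak_deriv_eqI has_weak_deriv_scaleR Sobolev_1_weak_deriv assms)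
  then show ?thesis by (simp add: Sobolev_norm_1 distrib_left del: One_nat_def)
qed

lemma Sobolev_norm_diff:
  assumes "f \<in> Sobolev 1" "g \<in> Sobolev 1"
  shows "Sobolev_norm 1 (f - g) \<le> Sobolev_norm 1 f + Sobolev_norm 1 g"
  using Sobolev_norm_add[OF assms(1) Sobolev_1_scaleR[OF assms(2), of "-1"]]
    Sobolev_norm_scaleR[OF assms(2), of "-1"] by simp

section \<open>The transfer operator is dual to composition\<close>

text \<open>The substitution is carried out for the completed measure; Borel measurability of the
  integrand \<open>F\<close> on the image brings integrability back to
  \<open>lborel\<close>.\<close>

lemma lborel_change_of_variables:
  fixes g F :: "real \<Rightarrow> real"
  assumes S: "S \<in> sets borel" and gS: "g ` S \<in> sets borel"
    and g: "\<And>x. x \<in> S \<Longrightarrow> (g has_real_derivative g' x) (at x)" and inj: "inj_on g S"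
    and F: "(\<lambda>x. indicator (g ` S) x * F x) \<in> borel_measurable borel"
    and int: "integrable lborel (\<lambda>x. indicator S x * (\<bar>g' x\<bar> * F (g x)))"
  shows "integrable lborel (\<lambda>x. indicator (g ` S) x * F x)"
    and "(LINT x|lborel. indicator (g ` S) x * F x) = (LINT x|lborel. indicator S x * (\<bar>g' x\<bar> * F (g x)))"
proof -
  have SL: "S \<in> sets lebesgue" using S by auto
  have int': "(\<lambda>x. \<bar>g' x\<bar> * F (g x)) absolutely_integrable_on S"
    unfolding set_integrable_def using int by (simp add: integrable_completion)
  have cov: "F absolutely_integrable_on (g ` S) \<and>
      integral (g ` S) F = integral S (\<lambda>x. \<bar>g' x\<bar> * F (g x))"
    using has_absolute_integral_change_of_variables_1'[OF SL _ inj, of g' F] g int'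
    by (blast intro: has_field_derivative_at_within)
  have "integrable lebesgue (\<lambda>x. indicator (g ` S) x * F x)"
    using cov by (simp add: set_integrable_def)
  then show *: "integrable lborel (\<lambda>x. indicator (g ` S) x * F x)"
    using integrable_completion[of "\<lambda>x. indicator (g ` S) x * F x" lborel] F by simp
  have "(LINT x|lborel. indicator (g ` S) x * F x) = (LINT x:g ` S|lebesgue. F x)"
    unfolding set_lebesgue_integral_def using * by (simp add: integral_completion)
  also have "\<dots> = (LINT x:S|lebesgue. \<bar>g' x\<bar> * F (g x))"
    using cov int' by (simp add: set_lebesgue_integral_eq_integral)
  also have "\<dots> = (LINT x|lborel. indicator S x * (\<bar>g' x\<bar> * F (g x)))"
    unfolding set_lebesgue_integral_def using int by (simp add: integral_completion)
  finally show "(LINT x|lborel. indicator (g ` S) x * F x) = (LINT x|lborel. indicator S x * (\<bar>g' x\<bar> * F (g x)))" .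
qed

locale expanding_circle_map =
  fixes T T' T'' :: "real \<Rightarrow> real" and \<sigma> :: real and d :: int
  assumes T_add_period: "T (x + 2 * pi) = T x + 2 * pi * of_int d"
    and T_DERIV: "(T has_real_derivative T' x) (at x)"
    and T'_DERIV: "(T' has_real_derivative T'' x) (at x)"
    and T''_continuous: "continuous_on UNIV T''"
    and \<sigma>: "\<sigma> > 1"
    and T'_gt: "\<sigma> < \<bar>T' x\<bar>"
begin

lemma deriv_T: "deriv T = T'"
  using T_DERIV by (auto intro: DERIV_imp_deriv)

lemma T'_nonzero: "T' x \<noteq> 0"
  using T'_gt[of x] \<sigma> by auto

lemma T_continuous: "continuous_on S T"
  by (meson T_DERIV DERIV_isCont continuous_at_imp_continuous_on)

lemma T'_continuous: "continuous_on S T'"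
  by (meson T'_DERIV DERIV_isCont continuous_at_imp_continuous_on)

text \<open>For the lift the mean value theorem holds at all distances, so expansion is global on
  the line and injectivity follows, although the circle map itself may be many-to-one.\<close>

lemma T_expands: "\<sigma> * \<bar>x - y\<bar> \<le> \<bar>T x - T y\<bar>"
proof -
  have *: "\<sigma> * \<bar>b - a\<bar> \<le> \<bar>T b - T a\<bar>" if ab: "a < b" for a b
  proof -
    obtain z where "T b - T a = (b - a) * T' z"
      using MVT2[OF ab, of T T'] T_DERIV by blast
    then show ?thesis using T'_gt[of z] ab by (simp add: abs_mult mult.commute)
  qed
  show ?thesis
    using *[of x y] *[of y x] by (cases x y rule: linorder_cases) (auto simp: abs_minus_commute)
qed

lemma T_inj: "inj T"
proof (rule injI)
  fix x y assume "T x = T y"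
  then have "\<sigma> * \<bar>x - y\<bar> \<le> 0" using T_expands[of x y] by simp
  then show "x = y" using \<sigma> by (simp add: mult_le_0_iff)
qed

lemma T_shift: "T (x + 2 * pi * of_int n) = T x + 2 * pi * of_int (d * n)"
  using periodic_shift[of "\<lambda>x. T x - of_int d * x" x n] T_add_period by (simp add: algebra_simps)

lemma T_surj: "surj T"
proof -
  have d: "d \<noteq> 0"
  proof
    assume "d = 0"
    then have "T (0 + 2 * pi) = T 0" using T_add_period[of 0] by simp
    then show False using injD[OF T_inj] by fastforce
  qed
  have "y \<in> range T" for y
  proof -
    \<comment> \<open>Over \<open>d * k\<close> periods \<open>T\<close> grows by
      \<open>2 * pi * d * d * k\<close>, which is at least \<open>k\<close> for either sign of
      \<open>d\<close>. Values of \<open>T\<close> therefore bracket \<open>y\<close>.\<close>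
    define k where "k = \<lceil>\<bar>y - T 0\<bar>\<rceil>"
    have k: "\<bar>y - T 0\<bar> \<le> of_int k" "0 \<le> k" unfolding k_def by linarith+
    define E where "E = 2 * pi * of_int (d * (d * k))"
    have "k \<le> d * (d * k)"
    proof -
      have "1 \<le> d * d"
        using d by (metis int_one_le_iff_zero_less not_square_less_zero linorder_neqE mult_eq_0_iff)
      then show ?thesis using mult_right_mono[of 1 "d * d" k] k(2) by (simp add: mult.assoc)
    qed
    then have kd: "of_int k \<le> (of_int (d * (d * k)) :: real)" by (simp only: of_int_le_iff)
    moreover have "0 \<le> (of_int k :: real)" using k(2) by simp
    ultimately have "0 \<le> (of_int (d * (d * k)) :: real)" by linarith
    from mult_right_mono[OF _ this, of 1 "2 * pi"] have "of_int (d * (d * k)) \<le> E"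
      unfolding E_def using pi_gt3 by simp
    moreover have "T (0 + 2 * pi * of_int (- (d * k))) = T 0 - E" "T (0 + 2 * pi * of_int (d * k)) = T 0 + E"
      unfolding T_shift E_def by simp_all
    ultimately have 1: "T (0 + 2 * pi * of_int (- (d * k))) \<le> y" "y \<le> T (0 + 2 * pi * of_int (d * k))"
      using k(1) kd by linarith+
    have "connected (range T)"
      by (intro connected_continuous_image T_continuous connected_UNIV)
    then show ?thesis
      using connected_contains_Icc[of "range T"] 1 by (meson atLeastAtMost_iff rangeI subsetD)
  qed
  then show ?thesis by blast
qed

text \<open>The inverse branches of the circle map are the functions
  \<open>G (x + 2 * pi * of_int m)\<close>, restricted to those \<open>x\<close> for which the value
  lies in the fundamental domain.\<close>

definition G :: "real \<Rightarrow> real" where "G = inv T"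

lemma T_G [simp]: "T (G x) = x" and G_T [simp]: "G (T x) = x"
  unfolding G_def using T_inj T_surj by (simp_all add: surj_f_inv_f)

lemma G_continuous: "continuous_on S G"
proof -
  have "\<bar>G x - G y\<bar> \<le> \<bar>x - y\<bar>" for x y
  proof -
    have "1 * \<bar>G x - G y\<bar> \<le> \<sigma> * \<bar>G x - G y\<bar>" using \<sigma> by (intro mult_right_mono) auto
    also have "\<dots> \<le> \<bar>x - y\<bar>" using T_expands[of "G x" "G y"] by simp
    finally show ?thesis by simp
  qed
  then show ?thesis
    unfolding continuous_on_iff dist_real_def by (metis le_less_trans)
qed

lemma G_measurable [measurable]: "G \<in> borel_measurable borel"
  by (intro borel_measurable_continuous_onI G_continuous)

lemma T_measurable [measurable]: "T \<in> borel_measurable borel"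
  by (intro borel_measurable_continuous_onI T_continuous)

lemma T'_measurable [measurable]: "T' \<in> borel_measurable borel"
  by (intro borel_measurable_continuous_onI T'_continuous)

text \<open>Compactness leaves finitely many branches, so the sum over preimages can be written over
  one index range that does not depend on \<open>x\<close>.\<close>

lemma T_winding_bounded:
  obtains M :: int where
    "\<And>x y m. x \<in> {0..<2 * pi} \<Longrightarrow> y \<in> {0..<2 * pi} \<Longrightarrow> T y = x + 2 * pi * of_int m \<Longrightarrow> m \<in> {-M..M}"
proof -
  have "compact (T ` {0..2 * pi})"
    by (intro compact_continuous_image T_continuous compact_Icc)
  then obtain B where "\<forall>z\<in>T ` {0..2 * pi}. norm z \<le> B"
    using compact_imp_bounded bounded_iff by blast
  then have B: "\<bar>T y\<bar> \<le> B" if "y \<in> {0..2 * pi}" for y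
    using that by auto
  show thesis
  proof (rule that[of "\<lceil>B + 2 * pi\<rceil>"])
    fix x y :: real and m :: int
    assume *: "x \<in> {0..<2 * pi}" "y \<in> {0..<2 * pi}" "T y = x + 2 * pi * of_int m"
    have "2 * pi * \<bar>of_int m\<bar> = \<bar>T y - x\<bar>" using *(3) by (simp add: abs_mult)
    also have "\<dots> \<le> B + 2 * pi" using B[of y] * by auto
    finally have "2 * pi * \<bar>of_int m\<bar> \<le> B + 2 * pi" .
    moreover have "\<bar>of_int m\<bar> \<le> 2 * pi * \<bar>of_int m :: real\<bar>"
      using pi_gt3 mult_right_mono[of 1 "2 * pi" "\<bar>of_int m :: real\<bar>"] by simp
    ultimately have "\<bar>of_int m :: real\<bar> \<le> B + 2 * pi" by linarith
    then have "\<bar>of_int m :: real\<bar> \<le> of_int \<lceil>B + 2 * pi\<rceil>" by linarith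
    then have "\<bar>m\<bar> \<le> \<lceil>B + 2 * pi\<rceil>" by linarith
    then show "m \<in> {- \<lceil>B + 2 * pi\<rceil>..\<lceil>B + 2 * pi\<rceil>}" by auto
  qed
qed

text \<open>Preimages are indexed by their winding number \<open>m\<close>, which determines them
  because \<open>T\<close> is injective on the line. The indicators absorb the dependence on
  \<open>x\<close>, so each branch can be integrated separately.\<close>

lemma sum_circ_preimage:
  fixes f :: "real \<Rightarrow> real"
  assumes M: "\<And>x y m. x \<in> {0..<2 * pi} \<Longrightarrow> y \<in> {0..<2 * pi} \<Longrightarrow> T y = x + 2 * pi * of_int m \<Longrightarrow> m \<in> {-M..M}"
    and x: "x \<in> {0..<2 * pi}"
  shows "(\<Sum>y\<in>circ_preimage T x. f y) =
    (\<Sum>m\<in>{-M..M}. indicator {0..<2 * pi} (G (x + 2 * pi * of_int m)) * f (G (x + 2 * pi * of_int m)))"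
proof -
  let ?I = "{m \<in> {-M..M}. G (x + 2 * pi * of_int m) \<in> {0..<2 * pi}}"
  let ?h = "\<lambda>m. G (x + 2 * pi * of_int m)"
  have "bij_betw ?h ?I (circ_preimage T x)"
  proof (rule bij_betw_imageI)
    show "inj_on ?h ?I"
    proof (rule inj_onI)
      fix m n assume "?h m = ?h n"
      then have "T (?h m) = T (?h n)" by simp
      then show "m = n" by simp
    qed
    show "?h ` ?I = circ_preimage T x"
    proof (intro equalityI subsetI)
      fix y assume "y \<in> circ_preimage T x"
      then obtain m :: int where m: "y \<in> {0..<2 * pi}" "T y = x + 2 * pi * of_int m"
        by (auto simp: circ_preimage_def)
      then have "y = ?h m" by (metis G_T)
      moreover have "m \<in> ?I" using M[OF x m] m \<open>y = ?h m\<close> by auto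
      ultimately show "y \<in> ?h ` ?I" by blast
    qed (auto simp: circ_preimage_def)
  qed
  then have "(\<Sum>y\<in>circ_preimage T x. f y) = (\<Sum>m\<in>?I. f (?h m))"
    by (rule sum.reindex_bij_betw[symmetric])
  also have "\<dots> = (\<Sum>m\<in>{-M..M}. if ?h m \<in> {0..<2 * pi} then f (?h m) else 0)"
    by (rule sum.inter_filter) simp
  also have "\<dots> = (\<Sum>m\<in>{-M..M}. indicator {0..<2 * pi} (?h m) * f (?h m))"
    by (intro sum.cong) (auto simp: indicator_def)
  finally show ?thesis .
qed

lemma Cper_comp_T: "u \<in> Cper \<Longrightarrow> (\<lambda>x. u (T x)) \<in> Cper"
proof (rule CperI)
  assume u: "u \<in> Cper"
  show "continuous_on UNIV (\<lambda>x. u (T x))"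
    using Cper_continuous[OF u, of UNIV] T_continuous by (rule continuous_on_compose2) auto
  show "u (T (x + 2 * pi)) = u (T x)" for x
    by (simp add: T_add_period Cper_shift[OF u])
qed

text \<open>Substituting \<open>x = T y - 2 * pi * of_int m\<close> produces the Jacobian
  \<open>\<bar>T' y\<bar>\<close>, which cancels the weight of the transfer operator; periodicity of
  \<open>u\<close> removes the translation.\<close>

lemma transfer_branch:
  fixes m :: int
  assumes f: "integrable circ f" and u: "u \<in> Cper"
  defines "B \<equiv> \<lambda>x. indicator {0..<2 * pi} x * (indicator {0..<2 * pi} (G (x + 2 * pi * of_int m)) *
      (f (G (x + 2 * pi * of_int m)) / \<bar>T' (G (x + 2 * pi * of_int m))\<bar>) * u x)"
  shows "integrable lborel B"
    and "(LINT x|lborel. B x) = (LINT y|lborel. indicator {0..<2 * pi} y *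
      indicator {0..<2 * pi} (T y - 2 * pi * of_int m) * (f y * u (T y)))"
proof -
  define S where "S = {y \<in> {0..<2 * pi}. T y - 2 * pi * of_int m \<in> {0..<2 * pi}}"
  define g where "g y = T y - 2 * pi * of_int m" for y
  define F where "F x = f (G (x + 2 * pi * of_int m)) / \<bar>T' (G (x + 2 * pi * of_int m))\<bar> * u x" for x
  have gS: "g ` S = {x \<in> {0..<2 * pi}. G (x + 2 * pi * of_int m) \<in> {0..<2 * pi}}"
  proof (intro equalityI subsetI)
    fix x assume "x \<in> {x \<in> {0..<2 * pi}. G (x + 2 * pi * of_int m) \<in> {0..<2 * pi}}"
    then have "G (x + 2 * pi * of_int m) \<in> S" "x = g (G (x + 2 * pi * of_int m))"
      by (auto simp: S_def g_def)
    then show "x \<in> g ` S" by blast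
  qed (auto simp: S_def g_def)
  have "{y. T y - 2 * pi * of_int m \<in> {0..<2 * pi}} \<in> sets borel"
    by measurable
  then have S: "S \<in> sets borel"
    unfolding S_def by (simp add: Collect_conj_eq)
  have "{x. G (x + 2 * pi * of_int m) \<in> {0..<2 * pi}} \<in> sets borel" by measurable
  then have gS': "g ` S \<in> sets borel" unfolding gS by (simp add: Collect_conj_eq)
  have um [measurable]: "u \<in> borel_measurable borel" by (rule Cper_measurable[OF u])
  have fm: "(\<lambda>y. indicator {0..<2 * pi} y * f y) \<in> borel_measurable borel"
    using f unfolding integrable_circ_iff by (auto dest: borel_measurable_integrable)
  have uT: "u (T y - 2 * pi * of_int m) = u (T y)" for y
    using Cper_shift[OF u, of "T y" "-m"] by simp
  have B: "B = (\<lambda>x. indicator (g ` S) x * F x)"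
    unfolding B_def gS F_def by (auto simp: indicator_def fun_eq_iff)
  \<comment> \<open>On the image of \<open>S\<close> the argument of \<open>f\<close> lies in the
    fundamental domain. Inserting the indicator there matters because \<open>f\<close> is known to
    be measurable only on that domain.\<close>
  have BF: "(\<lambda>x. indicator (g ` S) x * F x) = (\<lambda>x. indicator (g ` S) x *
      (((\<lambda>y. indicator {0..<2 * pi} y * f y) (G (x + 2 * pi * of_int m))) /
        \<bar>T' (G (x + 2 * pi * of_int m))\<bar> * u x))"
    unfolding F_def gS by (auto simp: indicator_def fun_eq_iff)
  have Bm: "(\<lambda>x. indicator (g ` S) x * F x) \<in> borel_measurable borel"
    unfolding BF
    by (intro borel_measurable_times borel_measurable_divide um borel_measurable_indicator gS'
          borel_measurable_abs measurable_compose[OF _ fm] measurable_compose[OF _ T'_measurable]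
          measurable_compose[OF _ G_measurable]) measurable
  have eq: "indicator S y * (\<bar>T' y\<bar> * F (g y)) = indicator {0..<2 * pi} y *
      indicator {0..<2 * pi} (T y - 2 * pi * of_int m) * (f y * u (T y))" for y
    using T'_nonzero[of y] by (auto simp: S_def F_def g_def uT indicator_def)
  have "integrable lborel (\<lambda>y. indicator {0..<2 * pi} y * (f y * u (T y)))"
    using integrable_mult_Cper[OF f Cper_comp_T[OF u]] unfolding integrable_circ_iff .
  then have "integrable lborel (\<lambda>y. indicator S y *\<^sub>R (indicator {0..<2 * pi} y * (f y * u (T y))))"
    by (rule integrable_mult_indicator[rotated]) (use S in simp)
  also have "(\<lambda>y. indicator S y *\<^sub>R (indicator {0..<2 * pi} y * (f y * u (T y)))) =
      (\<lambda>y. indicator S y * (\<bar>T' y\<bar> * F (g y)))"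
    unfolding eq by (auto simp: S_def indicator_def fun_eq_iff)
  finally have int: "integrable lborel (\<lambda>y. indicator S y * (\<bar>T' y\<bar> * F (g y)))" .
  have der: "(g has_real_derivative T' x) (at x)" for x
    unfolding g_def by (auto intro!: derivative_eq_intros T_DERIV)
  have inj: "inj_on g S" using injD[OF T_inj] by (auto simp: g_def inj_on_def)
  note cov = lborel_change_of_variables[OF S gS' der inj Bm int]
  show "integrable lborel B" unfolding B by (rule cov(1))
  show "(LINT x|lborel. B x) = (LINT y|lborel. indicator {0..<2 * pi} y *
      indicator {0..<2 * pi} (T y - 2 * pi * of_int m) * (f y * u (T y)))"
    unfolding B cov(2) eq ..
qed

text \<open>After the branchwise substitution the domains of integration partition the fundamental
  domain: \<open>T y\<close> lies in exactly one translate of it, so the indicators in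
  \<open>C\<close> add up to 1.\<close>

lemma transfer_integral:
  assumes f: "integrable circ f" and u: "u \<in> Cper"
  defines "P \<equiv> \<lambda>x. \<Sum>y\<in>circ_preimage T x. f y / \<bar>T' y\<bar>"
  shows "integrable circ (\<lambda>x. P x * u x)"
    and "(LINT x|circ. P x * u x) = (LINT y|circ. f y * u (T y))"
proof -
  obtain M :: int where
    M: "\<And>x y m. x \<in> {0..<2 * pi} \<Longrightarrow> y \<in> {0..<2 * pi} \<Longrightarrow> T y = x + 2 * pi * of_int m \<Longrightarrow> m \<in> {-M..M}"
    using T_winding_bounded by blast
  define B where "B m x = indicator {0..<2 * pi} x * (indicator {0..<2 * pi} (G (x + 2 * pi * of_int m)) *
      (f (G (x + 2 * pi * of_int m)) / \<bar>T' (G (x + 2 * pi * of_int m))\<bar>) * u x)" for m :: int and x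
  define C where "C m y = indicator {0..<2 * pi} y *
      indicator {0..<2 * pi} (T y - 2 * pi * of_int m) * (f y * u (T y))" for m :: int and y
  have B: "integrable lborel (B m)" "(LINT x|lborel. B m x) = (LINT y|lborel. C m y)" for m
    using transfer_branch[OF f u, of m] unfolding B_def[abs_def] C_def[abs_def] by auto
  have PB: "indicator {0..<2 * pi} x * (P x * u x) = (\<Sum>m\<in>{-M..M}. B m x)" for x
  proof (cases "x \<in> {0..<2 * pi}")
    case True
    have "P x = (\<Sum>m\<in>{-M..M}. indicator {0..<2 * pi} (G (x + 2 * pi * of_int m)) *
        (f (G (x + 2 * pi * of_int m)) / \<bar>T' (G (x + 2 * pi * of_int m))\<bar>))"
      unfolding P_def by (rule sum_circ_preimage[OF M True])
    then show ?thesis using True by (simp add: B_def sum_distrib_right)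
  next
    case False
    then show ?thesis by (simp add: B_def)
  qed
  show "integrable circ (\<lambda>x. P x * u x)"
    unfolding integrable_circ_iff PB using B(1) by simp
  have C_int: "integrable lborel (C m)" for m
  proof -
    have "integrable lborel (\<lambda>y. indicator {0..<2 * pi} y * (f y * u (T y)))"
      using integrable_mult_Cper[OF f Cper_comp_T[OF u]] unfolding integrable_circ_iff .
    moreover have "{y. T y - 2 * pi * of_int m \<in> {0..<2 * pi}} \<in> sets borel" by measurable
    ultimately have "integrable lborel (\<lambda>y. indicator {y. T y - 2 * pi * of_int m \<in> {0..<2 * pi}} y *\<^sub>R
        (indicator {0..<2 * pi} y * (f y * u (T y))))"
      by (intro integrable_mult_indicator) auto
    also have "(\<lambda>y. indicator {y. T y - 2 * pi * of_int m \<in> {0..<2 * pi}} y *\<^sub>R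
        (indicator {0..<2 * pi} y * (f y * u (T y)))) = C m"
      by (auto simp: C_def indicator_def fun_eq_iff)
    finally show ?thesis .
  qed
  have CT: "(\<Sum>m\<in>{-M..M}. C m y) = indicator {0..<2 * pi} y * (f y * u (T y))" for y
  proof (cases "y \<in> {0..<2 * pi}")
    case True
    obtain k :: int where k: "T y + 2 * pi * of_int k \<in> {0..<2 * pi}"
      using fundamental_domain by blast
    have kM: "- k \<in> {-M..M}"
      by (rule M[OF k True]) simp
    have uniq: "m = - k" if "T y - 2 * pi * of_int m \<in> {0..<2 * pi}" for m :: int
    proof -
      have "\<bar>2 * pi * (of_int m + of_int k)\<bar> < 2 * pi * 1"
        using that k by (auto simp: algebra_simps abs_if)
      then have "\<bar>of_int (m + k) :: real\<bar> < 1" by (simp add: abs_mult)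
      then have "m + k = 0" by linarith
      then show ?thesis by simp
    qed
    have "(\<Sum>m\<in>{-M..M}. C m y) = (\<Sum>m\<in>{-M..M}. if m = - k then f y * u (T y) else 0)"
      using True k uniq by (intro sum.cong) (auto simp: C_def indicator_def)
    then show ?thesis using kM True by simp
  qed (simp add: C_def)
  have "(LINT x|circ. P x * u x) = (\<Sum>m\<in>{-M..M}. LINT x|lborel. B m x)"
    unfolding integral_circ PB using B(1) by simp
  also have "\<dots> = (LINT y|lborel. (\<Sum>m\<in>{-M..M}. C m y))"
    unfolding B(2) using C_int by simp
  also have "\<dots> = (LINT y|circ. f y * u (T y))"
    unfolding integral_circ CT ..
  finally show "(LINT x|circ. P x * u x) = (LINT y|circ. f y * u (T y))" .
qed

abbreviation L :: "L1 \<Rightarrow> L1" where "L \<equiv> transfer_op T"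

theorem pairing_transfer: "u \<in> Cper \<Longrightarrow> pairing (L f) u = pairing f (\<lambda>x. u (T x))"
  using transfer_integral[OF integrable_rep_L1[of f], of u]
    \<comment> \<open>The case \<open>u = 1\<close> gives integrability of the preimage sum itself,
      so that it represents an element of \<open>L1\<close>.\<close>
    transfer_integral(1)[OF integrable_rep_L1[of f] Cper_const[of 1]]
  unfolding transfer_op_def deriv_T
  by (simp add: pairing_abs_L1) (simp add: pairing_def)

end

section \<open>The transfer operator on Sobolev functions\<close>

definition mult_L1 :: "(real \<Rightarrow> real) \<Rightarrow> L1 \<Rightarrow> L1" where
  "mult_L1 v f = abs_L1 (\<lambda>x. rep_L1 f x * v x)"

lemma pairing_mult_L1:
  "v \<in> Cper \<Longrightarrow> u \<in> Cper \<Longrightarrow> pairing (mult_L1 v f) u = pairing f (\<lambda>x. v x * u x)"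
  unfolding mult_L1_def
  by (simp add: pairing_abs_L1 integrable_mult_Cper) (simp add: pairing_def mult.assoc)

lemma norm_mult_L1:
  assumes v: "v \<in> Cper" and B: "\<And>x. \<bar>v x\<bar> \<le> B"
  shows "norm (mult_L1 v f) \<le> B * norm f"
proof (rule norm_L1_le_dual)
  fix u assume u: "u \<in> Cper" "\<And>x. \<bar>u x\<bar> \<le> (1::real)"
  have "\<bar>v x * u x\<bar> \<le> B" for x
    using mult_mono[OF B[of x] u(2)[of x]] B[of x] by (simp add: abs_mult)
  then have "\<bar>pairing f (\<lambda>x. v x * u x)\<bar> \<le> B * norm f"
    by (intro pairing_bound Cper_mult v u)
  then show "pairing (mult_L1 v f) u \<le> B * norm f"
    using pairing_mult_L1[OF v u(1)] by simp
qed

context expanding_circle_map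
begin

lemma norm_transfer: "norm (L f) \<le> norm f"
proof (rule norm_L1_le_dual)
  fix u assume u: "u \<in> Cper" "\<And>x. \<bar>u x\<bar> \<le> (1::real)"
  show "pairing (L f) u \<le> norm f"
    using pairing_bound[OF Cper_comp_T[OF u(1)] u(2), of f] by (simp add: pairing_transfer[OF u(1)])
qed

lemma mean_transfer: "mean (L f) = mean f"
  using pairing_transfer[of "\<lambda>_. 1" f] by (simp add: pairing_one)

lemma transfer_add: "L (f + g) = L f + L g"
  by (rule L1_eqI_dual) (simp add: pairing_transfer pairing_add_left Cper_comp_T)

lemma transfer_diff: "L (f - g) = L f - L g"
  by (rule L1_eqI_dual) (simp add: pairing_transfer pairing_diff_left Cper_comp_T)

lemma norm_transfer_funpow: "norm ((L ^^ n) f) \<le> norm f"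
  by (induction n) (auto intro: order_trans[OF norm_transfer])

lemma pairing_transfer_funpow:
  "u \<in> Cper \<Longrightarrow> (\<lambda>x. u ((T ^^ n) x)) \<in> Cper \<and> pairing ((L ^^ n) f) u = pairing f (\<lambda>x. u ((T ^^ n) x))"
proof (induction n arbitrary: u)
  case (Suc n)
  have "pairing ((L ^^ Suc n) f) u = pairing ((L ^^ n) f) (\<lambda>x. u (T x))"
    using Suc.prems by (simp add: pairing_transfer)
  then show ?case using Suc.IH[OF Cper_comp_T[OF Suc.prems]] by simp
qed simp

lemma T'_Cper: "T' \<in> Cper"
  by (intro CperI T'_continuous periodic_DERIV[OF T_add_period T_DERIV])

lemma T''_Cper: "T'' \<in> Cper"
  by (intro CperI T''_continuous periodic_DERIV[of T' _ 0, OF _ T'_DERIV])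
     (simp add: Cper_periodic[OF T'_Cper])

lemma inverse_T'_Cper: "(\<lambda>x. 1 / T' x) \<in> Cper"
  by (intro Cper_intros T'_Cper T'_nonzero)

text \<open>This is minus the derivative of \<open>1 / T'\<close>.\<close>

definition distortion :: "real \<Rightarrow> real" where "distortion x = T'' x / (T' x)\<^sup>2"

lemma distortion_Cper: "distortion \<in> Cper"
proof -
  have "(\<lambda>x. T'' x / (T' x * T' x)) \<in> Cper"
    by (intro Cper_intros T'_Cper T''_Cper) (simp add: T'_nonzero)
  then show ?thesis by (simp add: distortion_def[abs_def] power2_eq_square)
qed

text \<open>Strict positivity is demanded so that the cone parameter
  \<open>\<beta> * (\<sigma> + 1) / (\<sigma> - 1)\<close> used later is positive.\<close>

definition \<beta> :: real where "\<beta> = (SOME b. b > 0 \<and> (\<forall>x. \<bar>distortion x\<bar> \<le> b))"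

lemma \<beta>_pos: "\<beta> > 0" and distortion_le: "\<bar>distortion x\<bar> \<le> \<beta>"
proof -
  have "\<exists>b. b > 0 \<and> (\<forall>x. \<bar>distortion x\<bar> \<le> b)"
    using Cper_bounded[OF distortion_Cper] by metis
  from someI_ex[OF this] show "\<beta> > 0" "\<bar>distortion x\<bar> \<le> \<beta>"
    by (auto simp: \<beta>_def)
qed

lemma inverse_T'_le: "\<bar>1 / T' x\<bar> \<le> 1 / \<sigma>"
  using T'_gt[of x] \<sigma> by (simp add: frac_le)

text \<open>Differentiating \<open>u (T x) / T' x\<close> gives \<open>deriv u (T x)\<close> minus
  \<open>distortion x * u (T x)\<close>. The first term is what duality makes of
  \<open>deriv u\<close>, so the weak derivative of \<open>f\<close> can be moved onto this C^1
  function.\<close>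

lemma has_weak_deriv_transfer:
  assumes fg: "has_weak_deriv 1 f g"
  shows "has_weak_deriv 1 (L f) (L (mult_L1 (\<lambda>x. 1 / T' x) g - mult_L1 distortion f))"
  unfolding has_weak_deriv_1_iff
proof (intro allI impI)
  fix u assume u: "test_function u"
  note uC = test_function_Cper[OF u]
  note duC = test_function_Cper[OF test_function_deriv[OF u]]
  note uT = Cper_comp_T[OF uC] and duT = Cper_comp_T[OF duC]
  let ?v = "\<lambda>x. 1 / T' x * u (T x)"
  let ?w = "\<lambda>x. distortion x * u (T x)"
  have v: "?v \<in> Cper" and w: "?w \<in> Cper"
    by (intro Cper_mult inverse_T'_Cper distortion_Cper uT)+
  have der: "(?v has_real_derivative deriv u (T x) - ?w x) (at x)" for x
    unfolding distortion_def
    by (rule derivative_eq_intros DERIV_chain2[OF test_function_DERIV[OF u]] T_DERIV T'_DERIV refl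
          | simp add: T'_nonzero field_simps power2_eq_square)+
  have "pairing (L f) (deriv u) = pairing f (\<lambda>x. deriv u (T x) - ?w x) + pairing f ?w"
    by (simp add: pairing_transfer[OF duC] pairing_diff[OF duT w])
  also have "pairing f (\<lambda>x. deriv u (T x) - ?w x) = - pairing g ?v"
    by (rule pairing_weak_deriv_C1[OF fg v Cper_diff[OF duT w] der])
  also have "- pairing g ?v + pairing f ?w = - pairing (L (mult_L1 (\<lambda>x. 1 / T' x) g - mult_L1 distortion f)) u"
    by (simp add: pairing_transfer[OF uC] pairing_diff_left[OF uT] pairing_mult_L1[OF inverse_T'_Cper uT]
        pairing_mult_L1[OF distortion_Cper uT])
  finally show "pairing (L f) (deriv u) = - pairing (L (mult_L1 (\<lambda>x. 1 / T' x) g - mult_L1 distortion f)) u" .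
qed

lemma Sobolev_1_transfer: "f \<in> Sobolev 1 \<Longrightarrow> L f \<in> Sobolev 1"
  unfolding Sobolev_1_iff using has_weak_deriv_transfer by blast

lemma Sobolev_1_transfer_funpow: "f \<in> Sobolev 1 \<Longrightarrow> (L ^^ n) f \<in> Sobolev 1"
  by (induction n) (simp_all add: Sobolev_1_transfer del: One_nat_def)

lemma weak_deriv_transfer:
  "f \<in> Sobolev 1 \<Longrightarrow>
    weak_deriv 1 (L f) = L (mult_L1 (\<lambda>x. 1 / T' x) (weak_deriv 1 f) - mult_L1 distortion f)"
  by (intro weak_deriv_eqI has_weak_deriv_transfer Sobolev_1_weak_deriv)

lemma Lasota_Yorke:
  assumes "f \<in> Sobolev 1"
  shows "norm (weak_deriv 1 (L f)) \<le> norm (weak_deriv 1 f) / \<sigma> + \<beta> * norm f"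
proof -
  have "norm (weak_deriv 1 (L f)) \<le> norm (mult_L1 (\<lambda>x. 1 / T' x) (weak_deriv 1 f)) + norm (mult_L1 distortion f)"
    unfolding weak_deriv_transfer[OF assms] by (rule order_trans[OF norm_transfer norm_triangle_ineq4])
  also have "\<dots> \<le> 1 / \<sigma> * norm (weak_deriv 1 f) + \<beta> * norm f"
    by (intro add_mono norm_mult_L1 inverse_T'_Cper inverse_T'_le distortion_Cper distortion_le)
  finally show ?thesis by simp
qed

text \<open>The constant \<open>\<beta> * \<sigma> / (\<sigma> - 1)\<close> is
  \<open>\<beta>\<close> times the geometric series in \<open>1 / \<sigma>\<close>; it is uniform in
  \<open>n\<close> because \<open>L\<close> does not increase the L1 norm.\<close>

lemma Lasota_Yorke_funpow:
  assumes "f \<in> Sobolev 1"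
  shows "norm (weak_deriv 1 ((L ^^ n) f)) \<le> norm (weak_deriv 1 f) / \<sigma> ^ n + \<beta> * \<sigma> / (\<sigma> - 1) * norm f"
proof (induction n)
  case 0
  then show ?case using \<beta>_pos \<sigma> by simp
next
  case (Suc n)
  have "norm (weak_deriv 1 ((L ^^ Suc n) f)) \<le> norm (weak_deriv 1 ((L ^^ n) f)) / \<sigma> + \<beta> * norm ((L ^^ n) f)"
    using Lasota_Yorke[OF Sobolev_1_transfer_funpow[OF assms]] by simp
  also have "\<dots> \<le> (norm (weak_deriv 1 f) / \<sigma> ^ n + \<beta> * \<sigma> / (\<sigma> - 1) * norm f) / \<sigma> + \<beta> * norm f"
    using Suc \<sigma> \<beta>_pos by (intro add_mono divide_right_mono mult_left_mono norm_transfer_funpow) auto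
  also have "\<dots> = norm (weak_deriv 1 f) / \<sigma> ^ Suc n + \<beta> * \<sigma> / (\<sigma> - 1) * norm f"
    using \<sigma> by (simp add: field_simps)
  finally show ?case .
qed

end

section \<open>A cone of log-Lipschitz densities\<close>

text \<open>The cone of functions with \<open>|h'| \<le> a h\<close>, expressed by duality.\<close>

definition density_cone :: "real \<Rightarrow> L1 set" where
  "density_cone a = {h \<in> Sobolev 1. \<forall>w\<in>Cper. \<bar>pairing (weak_deriv 1 h) w\<bar> \<le> a * pairing h (\<lambda>x. \<bar>w x\<bar>)}"

lemma cone_Sobolev: "h \<in> density_cone a \<Longrightarrow> h \<in> Sobolev 1"
  by (simp add: density_cone_def)

lemma cone_bound: "h \<in> density_cone a \<Longrightarrow> w \<in> Cper \<Longrightarrow> \<bar>pairing (weak_deriv 1 h) w\<bar> \<le> a * pairing h (\<lambda>x. \<bar>w x\<bar>)"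
  by (simp add: density_cone_def)

text \<open>The left side of the cone inequality is an absolute value, so the cone condition already
  contains positivity of \<open>h\<close>.\<close>

lemma cone_pairing_nonneg:
  assumes h: "h \<in> density_cone a" and a: "a > 0" and v: "v \<in> Cper" "\<And>x. 0 \<le> v x"
  shows "0 \<le> pairing h v"
proof -
  have "0 \<le> a * pairing h (\<lambda>x. \<bar>v x\<bar>)" using cone_bound[OF h v(1)] by linarith
  then show ?thesis using a v(2) by (simp add: zero_le_mult_iff)
qed

lemma cone_pairing_mono:
  assumes h: "h \<in> density_cone a" and a: "a > 0" and "v \<in> Cper" "w \<in> Cper" "\<And>x. v x \<le> w x"
  shows "pairing h v \<le> pairing h w"
  using cone_pairing_nonneg[OF h a Cper_diff, of w v] assms by (simp add: pairing_diff)

lemma norm_cone_le_mean: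
  assumes h: "h \<in> density_cone a" and a: "a > 0"
  shows "norm h \<le> mean h"
proof (rule norm_L1_le_dual)
  fix u assume u: "u \<in> Cper" "\<And>x. \<bar>u x\<bar> \<le> (1::real)"
  have "pairing h u \<le> pairing h (\<lambda>x. 1)"
    using u by (intro cone_pairing_mono[OF h a]) (auto intro: order_trans[OF abs_ge_self])
  then show "pairing h u \<le> mean h" by (simp add: pairing_one)
qed

text \<open>Testing against \<open>v\<close> with \<open>v' + a v = u - const\<close> and \<open>v \<ge> 0\<close> gives a lower bound for \<open>h \<in> density_cone a\<close>.\<close>

lemma Cper_linear_ode:
  assumes a: "a > 0" and u: "u \<in> Cper" "\<And>x. 0 \<le> u x"
  obtains v v' where "v \<in> Cper" "v' \<in> Cper" "\<And>x. (v has_real_derivative v' x) (at x)"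
    "\<And>x. v' x + a * v x = u x" "\<And>x. exp (- (2 * pi * a)) / (exp (2 * pi * a) - 1) * (LINT x|circ. u x) \<le> v x"
proof -
  have cont: "continuous_on UNIV (\<lambda>t. exp (a * t) * u t)"
    by (intro continuous_intros Cper_continuous u)
  obtain E0 where E0: "\<And>x. (E0 has_real_derivative exp (a * x) * u x) (at x)"
    using continuous_has_antiderivative[OF cont] by blast
  define E where "E x = E0 x - E0 0" for x
  have E: "(E has_real_derivative exp (a * x) * u x) (at x)" for x
    unfolding E_def by (auto intro!: derivative_eq_intros E0)
  have E_0: "E 0 = 0" by (simp add: E_def)
  have E_mono: "E x \<le> E y" if "x \<le> y" for x y
    by (rule DERIV_nonneg_imp_nondecreasing[OF that]) (use E u(2) in force)
  define q where "q = exp (2 * pi * a)"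
  have q: "q > 1" using a by (simp add: q_def)
  \<comment> \<open>Variation of constants; \<open>A\<close> is the initial value that makes
    \<open>v\<close> periodic, as it solves \<open>A + E (2 * pi) = q * A\<close>.\<close>
  define A where "A = E (2 * pi) / (q - 1)"
  define v where "v x = exp (- (a * x)) * (A + E x)" for x
  define v' where "v' x = u x - a * v x" for x
  have der: "(v has_real_derivative v' x) (at x)" for x
    unfolding v_def[abs_def] v'_def
    by (auto intro!: derivative_eq_intros E simp: algebra_simps simp flip: exp_add)
  have per: "v (x + 2 * pi) = v x" for x
  proof -
    let ?k = "\<lambda>x. E (x + 2 * pi) - q * E x"
    have "(?k has_real_derivative 0) (at x)" for x
    proof -
      have "((\<lambda>x. E (x + 2 * pi)) has_real_derivative exp (a * (x + 2 * pi)) * u x) (at x)"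
        using E[of "x + 2 * pi"] by (simp add: DERIV_shift Cper_periodic[OF u(1)])
      then show ?thesis
        using E[of x] by (auto intro!: derivative_eq_intros simp: q_def algebra_simps exp_add)
    qed
    then have "?k x = ?k 0" using DERIV_isconst_all[of ?k x 0] by blast
    then have "E (x + 2 * pi) = q * E x + A * (q - 1)" using q by (simp add: E_0 A_def)
    then have "A + E (x + 2 * pi) = q * (A + E x)" by (simp add: algebra_simps)
    moreover have "exp (- (a * (x + 2 * pi))) * q = exp (- (a * x))"
      unfolding q_def by (simp add: algebra_simps flip: exp_add)
    ultimately show ?thesis unfolding v_def by (metis mult.assoc)
  qed
  have v: "v \<in> Cper" by (intro CperI continuous_on_DERIV[OF der] per)
  have v': "v' \<in> Cper" unfolding v'_def by (intro Cper_intros u v)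
  have E_ge: "(LINT x|circ. u x) \<le> E (2 * pi)"
  proof -
    obtain F where F: "\<And>x. (F has_real_derivative u x) (at x)"
      using continuous_has_antiderivative[OF Cper_continuous[OF u(1)]] by blast
    have "E 0 - F 0 \<le> E (2 * pi) - F (2 * pi)"
    proof (rule DERIV_nonneg_imp_nondecreasing[of 0 "2 * pi" "\<lambda>x. E x - F x"])
      fix x :: real assume "0 \<le> x"
      then have "1 * u x \<le> exp (a * x) * u x" using a u(2) by (intro mult_right_mono) auto
      then show "\<exists>y. ((\<lambda>x. E x - F x) has_real_derivative y) (at x) \<and> 0 \<le> y"
        by (intro exI[of _ "exp (a * x) * u x - u x"]) (auto intro!: derivative_eq_intros E F)
    qed simp
    then show ?thesis using integral_circ_FTC[OF u(1) F] E_0 by simp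
  qed
  have "exp (- (2 * pi * a)) / (q - 1) * (LINT x|circ. u x) \<le> v x" for x
  proof -
    obtain y where y: "y \<in> {0..<2 * pi}" "v x = v y"
      using periodic_value[of v x] per by metis
    have "0 \<le> E (2 * pi)" using E_mono[of 0 "2 * pi"] E_0 by simp
    then have A: "0 \<le> A" using q by (simp add: A_def)
    have "exp (- (2 * pi * a)) / (q - 1) * (LINT x|circ. u x) \<le> exp (- (2 * pi * a)) / (q - 1) * E (2 * pi)"
      using E_ge q by (intro mult_left_mono) auto
    also have "\<dots> = exp (- (2 * pi * a)) * A" by (simp add: A_def)
    also have "\<dots> \<le> exp (- (a * y)) * (A + E y)"
      using y a A E_mono[of 0 y] E_0 by (intro mult_mono) (auto simp: mult.commute)
    also have "\<dots> = v y" by (simp only: v_def)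
    also have "\<dots> = v x" by (simp only: y(2))
    finally show ?thesis .
  qed
  then show thesis using that[OF v v' der] by (simp add: v'_def q_def)
qed

text \<open>\<open>a\<close> times the lower bound from \<open>Cper_linear_ode\<close> for a
  right-hand side of integral 1.\<close>

definition harnack :: "real \<Rightarrow> real" where
  "harnack a = a * exp (- (2 * pi * a)) / (exp (2 * pi * a) - 1)"

lemma harnack_pos: "a > 0 \<Longrightarrow> harnack a > 0"
  by (simp add: harnack_def)

text \<open>The constant split off from a cone element thus has no more mass than the element, which
  keeps the contraction factor nonnegative.\<close>

lemma harnack_le: "a > 0 \<Longrightarrow> 2 * pi * harnack a \<le> 1"
proof -
  assume a: "a > 0"
  define x where "x = 2 * pi * a"
  have x: "x > 0" using a by (simp add: x_def)
  have "x * exp (- x) \<le> x * 1" using x by (intro mult_left_mono) auto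
  also have "\<dots> \<le> exp x - 1" using exp_ge_add_one_self[of x] by linarith
  finally show ?thesis using x by (simp add: harnack_def x_def[symmetric] field_simps) (simp add: x_def field_simps)
qed

text \<open>For \<open>w \<ge> 0\<close> of class C^1, integration by parts and the cone condition
  give a nonnegative pairing of \<open>h\<close> with \<open>w' + a * w\<close>. Lowering
  \<open>v\<close> by its bound \<open>\<kappa> / a\<close> keeps it nonnegative and turns this
  combination into \<open>u - \<kappa>\<close>.\<close>

lemma cone_lower_bound:
  assumes h: "h \<in> density_cone a" and a: "a > 0" and u: "u \<in> Cper" "\<And>x. 0 \<le> u x"
  shows "harnack a * mean h * (LINT x|circ. u x) \<le> pairing h u"
proof -
  define \<kappa> where "\<kappa> = harnack a * (LINT x|circ. u x)"
  obtain v v' where v: "v \<in> Cper" "v' \<in> Cper" "\<And>x. (v has_real_derivative v' x) (at x)"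
    "\<And>x. v' x + a * v x = u x" and v_ge: "\<And>x. \<kappa> / a \<le> v x"
    using Cper_linear_ode[OF a u] a by (auto simp: \<kappa>_def harnack_def)
  let ?w = "\<lambda>x. v x - \<kappa> / a"
  have w: "?w \<in> Cper" by (intro Cper_intros v)
  have der: "(?w has_real_derivative v' x) (at x)" for x
    by (auto intro!: derivative_eq_intros v(3))
  have "pairing h v' = - pairing (weak_deriv 1 h) ?w"
    by (rule pairing_weak_deriv_C1[OF Sobolev_1_weak_deriv[OF cone_Sobolev[OF h]] w v(2) der])
  moreover have "\<bar>pairing (weak_deriv 1 h) ?w\<bar> \<le> a * pairing h ?w"
    using cone_bound[OF h w] v_ge by simp
  ultimately have "0 \<le> pairing h v' + a * pairing h ?w" by linarith
  also have "\<dots> = pairing h (\<lambda>x. v' x + a * ?w x)"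
    using pairing_add[OF v(2) Cper_mult[OF Cper_const w], of h a] by (simp add: pairing_cmult)
  also have "(\<lambda>x. v' x + a * ?w x) = (\<lambda>x. u x - \<kappa>)"
    using a by (auto simp: algebra_simps simp flip: v(4))
  also have "pairing h \<dots> = pairing h u - \<kappa> * mean h"
    by (simp add: pairing_diff[OF u(1) Cper_const] pairing_const)
  finally show ?thesis by (simp add: \<kappa>_def mult_ac)
qed

abbreviation const_L1 :: "real \<Rightarrow> L1" where "const_L1 c \<equiv> abs_L1 (\<lambda>x. c)"

lemma mean_const_L1: "mean (const_L1 c) = 2 * pi * c"
  by (simp add: mean_abs_L1 integrable_Cper)

lemma has_weak_deriv_const_L1: "has_weak_deriv 1 (const_L1 c) (const_L1 0)"
  by (rule has_weak_deriv_C1) auto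

lemma pairing_const_L1: "u \<in> Cper \<Longrightarrow> pairing (const_L1 c) u = c * (LINT x|circ. u x)"
  by (simp add: pairing_abs_L1_Cper)

text \<open>Subtracting a constant leaves the derivative alone and, by the lower bound, keeps at
  least the fraction \<open>1 - s\<close> of \<open>h\<close> under every nonnegative observable.
  The aperture therefore grows by at most the factor \<open>1 / (1 - s)\<close>.\<close>

lemma cone_diff_const:
  assumes h: "h \<in> density_cone a" and a: "a > 0" and s: "0 \<le> s" "s < 1"
  shows "h - const_L1 (s * harnack a * mean h) \<in> density_cone (a / (1 - s))"
  unfolding density_cone_def
proof (intro CollectI conjI ballI)
  let ?c = "s * harnack a * mean h"
  have D: "has_weak_deriv 1 (h - const_L1 ?c) (weak_deriv 1 h - const_L1 0)"
    by (intro has_weak_deriv_diff has_weak_deriv_const_L1 Sobolev_1_weak_deriv cone_Sobolev[OF h])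
  then show "h - const_L1 ?c \<in> Sobolev 1" unfolding Sobolev_1_iff by blast
  fix w assume w: "w \<in> Cper"
  have "s * (harnack a * mean h * (LINT x|circ. \<bar>w x\<bar>)) \<le> s * pairing h (\<lambda>x. \<bar>w x\<bar>)"
    using s w by (intro mult_left_mono cone_lower_bound[OF h a] Cper_abs) auto
  then have "(1 - s) * pairing h (\<lambda>x. \<bar>w x\<bar>) \<le> pairing (h - const_L1 ?c) (\<lambda>x. \<bar>w x\<bar>)"
    by (simp add: pairing_diff_left pairing_const_L1 Cper_abs[OF w] algebra_simps)
  from mult_left_mono[OF this, of a]
  have "(a * pairing h (\<lambda>x. \<bar>w x\<bar>)) * (1 - s) \<le> a * pairing (h - const_L1 ?c) (\<lambda>x. \<bar>w x\<bar>)"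
    using a by (simp only: mult_ac less_imp_le)
  then have "a * pairing h (\<lambda>x. \<bar>w x\<bar>) \<le> a / (1 - s) * pairing (h - const_L1 ?c) (\<lambda>x. \<bar>w x\<bar>)"
    using s by (simp only: pos_le_divide_eq[symmetric] diff_gt_0_iff_gt times_divide_eq_left)
  moreover have "pairing (weak_deriv 1 (h - const_L1 ?c)) w = pairing (weak_deriv 1 h) w"
    unfolding weak_deriv_eqI[OF D] by (simp add: pairing_diff_left pairing_const_L1 w)
  ultimately show "\<bar>pairing (weak_deriv 1 (h - const_L1 ?c)) w\<bar>
      \<le> a / (1 - s) * pairing (h - const_L1 ?c) (\<lambda>x. \<bar>w x\<bar>)"
    using cone_bound[OF h w] by simp
qed

lemma C1_in_cone:
  assumes v: "v \<in> Cper" "v' \<in> Cper" "\<And>x. (v has_real_derivative v' x) (at x)"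
    and bound: "\<And>x. \<bar>v' x\<bar> \<le> a * v x"
  shows "abs_L1 v \<in> density_cone a"
  unfolding density_cone_def
proof (intro CollectI conjI ballI)
  note D = has_weak_deriv_C1[OF v]
  then show "abs_L1 v \<in> Sobolev 1" unfolding Sobolev_1_iff by blast
  fix w assume w: "w \<in> Cper"
  have "\<bar>pairing (abs_L1 v') w\<bar> \<le> (LINT x|circ. \<bar>v' x * w x\<bar>)"
    unfolding pairing_abs_L1_Cper[OF v(2) w] by (rule integral_abs_bound)
  also have "\<dots> \<le> (LINT x|circ. a * (v x * \<bar>w x\<bar>))"
  proof (intro integral_mono integrable_Cper Cper_intros v w)
    show "\<bar>v' x * w x\<bar> \<le> a * (v x * \<bar>w x\<bar>)" for x
      using mult_right_mono[OF bound[of x], of "\<bar>w x\<bar>"] by (simp add: abs_mult mult.assoc)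
  qed
  also have "\<dots> = a * pairing (abs_L1 v) (\<lambda>x. \<bar>w x\<bar>)"
    by (simp add: pairing_abs_L1_Cper v Cper_abs[OF w])
  finally show "\<bar>pairing (weak_deriv 1 (abs_L1 v)) w\<bar> \<le> a * pairing (abs_L1 v) (\<lambda>x. \<bar>w x\<bar>)"
    unfolding weak_deriv_eqI[OF D] .
qed

context expanding_circle_map
begin

text \<open>Multiplication by \<open>1 / T'\<close> shrinks the derivative term by
  \<open>\<sigma>\<close>, and the distortion term costs \<open>\<beta>\<close>. Positivity of
  \<open>h\<close> turns these pointwise bounds into bounds on pairings.\<close>

lemma transfer_cone:
  assumes h: "h \<in> density_cone a" and a: "a > 0"
  shows "L h \<in> density_cone (a / \<sigma> + \<beta>)"
  unfolding density_cone_def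
proof (intro CollectI conjI ballI Sobolev_1_transfer[OF cone_Sobolev[OF h]])
  fix w assume w: "w \<in> Cper"
  let ?wT = "\<lambda>x. w (T x)"
  note wT = Cper_comp_T[OF w]
  have "pairing (weak_deriv 1 (L h)) w =
      pairing (weak_deriv 1 h) (\<lambda>x. 1 / T' x * ?wT x) - pairing h (\<lambda>x. distortion x * ?wT x)"
    unfolding weak_deriv_transfer[OF cone_Sobolev[OF h]]
    by (simp add: pairing_transfer[OF w] pairing_diff_left[OF wT] pairing_mult_L1[OF inverse_T'_Cper wT]
        pairing_mult_L1[OF distortion_Cper wT])
  moreover have "\<bar>pairing (weak_deriv 1 h) (\<lambda>x. 1 / T' x * ?wT x)\<bar> \<le> a * (1 / \<sigma> * pairing h (\<lambda>x. \<bar>?wT x\<bar>))"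
  proof -
    have "\<bar>1 / T' x * ?wT x\<bar> \<le> 1 / \<sigma> * \<bar>?wT x\<bar>" for x
      unfolding abs_mult by (intro mult_right_mono inverse_T'_le) simp
    then have "pairing h (\<lambda>x. \<bar>1 / T' x * ?wT x\<bar>) \<le> pairing h (\<lambda>x. 1 / \<sigma> * \<bar>?wT x\<bar>)"
      by (intro cone_pairing_mono[OF h a] Cper_abs Cper_mult Cper_const inverse_T'_Cper wT)
    then have "pairing h (\<lambda>x. \<bar>1 / T' x * ?wT x\<bar>) \<le> 1 / \<sigma> * pairing h (\<lambda>x. \<bar>?wT x\<bar>)"
      unfolding pairing_cmult .
    then have "a * pairing h (\<lambda>x. \<bar>1 / T' x * ?wT x\<bar>) \<le> a * (1 / \<sigma> * pairing h (\<lambda>x. \<bar>?wT x\<bar>))"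
      by (rule mult_left_mono) (use a in simp)
    then show ?thesis
      using cone_bound[OF h Cper_mult[OF inverse_T'_Cper wT]] by (rule order_trans[rotated])
  qed
  moreover have "\<bar>pairing h (\<lambda>x. distortion x * ?wT x)\<bar> \<le> \<beta> * pairing h (\<lambda>x. \<bar>?wT x\<bar>)"
  proof -
    have "\<bar>distortion x * ?wT x\<bar> \<le> \<beta> * \<bar>?wT x\<bar>" for x
      unfolding abs_mult by (intro mult_right_mono distortion_le) simp
    then have "distortion x * ?wT x \<le> \<beta> * \<bar>?wT x\<bar>" "- (distortion x * ?wT x) \<le> \<beta> * \<bar>?wT x\<bar>" for x
      by (metis abs_le_D1, metis abs_le_D2)
    then have "pairing h (\<lambda>x. distortion x * ?wT x) \<le> pairing h (\<lambda>x. \<beta> * \<bar>?wT x\<bar>)"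
      "pairing h (\<lambda>x. - (distortion x * ?wT x)) \<le> pairing h (\<lambda>x. \<beta> * \<bar>?wT x\<bar>)"
      by (intro cone_pairing_mono[OF h a] Cper_intros distortion_Cper wT; simp)+
    then show ?thesis unfolding pairing_cmult pairing_uminus by linarith
  qed
  ultimately have "\<bar>pairing (weak_deriv 1 (L h)) w\<bar> \<le>
      a * (1 / \<sigma> * pairing h (\<lambda>x. \<bar>?wT x\<bar>)) + \<beta> * pairing h (\<lambda>x. \<bar>?wT x\<bar>)"
    by linarith
  also have "\<dots> = (a / \<sigma> + \<beta>) * pairing (L h) (\<lambda>x. \<bar>w x\<bar>)"
    by (simp add: pairing_transfer[OF Cper_abs[OF w]] algebra_simps)
  finally show "\<bar>pairing (weak_deriv 1 (L h)) w\<bar> \<le> (a / \<sigma> + \<beta>) * pairing (L h) (\<lambda>x. \<bar>w x\<bar>)" .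
qed

lemma cone_contraction:
  obtains a \<theta> where "a > 0" "0 \<le> \<theta>" "\<theta> < 1"
    "\<And>n h1 h2. h1 \<in> density_cone a \<Longrightarrow> h2 \<in> density_cone a \<Longrightarrow> mean h1 = mean h2 \<Longrightarrow>
      norm ((L ^^ n) (h1 - h2)) \<le> 2 * mean h1 * \<theta> ^ n"
proof -
  \<comment> \<open>With \<open>1 - s = (1 + \<sigma>) / (2 * \<sigma>)\<close> the widened aperture
    \<open>a / (1 - s)\<close> is mapped to \<open>2 * a / (\<sigma> + 1) + \<beta>\<close>;
    \<open>a\<close> is the fixed point of this map. \<open>\<theta>\<close> is the fraction of mass
    left after one splitting.\<close>
  define s where "s = 1 - (1 + \<sigma>) / (2 * \<sigma>)"
  define a where "a = \<beta> * (\<sigma> + 1) / (\<sigma> - 1)"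
  define \<theta> where "\<theta> = 1 - 2 * pi * (s * harnack a)"
  have s: "0 < s" "s < 1" using \<sigma> by (auto simp: s_def field_simps)
  have a: "a > 0" using \<sigma> \<beta>_pos by (simp add: a_def)
  have "a / (1 - s) / \<sigma> = 2 * (a / (\<sigma> + 1))"
    using \<sigma> by (simp add: s_def add.commute)
  also have "a / (\<sigma> + 1) = \<beta> / (\<sigma> - 1)"
    using \<sigma> by (simp add: a_def)
  also have "2 * (\<beta> / (\<sigma> - 1)) = a - \<beta>"
    using \<sigma> by (simp add: a_def field_simps)
  finally have "a / (1 - s) / \<sigma> + \<beta> = a" by simp
  then have L_cone: "L h \<in> density_cone a" if "h \<in> density_cone (a / (1 - s))" for h
    using transfer_cone[OF that] a s by simp
  have \<theta>: "0 \<le> \<theta>" "\<theta> < 1"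
  proof -
    have "s * (2 * pi * harnack a) \<le> 1 * 1"
      using harnack_le[OF a] harnack_pos[OF a] s by (intro mult_mono) auto
    then show "0 \<le> \<theta>" by (simp add: \<theta>_def mult_ac)
    show "\<theta> < 1" using s harnack_pos[OF a] by (simp add: \<theta>_def)
  qed
  have "norm ((L ^^ n) (h1 - h2)) \<le> 2 * mean h1 * \<theta> ^ n"
    if "h1 \<in> density_cone a" "h2 \<in> density_cone a" "mean h1 = mean h2" for n h1 h2
    using that
  proof (induction n arbitrary: h1 h2)
    case 0
    show ?case
      using norm_triangle_ineq4[of h1 h2] norm_cone_le_mean[OF 0(1) a] norm_cone_le_mean[OF 0(2) a] 0(3) by simp
  next
    case (Suc n)
    \<comment> \<open>Both functions have the same mean, hence lose the same constant, and their
      difference is unchanged; \<open>L\<close> then narrows the widened cone back to aperture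
      \<open>a\<close>.\<close>
    let ?c = "const_L1 (s * harnack a * mean h1)"
    have cone: "L (h1 - ?c) \<in> density_cone a" "L (h2 - ?c) \<in> density_cone a"
      using cone_diff_const[OF Suc.prems(1) a, of s] cone_diff_const[OF Suc.prems(2) a, of s] s Suc.prems(3)
      by (auto intro!: L_cone)
    have mean: "mean (L (h1 - ?c)) = mean h1 * \<theta>" "mean (L (h2 - ?c)) = mean h1 * \<theta>"
      using Suc.prems(3) by (simp_all add: mean_transfer mean_diff mean_const_L1 \<theta>_def algebra_simps)
    have "(L ^^ Suc n) (h1 - h2) = (L ^^ n) (L (h1 - ?c) - L (h2 - ?c))"
      by (simp add: funpow_Suc_right transfer_diff[symmetric] del: funpow.simps)
    also have "norm \<dots> \<le> 2 * (mean h1 * \<theta>) * \<theta> ^ n"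
      using Suc.IH[OF cone] mean by simp
    finally show ?case by (simp add: mult_ac)
  qed
  then show thesis using that a \<theta> by blast
qed

lemma transfer_decay_C1:
  obtains C \<theta> where "C \<ge> 0" "0 \<le> \<theta>" "\<theta> < 1"
    "\<And>n v v' M. v \<in> Cper \<Longrightarrow> v' \<in> Cper \<Longrightarrow> (\<And>x. (v has_real_derivative v' x) (at x)) \<Longrightarrow>
      (\<And>x. \<bar>v x\<bar> \<le> M) \<Longrightarrow> (\<And>x. \<bar>v' x\<bar> \<le> M) \<Longrightarrow> (LINT x|circ. v x) = 0 \<Longrightarrow>
      norm ((L ^^ n) (abs_L1 v)) \<le> C * M * \<theta> ^ n"
proof -
  obtain a \<theta> where a: "a > 0" and \<theta>: "0 \<le> \<theta>" "\<theta> < 1" and contr: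
    "\<And>n h1 h2. h1 \<in> density_cone a \<Longrightarrow> h2 \<in> density_cone a \<Longrightarrow> mean h1 = mean h2 \<Longrightarrow>
      norm ((L ^^ n) (h1 - h2)) \<le> 2 * mean h1 * \<theta> ^ n"
    using cone_contraction by blast
  define C where "C = 4 * pi * (1 + 1 / a)"
  have "norm ((L ^^ n) (abs_L1 v)) \<le> C * M * \<theta> ^ n"
    if v: "v \<in> Cper" "v' \<in> Cper" "\<And>x. (v has_real_derivative v' x) (at x)"
      and M: "\<And>x. \<bar>v x\<bar> \<le> M" "\<And>x. \<bar>v' x\<bar> \<le> M" and mean: "(LINT x|circ. v x) = 0" for n v v' M
  proof -
    \<comment> \<open>With this shift \<open>v + K \<ge> M / a\<close>, so
      \<open>a * (v + K)\<close> dominates \<open>\<bar>v'\<bar>\<close>. Since \<open>v\<close> has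
      zero mean, \<open>v + K\<close> and the constant \<open>K\<close> are cone elements of equal
      mean.\<close>
    define K where "K = M * (1 + 1 / a)"
    have M0: "0 \<le> M" using M(1)[of 0] by simp
    have 1: "abs_L1 (\<lambda>x. v x + K) \<in> density_cone a"
    proof (rule C1_in_cone[OF _ v(2)])
      show "\<bar>v' x\<bar> \<le> a * (v x + K)" for x
      proof -
        have "a * (M / a) \<le> a * (v x + K)"
          using a M(1)[of x] by (intro mult_left_mono) (auto simp: K_def algebra_simps)
        then show ?thesis using M(2)[of x] a by simp
      qed
    qed (auto intro!: Cper_intros v derivative_eq_intros)
    have 2: "const_L1 K \<in> density_cone a"
      by (rule C1_in_cone[where v' = "\<lambda>_. 0"]) (use a M0 in \<open>auto simp: K_def\<close>)
    have vK: "(\<lambda>x. v x + K) \<in> Cper" by (intro Cper_intros v)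
    have mean1: "mean (abs_L1 (\<lambda>x. v x + K)) = 2 * pi * K"
      using mean v(1) by (simp add: mean_abs_L1 integrable_Cper vK)
    have "abs_L1 v = abs_L1 (\<lambda>x. v x + K) - const_L1 K"
      using vK by (simp add: minus_L1.abs_eq eq_L1_refl integrable_Cper)
    then have "norm ((L ^^ n) (abs_L1 v)) \<le> 2 * (2 * pi * K) * \<theta> ^ n"
      using contr[OF 1 2, of n] mean1 by (simp add: mean_const_L1)
    then show ?thesis by (simp add: C_def K_def mult_ac)
  qed
  moreover have "C \<ge> 0" using a by (simp add: C_def)
  ultimately show thesis using that \<theta> by blast
qed

end

section \<open>Exponential mixing in \<open>W\<^sup>1\<^sup>,\<^sup>1\<close>\<close>

lemma Cper_antiderivative_mean_zero:
  assumes w: "w \<in> Cper" and mean: "(LINT x|circ. w x) = 0"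
  obtains v where "v \<in> Cper" "\<And>x. (v has_real_derivative w x) (at x)" "(LINT x|circ. v x) = 0"
proof -
  obtain v where v: "v \<in> Cper" "\<And>x. (v has_real_derivative w x) (at x)"
    using Cper_antiderivative[OF w mean, of 0 0] by blast
  define m where "m = (LINT x|circ. v x) / (2 * pi)"
  show thesis
  proof (rule that)
    show "(\<lambda>x. v x - m) \<in> Cper" by (intro Cper_intros v)
    show "((\<lambda>x. v x - m) has_real_derivative w x) (at x)" for x
      by (auto intro!: derivative_eq_intros v)
    show "(LINT x|circ. v x - m) = 0"
      using v(1) by (simp add: integrable_Cper integral_circ_const m_def)
  qed
qed

lemma Cper_mean_zero_has_zero:
  assumes w: "w \<in> Cper" and mean: "(LINT x|circ. w x) = 0"
  obtains y where "w y = 0"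
proof -
  obtain F where F: "\<And>x. (F has_real_derivative w x) (at x)"
    using continuous_has_antiderivative[OF Cper_continuous[OF w]] by blast
  obtain z where "F (2 * pi) - F 0 = (2 * pi - 0) * w z"
    using MVT2[of 0 "2 * pi" F w] F by auto
  then show thesis using that integral_circ_FTC[OF w F] mean by simp
qed

text \<open>The derivative of \<open>v ^ 3\<close> is at most \<open>3 * B * v ^ 2\<close> in
  modulus; integrating it from a zero of \<open>v\<close> within one period gives the bound. It
  serves to turn smallness in mean square into smallness of the supremum.\<close>

lemma Cper_cube_bound:
  assumes v: "v \<in> Cper" "\<And>x. (v has_real_derivative v' x) (at x)" and B: "\<And>x. \<bar>v' x\<bar> \<le> B"
    and v0: "v y = 0"
  shows "\<bar>v x\<bar> ^ 3 \<le> 3 * B * (LINT x|circ. v x * v x)"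
proof -
  have w: "(\<lambda>x. 3 * B * (v x * v x)) \<in> Cper" by (intro Cper_intros v)
  obtain F where F: "\<And>x. (F has_real_derivative 3 * B * (v x * v x)) (at x)"
    using continuous_has_antiderivative[OF Cper_continuous[OF w]] by blast
  have F_int: "F (2 * pi) - F 0 = 3 * B * (LINT x|circ. v x * v x)"
    using integral_circ_FTC[OF w F] by simp
  have *: "\<bar>v q ^ 3 - v p ^ 3\<bar> \<le> F q - F p" if pq: "p \<le> q" for p q
  proof -
    have nonneg: "0 \<le> 3 * B * (v x * v x) - s * (3 * v x ^ 2 * v' x)" if "\<bar>s\<bar> = 1" for s x
    proof -
      have "s * (3 * v x ^ 2 * v' x) \<le> \<bar>s * (3 * v x ^ 2 * v' x)\<bar>" by simp
      also have "\<dots> = 3 * v x ^ 2 * \<bar>v' x\<bar>" using that by (simp add: abs_mult)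
      also have "\<dots> \<le> 3 * v x ^ 2 * B" by (intro mult_left_mono B) simp
      finally show ?thesis by (simp add: power2_eq_square mult_ac)
    qed
    \<comment> \<open>The signs \<open>s = 1\<close> and \<open>s = -1\<close> give the two halves
      of the absolute value.\<close>
    have "F p - s * v p ^ 3 \<le> F q - s * v q ^ 3" if "\<bar>s\<bar> = 1" for s
    proof (rule DERIV_nonneg_imp_nondecreasing[OF pq])
      fix x
      have "((\<lambda>x. F x - s * v x ^ 3) has_real_derivative (3 * B * (v x * v x) - s * (3 * v x ^ 2 * v' x))) (at x)"
        by (auto intro!: derivative_eq_intros F v(2) simp: power2_eq_square)
      then show "\<exists>y. ((\<lambda>x. F x - s * v x ^ 3) has_real_derivative y) (at x) \<and> 0 \<le> y"
        using nonneg[OF that] by blast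
    qed
    from this[of 1] this[of "-1"] show ?thesis by simp
  qed
  have mono: "F p \<le> F q" if "p \<le> q" for p q
    using *[OF that] by linarith
  obtain x' where x': "x' \<in> {0..<2 * pi}" "v x = v x'"
    using periodic_value[of v x] Cper_periodic[OF v(1)] by metis
  obtain y' where y': "y' \<in> {0..<2 * pi}" "v y' = 0"
    using periodic_value[of v y] Cper_periodic[OF v(1)] v0 by metis
  have "\<bar>v x' ^ 3\<bar> \<le> F (2 * pi) - F 0"
  proof (cases "x' \<le> y'")
    case True
    then show ?thesis using *[OF True] mono[of 0 x'] mono[of y' "2 * pi"] x' y' by simp
  next
    case False
    then show ?thesis using *[of y' x'] mono[of 0 y'] mono[of x' "2 * pi"] x' y' by simp
  qed
  then show ?thesis using F_int x'(2) by (simp add: power_abs)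
qed

context expanding_circle_map
begin

text \<open>For \<open>f\<close> of zero mean write \<open>u \<circ> T\<^sup>n = c + \<phi>'\<close> with \<open>\<phi>\<close> of zero mean, so that the pairing of \<open>L\<^sup>n f\<close>
  with \<open>u\<close> is minus the pairing of the weak derivative of \<open>f\<close> with \<open>\<phi>\<close>. If \<open>\<Phi>' = \<phi>\<close>, the integral
  of \<open>\<phi>\<^sup>2\<close> is minus the pairing of \<open>L\<^sup>n \<Phi>\<close> with \<open>u\<close>, which is exponentially small; hence so is \<open>sup |\<phi>|\<close>.\<close>

lemma transfer_decay_Sobolev:
  obtains \<eta> where "\<eta> \<longlonglongrightarrow> 0"
    "\<And>n f. f \<in> Sobolev 1 \<Longrightarrow> mean f = 0 \<Longrightarrow> norm ((L ^^ n) f) \<le> \<eta> n * norm (weak_deriv 1 f)"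
proof -
  obtain C \<theta> where C: "C \<ge> 0" and \<theta>: "0 \<le> \<theta>" "\<theta> < 1" and decay:
    "\<And>n v v' M. v \<in> Cper \<Longrightarrow> v' \<in> Cper \<Longrightarrow> (\<And>x. (v has_real_derivative v' x) (at x)) \<Longrightarrow>
      (\<And>x. \<bar>v x\<bar> \<le> M) \<Longrightarrow> (\<And>x. \<bar>v' x\<bar> \<le> M) \<Longrightarrow> (LINT x|circ. v x) = 0 \<Longrightarrow>
      norm ((L ^^ n) (abs_L1 v)) \<le> C * M * \<theta> ^ n"
    using transfer_decay_C1 by blast
  \<comment> \<open>The entries bound \<open>\<phi>\<close> and its antiderivative
    \<open>\<Phi>\<close>, starting from \<open>\<bar>\<phi>'\<bar> \<le> 2\<close> and gaining
    \<open>2 * pi\<close> per integration. The cube root and the factor \<open>6 = 3 * 2\<close> in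
    \<open>\<eta>\<close> come from \<open>Cper_cube_bound\<close>.\<close>
  define M where "M = max (4 * pi) (2 * pi * (4 * pi))"
  define \<eta> where "\<eta> n = root 3 (6 * (C * M * \<theta> ^ n))" for n
  have "(\<lambda>n. root 3 (6 * (C * M * \<theta> ^ n))) \<longlonglongrightarrow> root 3 (6 * (C * M * 0))"
    using \<theta> by (intro tendsto_intros LIMSEQ_power_zero) auto
  then have lim: "\<eta> \<longlonglongrightarrow> 0" by (simp add: \<eta>_def[abs_def])
  have "norm ((L ^^ n) f) \<le> \<eta> n * norm (weak_deriv 1 f)"
    if f: "f \<in> Sobolev 1" and mean: "mean f = 0" for n f
  proof (rule norm_L1_le_dual)
    fix u assume u: "u \<in> Cper" "\<And>x. \<bar>u x\<bar> \<le> (1::real)"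
    define U where "U x = u ((T ^^ n) x)" for x
    have U: "U \<in> Cper" and pairing_U: "pairing ((L ^^ n) k) u = pairing k U" for k
      using pairing_transfer_funpow[OF u(1), of n] by (auto simp: U_def[abs_def])
    define c where "c = (LINT x|circ. U x) / (2 * pi)"
    have "\<bar>LINT x|circ. U x\<bar> \<le> 2 * pi * 1"
      by (rule integral_circ_bound[OF U]) (simp add: U_def u(2))
    then have c: "\<bar>c\<bar> \<le> 1" by (simp add: c_def abs_mult)
    define \<phi>' where "\<phi>' x = U x - c" for x
    have \<phi>': "\<phi>' \<in> Cper" unfolding \<phi>'_def by (intro Cper_intros U)
    have \<phi>'_le: "\<bar>\<phi>' x\<bar> \<le> 2" for x
      using u(2)[of "(T ^^ n) x"] c by (simp add: \<phi>'_def U_def)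
    have "(LINT x|circ. \<phi>' x) = 0"
      unfolding \<phi>'_def using U by (simp add: integrable_Cper integral_circ_const c_def)
    then obtain \<phi> where \<phi>: "\<phi> \<in> Cper" "\<And>x. (\<phi> has_real_derivative \<phi>' x) (at x)" "(LINT x|circ. \<phi> x) = 0"
      using Cper_antiderivative_mean_zero[OF \<phi>'] by metis
    obtain y where y: "\<phi> y = 0" using Cper_mean_zero_has_zero[OF \<phi>(1,3)] by blast
    have \<phi>_le: "\<bar>\<phi> x\<bar> \<le> 4 * pi" for x
      using Cper_bound_of_DERIV[OF \<phi>(1,2) \<phi>'_le y] by simp
    obtain \<Phi> where \<Phi>: "\<Phi> \<in> Cper" "\<And>x. (\<Phi> has_real_derivative \<phi> x) (at x)" "(LINT x|circ. \<Phi> x) = 0"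
      using Cper_antiderivative_mean_zero[OF \<phi>(1,3)] by metis
    obtain z where z: "\<Phi> z = 0" using Cper_mean_zero_has_zero[OF \<Phi>(1,3)] by blast
    have \<Phi>_le: "\<bar>\<Phi> x\<bar> \<le> 2 * pi * (4 * pi)" for x
      by (rule Cper_bound_of_DERIV[OF \<Phi>(1,2) \<phi>_le z])
    have "norm ((L ^^ n) (abs_L1 \<Phi>)) \<le> C * M * \<theta> ^ n"
      by (rule decay[OF \<Phi>(1) \<phi>(1) \<Phi>(2) _ _ \<Phi>(3)])
         (use \<phi>_le \<Phi>_le in \<open>simp_all only: M_def le_max_iff_disj simp_thms\<close>)
    moreover have "(LINT x|circ. \<phi> x * \<phi> x) = - pairing ((L ^^ n) (abs_L1 \<Phi>)) u"
    proof -
      have "(LINT x|circ. \<phi> x * \<phi> x) = - (LINT x|circ. \<phi>' x * \<Phi> x)"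
        by (rule integral_circ_by_parts[OF \<phi>(1) \<phi>' \<phi>(2) \<Phi>(1) \<phi>(1) \<Phi>(2)])
      also have "(LINT x|circ. \<phi>' x * \<Phi> x) = (LINT x|circ. \<Phi> x * U x - c * \<Phi> x)"
        by (simp add: \<phi>'_def algebra_simps)
      also have "\<dots> = (LINT x|circ. \<Phi> x * U x)"
        using \<Phi>(3) by (simp add: integrable_Cper Cper_mult U \<Phi>(1))
      finally show ?thesis by (simp add: pairing_U pairing_abs_L1_Cper \<Phi>(1) U)
    qed
    ultimately have "(LINT x|circ. \<phi> x * \<phi> x) \<le> C * M * \<theta> ^ n"
      using pairing_bound[OF u, of "(L ^^ n) (abs_L1 \<Phi>)"] by linarith
    then have "\<bar>\<phi> x\<bar> ^ 3 \<le> 6 * (C * M * \<theta> ^ n)" for x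
      using Cper_cube_bound[OF \<phi>(1,2) \<phi>'_le y, of x] by simp
    then have "root 3 (\<bar>\<phi> x\<bar> ^ 3) \<le> \<eta> n" for x
      unfolding \<eta>_def by (intro real_root_le_mono) auto
    then have sup: "\<bar>\<phi> x\<bar> \<le> \<eta> n" for x
      by (simp add: real_root_power_cancel)
    have "pairing ((L ^^ n) f) u = pairing f (\<lambda>x. \<phi>' x + c)"
      by (simp add: pairing_U \<phi>'_def)
    also have "\<dots> = pairing f \<phi>'"
      using mean by (simp add: pairing_add[OF \<phi>' Cper_const] pairing_const)
    also have "\<dots> = - pairing (weak_deriv 1 f) \<phi>"
      by (rule pairing_weak_deriv_C1[OF Sobolev_1_weak_deriv[OF f] \<phi>(1) \<phi>' \<phi>(2)])
    also have "\<dots> \<le> \<eta> n * norm (weak_deriv 1 f)"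
      using pairing_bound[OF \<phi>(1) sup, of "weak_deriv 1 f"] by linarith
    finally show "pairing ((L ^^ n) f) u \<le> \<eta> n * norm (weak_deriv 1 f)" .
  qed
  then show thesis using that lim by blast
qed

lemma Sobolev_norm_transfer:
  assumes f: "f \<in> Sobolev 1"
  shows "Sobolev_norm 1 (L f) \<le> (1 + \<beta>) * Sobolev_norm 1 f"
proof -
  have "norm (weak_deriv 1 f) / \<sigma> \<le> norm (weak_deriv 1 f)"
    using \<sigma> by (simp add: divide_le_eq mult_left_le_one_le mult_le_cancel_left1)
  moreover have "0 \<le> \<beta> * norm (weak_deriv 1 f)" using \<beta>_pos by simp
  ultimately have "norm (L f) + norm (weak_deriv 1 (L f)) \<le> (1 + \<beta>) * (norm f + norm (weak_deriv 1 f))"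
    using Lasota_Yorke[OF f] norm_transfer[of f] unfolding distrib_left distrib_right by simp
  then show ?thesis unfolding Sobolev_norm_1 .
qed

text \<open>The first \<open>n\<close> steps make the L1 norm small relative to the derivative,
  without enlarging the derivative beyond the Lasota-Yorke bound; \<open>k\<close> further steps
  damp the derivative while the small L1 norm pays for the error term.\<close>

lemma transfer_spectral_gap:
  obtains N where "N > 0"
    "\<And>f. f \<in> Sobolev 1 \<Longrightarrow> mean f = 0 \<Longrightarrow> Sobolev_norm 1 ((L ^^ N) f) \<le> Sobolev_norm 1 f / 2"
proof -
  obtain \<eta> where \<eta>: "\<eta> \<longlonglongrightarrow> 0"
    "\<And>n f. f \<in> Sobolev 1 \<Longrightarrow> mean f = 0 \<Longrightarrow> norm ((L ^^ n) f) \<le> \<eta> n * norm (weak_deriv 1 f)"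
    using transfer_decay_Sobolev by blast
  define b where "b = \<beta> * \<sigma> / (\<sigma> - 1)"
  have b: "b \<ge> 0" using \<sigma> \<beta>_pos by (simp add: b_def)
  \<comment> \<open>The threshold is set so that the final sum \<open>2 * y + b * x + b * y\<close>,
    at most \<open>2 * (1 + b) * (x + y)\<close>, is reduced to half of
    \<open>x + y\<close>.\<close>
  have "\<forall>\<^sub>F n in sequentially. \<eta> n < 1 / (4 * (1 + b))"
    using b by (intro order_tendstoD(2)[OF \<eta>(1)]) simp
  then obtain n where n: "\<eta> n < 1 / (4 * (1 + b))" by (auto simp: eventually_sequentially)
  have "(\<lambda>k. (1 / \<sigma>) ^ k) \<longlonglongrightarrow> 0" using \<sigma> by (intro LIMSEQ_power_zero) auto
  \<comment> \<open>\<open>k \<ge> 1\<close> ensures that the exponent \<open>k + n\<close> is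
    positive.\<close>
  then have "\<forall>\<^sub>F k in sequentially. (1 / \<sigma>) ^ k < 1 / (4 * (1 + b)) \<and> k \<ge> 1"
    using b by (intro eventually_conj order_tendstoD(2) eventually_ge_at_top) auto
  then obtain k where k: "(1 / \<sigma>) ^ k < 1 / (4 * (1 + b))" "k \<ge> 1" by (auto simp: eventually_sequentially)
  have "Sobolev_norm 1 ((L ^^ (k + n)) f) \<le> Sobolev_norm 1 f / 2"
    if f: "f \<in> Sobolev 1" and mean: "mean f = 0" for f
  proof -
    define x y where "x = norm f" and "y = norm (weak_deriv 1 f)"
    have xy: "0 \<le> x" "0 \<le> y" by (simp_all add: x_def y_def)
    let ?g = "(L ^^ n) f"
    have g: "?g \<in> Sobolev 1" by (rule Sobolev_1_transfer_funpow[OF f])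
    have Lg: "(L ^^ (k + n)) f = (L ^^ k) ?g" by (simp add: funpow_add)
    have e: "\<eta> n * y \<le> 1 / (4 * (1 + b)) * y" using n xy by (intro mult_right_mono) auto
    have ng: "norm ?g \<le> 1 / (4 * (1 + b)) * y" using \<eta>(2)[OF f mean, of n] e by (simp add: y_def)
    have "norm (weak_deriv 1 ?g) \<le> y / \<sigma> ^ n + b * x"
      using Lasota_Yorke_funpow[OF f, of n] by (simp add: x_def y_def b_def)
    also have "y / \<sigma> ^ n \<le> y" using \<sigma> xy by (simp add: divide_le_eq mult_le_cancel_left1)
    finally have dg: "norm (weak_deriv 1 ?g) \<le> y + b * x" by simp
    have "norm (weak_deriv 1 ((L ^^ k) ?g)) \<le> (1 / \<sigma>) ^ k * norm (weak_deriv 1 ?g) + b * norm ?g"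
      using Lasota_Yorke_funpow[OF g, of k] by (simp add: b_def power_divide)
    also have "\<dots> \<le> 1 / (4 * (1 + b)) * (y + b * x) + b * (1 / (4 * (1 + b)) * y)"
      using k(1) dg ng b xy by (intro add_mono mult_mono mult_left_mono) auto
    finally have "norm (weak_deriv 1 ((L ^^ k) ?g)) \<le> 1 / (4 * (1 + b)) * (y + b * x + b * y)"
      by (simp only: ring_distribs mult_ac add_ac)
    moreover have "norm ((L ^^ k) ?g) \<le> 1 / (4 * (1 + b)) * y"
      using norm_transfer_funpow[of k ?g] ng by linarith
    ultimately have "norm ((L ^^ k) ?g) + norm (weak_deriv 1 ((L ^^ k) ?g)) \<le> 1 / (4 * (1 + b)) * (2 * y + b * x + b * y)"
      by (simp add: distrib_left)
    also have "\<dots> \<le> 1 / (4 * (1 + b)) * (2 * (1 + b) * (x + y))"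
    proof (rule mult_left_mono)
      have "0 \<le> b * x" "0 \<le> b * y" using b xy by auto
      then show "2 * y + b * x + b * y \<le> 2 * (1 + b) * (x + y)"
        using xy by (simp add: algebra_simps)
    qed (use b in simp)
    also have "\<dots> = (x + y) / 2" using b by (simp add: field_simps)
    finally show ?thesis unfolding Lg Sobolev_norm_1 x_def y_def .
  qed
  then show thesis using that[of "k + n"] k(2) by simp
qed

end

lemma C4_uniformly_expanding_imp_locale:
  assumes C4: "C4_circle_lift T" and "uniformly_expanding T"
  obtains \<sigma> d where "expanding_circle_map T (deriv T) (deriv (deriv T)) \<sigma> d"
proof -
  obtain \<sigma> where \<sigma>: "\<sigma> > 1" "\<And>x. \<bar>deriv T x\<bar> > \<sigma>"
    using assms(2) by (auto simp: uniformly_expanding_def)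
  obtain d :: int where d: "\<And>x. T (x + 2 * pi) = T x + 2 * pi * of_int d"
    using C4 by (auto simp: C4_circle_lift_def)
  have diff: "((deriv ^^ k) T) differentiable (at x)" if "k < 4" for k x
    using C4 that by (simp add: C4_circle_lift_def)
  show thesis
  proof (rule that, unfold_locales)
    show "(T has_real_derivative deriv T x) (at x)" for x
      using diff[of 0 x] by (simp add: DERIV_deriv_iff_real_differentiable)
    show "(deriv T has_real_derivative deriv (deriv T) x) (at x)" for x
      using diff[of 1 x] by (simp add: DERIV_deriv_iff_real_differentiable)
    show "continuous_on UNIV (deriv (deriv T))"
      using diff[of 2] by (intro continuous_at_imp_continuous_on ballI differentiable_imp_continuous_within)
         (simp add: numeral_2_eq_2)
  qed (use \<sigma> d in auto)
qed

section \<open>Local stability\<close>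

text \<open>Since \<open>\<kappa> \<le> 1\<close>, the iterates never leave the ball on which the
  one-step estimate is available.\<close>

lemma local_contraction_iterate:
  fixes q :: "'a \<Rightarrow> real"
  assumes step: "\<And>g. g \<in> X \<Longrightarrow> q g \<le> r \<Longrightarrow> F g \<in> X \<and> q (F g) \<le> \<kappa> * q g"
    and \<kappa>: "0 \<le> \<kappa>" "\<kappa> \<le> 1" and q: "\<And>g. g \<in> X \<Longrightarrow> 0 \<le> q g" and g: "g \<in> X" "q g \<le> r"
  shows "(F ^^ n) g \<in> X \<and> q ((F ^^ n) g) \<le> \<kappa> ^ n * q g"
proof (induction n)
  case 0
  then show ?case using g by simp
next
  case (Suc n)
  have "\<kappa> ^ n * q g \<le> q g" using \<kappa> q[OF g(1)] by (simp add: mult_left_le_one_le power_le_one)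
  then have F: "F ((F ^^ n) g) \<in> X" "q (F ((F ^^ n) g)) \<le> \<kappa> * q ((F ^^ n) g)"
    using step[of "(F ^^ n) g"] Suc g(2) by auto
  have "\<kappa> * q ((F ^^ n) g) \<le> \<kappa> * (\<kappa> ^ n * q g)" using Suc \<kappa> by (intro mult_left_mono) auto
  with F show ?case by (simp add: mult.assoc)
qed

text \<open>A single application of \<open>A\<close> may enlarge \<open>p\<close>, so the remainder
  cannot be absorbed step by step in \<open>p\<close>. In the weighted sum over the first
  \<open>N\<close> iterates \<open>A\<close> contracts by \<open>1 / b\<close>, and on a small ball
  the quadratic remainder uses up only part of this gain.\<close>

lemma quadratic_perturbation_stable:
  fixes p :: "'a::real_vector \<Rightarrow> real" and A F :: "'a \<Rightarrow> 'a"
  assumes p_nonneg: "\<And>g. 0 \<le> p g"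
    and p_add: "\<And>f g. f \<in> X \<Longrightarrow> g \<in> X \<Longrightarrow> p (f + g) \<le> p f + p g"
    and A: "\<And>f. f \<in> X \<Longrightarrow> A f \<in> X" "\<And>f g. A (f + g) = A f + A g"
    and A_bound: "\<And>f. f \<in> X \<Longrightarrow> p (A f) \<le> K * p f" "K \<ge> 0"
    and A_contr: "\<And>f. f \<in> X \<Longrightarrow> p ((A ^^ N) f) \<le> p f / 2" "N > 0"
    and F: "\<And>g. g \<in> X \<Longrightarrow> p g \<le> r0 \<Longrightarrow> F g \<in> X \<and> F g - A g \<in> X \<and> p (F g - A g) \<le> M * (p g)\<^sup>2"
    and r0: "r0 > 0" and M: "M \<ge> 0"
  obtains r C \<kappa> where "r > 0" "C > 0" "0 < \<kappa>" "\<kappa> < 1"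
    "\<And>g n. g \<in> X \<Longrightarrow> p g \<le> r \<Longrightarrow> (F ^^ n) g \<in> X \<and> p ((F ^^ n) g) \<le> C * \<kappa> ^ n * p g"
proof -
  define b where "b = root N 2"
  have b: "b > 1" "b ^ N = 2" using A_contr(2) by (simp_all add: b_def)
  \<comment> \<open>An adapted norm: \<open>A\<close> contracts it in one step.\<close>
  define q where "q g = (\<Sum>k<N. b ^ k * p ((A ^^ k) g))" for g
  define Q where "Q = (\<Sum>k<N. b ^ k * K ^ k)"
  have AX: "(A ^^ k) f \<in> X" if "f \<in> X" for k f
    using that A(1) by (induction k) auto
  have A_add: "(A ^^ k) (f + g) = (A ^^ k) f + (A ^^ k) g" for k f g
    by (induction k) (auto simp: A(2))
  have A_pow: "p ((A ^^ k) f) \<le> K ^ k * p f" if f: "f \<in> X" for k f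
  proof (induction k)
    case (Suc k)
    have "p ((A ^^ Suc k) f) \<le> K * p ((A ^^ k) f)" using A_bound(1)[OF AX[OF f]] by simp
    also have "\<dots> \<le> K * (K ^ k * p f)" using Suc A_bound(2) by (intro mult_left_mono) auto
    finally show ?case by (simp add: mult.assoc)
  qed simp
  have q_nonneg: "0 \<le> q g" for g
    unfolding q_def using b by (intro sum_nonneg mult_nonneg_nonneg p_nonneg) auto
  have p_le_q: "p g \<le> q g" for g
  proof -
    have "b ^ 0 * p ((A ^^ 0) g) \<le> q g"
      unfolding q_def using b A_contr(2) by (intro member_le_sum) (auto intro!: mult_nonneg_nonneg p_nonneg)
    then show ?thesis by simp
  qed
  have q_le_p: "q g \<le> Q * p g" if "g \<in> X" for g
    unfolding q_def Q_def sum_distrib_right mult.assoc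
    using b by (intro sum_mono mult_left_mono A_pow that) auto
  have q_add: "q (f + g) \<le> q f + q g" if "f \<in> X" "g \<in> X" for f g
    unfolding q_def sum.distrib[symmetric] distrib_left[symmetric]
    using b by (intro sum_mono mult_left_mono) (auto simp: A_add intro!: p_add AX that)
  have q_A: "q (A g) \<le> q g / b" if g: "g \<in> X" for g
  proof -
    \<comment> \<open>Multiplying by \<open>b\<close> shifts the sum by one index. The new last term
      carries the weight \<open>b ^ N = 2\<close>, which cancels the factor one half of
      \<open>A_contr\<close>; the dropped first term is \<open>p g\<close>.\<close>
    have "b * q (A g) = (\<Sum>k<N. b ^ Suc k * p ((A ^^ Suc k) g))"
      unfolding q_def sum_distrib_left by (intro sum.cong) (simp_all add: funpow_Suc_right mult.assoc del: funpow.simps)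
    also have "\<dots> = (\<Sum>k<Suc N. b ^ k * p ((A ^^ k) g)) - p g"
      unfolding sum.lessThan_Suc_shift by simp
    also have "\<dots> = q g + 2 * p ((A ^^ N) g) - p g"
      by (simp add: q_def b(2))
    also have "\<dots> \<le> q g" using A_contr(1)[OF g] by simp
    finally show ?thesis using b by (simp add: field_simps)
  qed
  have Q: "Q > 0"
  proof -
    have "b ^ 0 * K ^ 0 \<le> Q"
      unfolding Q_def using b A_contr(2) A_bound(2) by (intro member_le_sum) auto
    then show ?thesis by simp
  qed
  define \<kappa> where "\<kappa> = (1 / b + 1) / 2"
  have \<kappa>: "1 / b < \<kappa>" "0 < \<kappa>" "\<kappa> < 1" using b by (auto simp: \<kappa>_def field_simps)
  \<comment> \<open>The remainder is at most \<open>r1 * Q * M\<close> times the adapted norm; this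
    radius fits it into the slack \<open>\<kappa> - 1 / b\<close>. The summand 1 covers the case
    \<open>Q * M = 0\<close>.\<close>
  define r1 where "r1 = min r0 ((\<kappa> - 1 / b) / (Q * M + 1))"
  have QM: "Q * M \<ge> 0" using Q M by simp
  have r1: "r1 > 0" "r1 \<le> r0" "r1 * (Q * M) \<le> \<kappa> - 1 / b"
  proof -
    show pos: "r1 > 0" using r0 \<kappa>(1) QM by (simp add: r1_def add_nonneg_pos)
    show "r1 \<le> r0" by (simp add: r1_def)
    have "r1 * (Q * M) \<le> r1 * (Q * M + 1)" using pos by simp
    also have "\<dots> \<le> (\<kappa> - 1 / b) / (Q * M + 1) * (Q * M + 1)"
      using QM by (intro mult_right_mono) (auto simp: r1_def)
    also have "\<dots> = \<kappa> - 1 / b" using QM by simp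
    finally show "r1 * (Q * M) \<le> \<kappa> - 1 / b" .
  qed
  have step: "F g \<in> X \<and> q (F g) \<le> \<kappa> * q g" if g: "g \<in> X" "q g \<le> r1" for g
  proof -
    have pg: "p g \<le> r1" using p_le_q[of g] g by simp
    then have Fg: "F g \<in> X" "F g - A g \<in> X" "p (F g - A g) \<le> M * (p g)\<^sup>2"
      using F[OF g(1)] r1(2) by auto
    have "q (F g) \<le> q (A g) + q (F g - A g)"
      using q_add[OF A(1)[OF g(1)] Fg(2)] by simp
    also have "\<dots> \<le> q g / b + Q * (M * (p g)\<^sup>2)"
      using q_A[OF g(1)] order_trans[OF q_le_p[OF Fg(2)] mult_left_mono[OF Fg(3)]] Q by simp
    also have "Q * (M * (p g)\<^sup>2) = (p g * (Q * M)) * p g" by (simp add: power2_eq_square mult_ac)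
    also have "\<dots> \<le> (\<kappa> - 1 / b) * q g"
    proof (intro mult_mono p_le_q p_nonneg)
      have "p g * (Q * M) \<le> r1 * (Q * M)" using pg QM by (intro mult_right_mono)
      then show "p g * (Q * M) \<le> \<kappa> - 1 / b" using r1(3) by simp
    qed (use \<kappa> in simp)
    finally show ?thesis using Fg(1) by (simp add: algebra_simps)
  qed
  show thesis
  proof (rule that[of "r1 / Q" Q \<kappa>])
    fix g n assume g: "g \<in> X" "p g \<le> r1 / Q"
    then have "q g \<le> r1" using q_le_p[OF g(1)] Q by (simp add: field_simps)
    then have *: "(F ^^ n) g \<in> X \<and> q ((F ^^ n) g) \<le> \<kappa> ^ n * q g"
      using local_contraction_iterate[of X q r1 F \<kappa> g n] step \<kappa> q_nonneg g(1) by auto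
    have "p ((F ^^ n) g) \<le> \<kappa> ^ n * q g" using * p_le_q[of "(F ^^ n) g"] by simp
    also have "\<dots> \<le> \<kappa> ^ n * (Q * p g)" using \<kappa> q_le_p[OF g(1)] by (intro mult_left_mono) auto
    finally show "(F ^^ n) g \<in> X \<and> p ((F ^^ n) g) \<le> Q * \<kappa> ^ n * p g"
      using * by (simp add: mult_ac)
  qed (use r1 Q \<kappa> in auto)
qed

section \<open>The order parameter \<open>W\<close> under perturbation\<close>

lemma cos_Cper: "cos \<in> Cper" and sin_Cper: "sin \<in> Cper"
  by (auto intro!: CperI continuous_intros)

lemma W_pairing: "W f = (pairing f cos)\<^sup>2 + (pairing f sin)\<^sup>2"
proof -
  have c: "integrable circ (\<lambda>x. rep_L1 f x * cos x)" and s: "integrable circ (\<lambda>x. rep_L1 f x * sin x)"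
    by (intro integrable_mult_Cper integrable_rep_L1 cos_Cper sin_Cper)+
  have "cis x * complex_of_real (rep_L1 f x) =
      complex_of_real (rep_L1 f x * cos x) + \<i> * complex_of_real (rep_L1 f x * sin x)" for x
    by (simp add: complex_eq_iff)
  then have "(LINT x|circ. cis x * complex_of_real (rep_L1 f x)) =
      (LINT x|circ. complex_of_real (rep_L1 f x * cos x) + \<i> * complex_of_real (rep_L1 f x * sin x))"
    by simp
  also have "\<dots> = (LINT x|circ. complex_of_real (rep_L1 f x * cos x)) +
      (LINT x|circ. \<i> * complex_of_real (rep_L1 f x * sin x))"
    by (intro Bochner_Integration.integral_add integrable_mult_right integrable_of_real c s)
  also have "\<dots> = Complex (pairing f cos) (pairing f sin)"
    unfolding integral_mult_right_zero integral_complex_of_real pairing_def by (simp add: complex_eq_iff)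
  finally have "(LINT x|circ. cis x * complex_of_real (rep_L1 f x)) = Complex (pairing f cos) (pairing f sin)" .
  then show ?thesis
    using W.abs_eq[of "rep_L1 f"] by (simp add: eq_L1_refl cmod_power2)
qed

lemma W_nonneg: "0 \<le> W f"
  by (simp add: W_pairing)

lemma pairing_cos_le: "\<bar>pairing f cos\<bar> \<le> norm f" and pairing_sin_le: "\<bar>pairing f sin\<bar> \<le> norm f"
  using pairing_bound[OF cos_Cper, of 1 f] pairing_bound[OF sin_Cper, of 1 f] by simp_all

text \<open>\<open>W\<close> is the sum of squares of two linear functionals; where it is zero both
  vanish, which kills the linear term in \<open>g\<close>.\<close>

lemma W_add_le:
  assumes "W f = 0" shows "W (f + g) \<le> 2 * (norm g)\<^sup>2"
proof -
  have "pairing f cos = 0" "pairing f sin = 0"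
    using assms by (simp_all add: W_pairing sum_power2_eq_zero_iff)
  then have "W (f + g) = (pairing g cos)\<^sup>2 + (pairing g sin)\<^sup>2"
    by (simp add: W_pairing pairing_add_left cos_Cper sin_Cper)
  moreover have "(pairing g cos)\<^sup>2 \<le> (norm g)\<^sup>2" "(pairing g sin)\<^sup>2 \<le> (norm g)\<^sup>2"
    using power_mono[OF pairing_cos_le[of g], of 2] power_mono[OF pairing_sin_le[of g], of 2] by simp_all
  ultimately show ?thesis by simp
qed

text \<open>This makes the strong coupling condition stable under small L1 perturbations.\<close>

lemma W_add_ge: "W f - 4 * norm f * norm g \<le> W (f + g)"
proof -
  have *: "a\<^sup>2 - 2 * (norm f * norm g) \<le> (a + e)\<^sup>2" if "\<bar>a\<bar> \<le> norm f" "\<bar>e\<bar> \<le> norm g" for a e :: real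
  proof -
    have "\<bar>a * e\<bar> \<le> norm f * norm g" unfolding abs_mult by (intro mult_mono that) auto
    then have "- (a * e) \<le> norm f * norm g" by linarith
    moreover have "0 \<le> e\<^sup>2" by simp
    moreover have "(a + e)\<^sup>2 = a\<^sup>2 + e\<^sup>2 + 2 * (a * e)" by (simp add: power2_sum)
    ultimately show ?thesis by linarith
  qed
  show ?thesis
    using *[OF pairing_cos_le[of f] pairing_cos_le[of g]] *[OF pairing_sin_le[of f] pairing_sin_le[of g]]
    by (simp add: W_pairing pairing_add_left cos_Cper sin_Cper)
qed

text \<open>The factor \<open>Sobolev_norm 1 g\<close> on the right makes one estimate serve both
  purposes: Lyapunov stability and the exponential rate. \<open>\<kappa>\<close> is kept positive so
  that its logarithm defines a rate.\<close>

definition exponentially_attracting :: "(L1 \<Rightarrow> L1) \<Rightarrow> L1 \<Rightarrow> bool" where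
  "exponentially_attracting F p \<longleftrightarrow>
     (\<exists>r>0. \<exists>C>0. \<exists>\<kappa>>0. \<kappa> < 1 \<and> (\<forall>g\<in>Sobolev 1 \<inter> V_L1. Sobolev_norm 1 g \<le> r \<longrightarrow>
        (\<forall>n. (F ^^ n) (p + g) - p \<in> Sobolev 1 \<and>
             Sobolev_norm 1 ((F ^^ n) (p + g) - p) \<le> C * \<kappa> ^ n * Sobolev_norm 1 g)))"

lemma funpow_translate: "(F ^^ n) (p + g) - p = ((\<lambda>g. F (p + g) - p) ^^ n) g" for p g :: "'a::ab_group_add"
  by (induction n) (simp_all add: algebra_simps)

lemma exponentially_attractingI:
  assumes "r > 0" "C > 0" "\<kappa> > 0" "\<kappa> < 1"
    and "\<And>g n. g \<in> Sobolev 1 \<inter> V_L1 \<Longrightarrow> Sobolev_norm 1 g \<le> r \<Longrightarrow>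
      ((\<lambda>g. F (p + g) - p) ^^ n) g \<in> Sobolev 1 \<inter> V_L1 \<and>
      Sobolev_norm 1 (((\<lambda>g. F (p + g) - p) ^^ n) g) \<le> C * \<kappa> ^ n * Sobolev_norm 1 g"
  shows "exponentially_attracting F p"
  unfolding exponentially_attracting_def funpow_translate using assms by blast

lemma exponentially_attracting_imp_stable:
  assumes "exponentially_attracting F p" and fp: "F p = p"
  shows "stable_fixed_point F p"
proof -
  obtain r C \<kappa> where rC: "r > 0" "C > 0" "\<kappa> > 0" "\<kappa> < 1" and
    bound: "\<And>g n. g \<in> Sobolev 1 \<inter> V_L1 \<Longrightarrow> Sobolev_norm 1 g \<le> r \<Longrightarrow>
       (F ^^ n) (p + g) - p \<in> Sobolev 1 \<and>
       Sobolev_norm 1 ((F ^^ n) (p + g) - p) \<le> C * \<kappa> ^ n * Sobolev_norm 1 g"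
    using assms(1) unfolding exponentially_attracting_def by metis
  show ?thesis
    unfolding stable_fixed_point_def
  proof (intro conjI fp allI impI)
    fix \<epsilon> :: real assume \<epsilon>: "\<epsilon> > 0"
    show "\<exists>\<rho>>0. \<forall>g\<in>Sobolev 1 \<inter> V_L1. Sobolev_norm 1 g \<le> \<rho> \<longrightarrow>
        (\<forall>n. (F ^^ n) (p + g) - p \<in> Sobolev 1 \<and> Sobolev_norm 1 ((F ^^ n) (p + g) - p) \<le> \<epsilon>)"
    proof (intro exI[of _ "min r (\<epsilon> / C)"] conjI ballI allI impI)
      fix g n assume g: "g \<in> Sobolev 1 \<inter> V_L1" "Sobolev_norm 1 g \<le> min r (\<epsilon> / C)"
      then have 1: "(F ^^ n) (p + g) - p \<in> Sobolev 1"
        "Sobolev_norm 1 ((F ^^ n) (p + g) - p) \<le> C * \<kappa> ^ n * Sobolev_norm 1 g"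
        using bound[OF g(1)] by auto
      have "\<kappa> ^ n * Sobolev_norm 1 g \<le> 1 * Sobolev_norm 1 g"
        using rC by (intro mult_right_mono power_le_one Sobolev_norm_nonneg) auto
      then have "C * (\<kappa> ^ n * Sobolev_norm 1 g) \<le> C * (\<epsilon> / C)"
        using g(2) rC by (intro mult_left_mono) auto
      then show "(F ^^ n) (p + g) - p \<in> Sobolev 1" "Sobolev_norm 1 ((F ^^ n) (p + g) - p) \<le> \<epsilon>"
        using 1 rC by (simp_all add: mult.assoc)
    qed (use rC \<epsilon> in simp)
  qed
qed

lemma exponentially_attracting_common_rate:
  assumes "exponentially_attracting F p" "exponentially_attracting F q"
  shows "\<exists>r>0. \<exists>C>0. \<exists>lam>0. \<forall>g\<in>Sobolev 1. mean g = 0 \<longrightarrow> Sobolev_norm 1 g \<le> r \<longrightarrow>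
      (\<forall>n::nat. (F ^^ n) (p + g) - p \<in> Sobolev 1 \<and>
         Sobolev_norm 1 ((F ^^ n) (p + g) - p) \<le> C * exp (- lam * real n) \<and>
         (F ^^ n) (q + g) - q \<in> Sobolev 1 \<and>
         Sobolev_norm 1 ((F ^^ n) (q + g) - q) \<le> C * exp (- lam * real n))"
proof -
  have rate: "\<exists>r>0. \<exists>C>0. \<exists>\<kappa>>0. \<kappa> < 1 \<and> (\<forall>g\<in>Sobolev 1. mean g = 0 \<longrightarrow> Sobolev_norm 1 g \<le> r \<longrightarrow>
      (\<forall>n. (F ^^ n) (p + g) - p \<in> Sobolev 1 \<and> Sobolev_norm 1 ((F ^^ n) (p + g) - p) \<le> C * \<kappa> ^ n))"
    if attr: "exponentially_attracting F p" for p
  proof -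
    obtain r C \<kappa> where rC: "r > 0" "C > 0" "\<kappa> > 0" "\<kappa> < 1" and
      bound: "\<And>g n. g \<in> Sobolev 1 \<inter> V_L1 \<Longrightarrow> Sobolev_norm 1 g \<le> r \<Longrightarrow>
         (F ^^ n) (p + g) - p \<in> Sobolev 1 \<and>
         Sobolev_norm 1 ((F ^^ n) (p + g) - p) \<le> C * \<kappa> ^ n * Sobolev_norm 1 g"
      using attr unfolding exponentially_attracting_def by metis
    have "Sobolev_norm 1 ((F ^^ n) (p + g) - p) \<le> (C * r) * \<kappa> ^ n"
      if g: "g \<in> Sobolev 1" "mean g = 0" "Sobolev_norm 1 g \<le> r" for g n
    proof -
      have "C * \<kappa> ^ n * Sobolev_norm 1 g \<le> C * \<kappa> ^ n * r"
        using rC g(3) by (intro mult_left_mono) auto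
      moreover have "Sobolev_norm 1 ((F ^^ n) (p + g) - p) \<le> C * \<kappa> ^ n * Sobolev_norm 1 g"
        using bound[of g n] g by (auto simp: V_L1_def)
      ultimately show ?thesis by (simp add: mult_ac)
    qed
    moreover have "(F ^^ n) (p + g) - p \<in> Sobolev 1"
      if "g \<in> Sobolev 1" "mean g = 0" "Sobolev_norm 1 g \<le> r" for g n
      using bound[of g n] that by (auto simp: V_L1_def)
    ultimately show ?thesis
      using rC by (intro exI[of _ r] exI[of _ "C * r"] exI[of _ \<kappa>] conjI) auto
  qed
  obtain r1 C1 \<kappa>1 where 1: "r1 > 0" "C1 > 0" "\<kappa>1 > 0" "\<kappa>1 < 1" and b1:
    "\<And>g n. g \<in> Sobolev 1 \<Longrightarrow> mean g = 0 \<Longrightarrow> Sobolev_norm 1 g \<le> r1 \<Longrightarrow>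
      (F ^^ n) (p + g) - p \<in> Sobolev 1 \<and> Sobolev_norm 1 ((F ^^ n) (p + g) - p) \<le> C1 * \<kappa>1 ^ n"
    using rate[OF assms(1)] by blast
  obtain r2 C2 \<kappa>2 where 2: "r2 > 0" "C2 > 0" "\<kappa>2 > 0" "\<kappa>2 < 1" and b2:
    "\<And>g n. g \<in> Sobolev 1 \<Longrightarrow> mean g = 0 \<Longrightarrow> Sobolev_norm 1 g \<le> r2 \<Longrightarrow>
      (F ^^ n) (q + g) - q \<in> Sobolev 1 \<and> Sobolev_norm 1 ((F ^^ n) (q + g) - q) \<le> C2 * \<kappa>2 ^ n"
    using rate[OF assms(2)] by blast
  \<comment> \<open>The slower of the two rates.\<close>
  define lam where "lam = - ln (max \<kappa>1 \<kappa>2)"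
  have lam: "lam > 0" using 1 2 by (simp add: lam_def max_def)
  have exp_lam: "exp (- lam * real n) = max \<kappa>1 \<kappa>2 ^ n" for n
    using 1 2 by (simp add: lam_def mult.commute[of _ "real n"] exp_of_nat_mult)
  have le: "C1 * \<kappa>1 ^ n \<le> max C1 C2 * exp (- lam * real n)" "C2 * \<kappa>2 ^ n \<le> max C1 C2 * exp (- lam * real n)" for n
    unfolding exp_lam using 1 2 by (auto intro!: mult_mono power_mono)
  show ?thesis
    by (rule exI[of _ "min r1 r2"], rule conjI, use 1 2 in simp,
        rule exI[of _ "max C1 C2"], rule conjI, use 1 2 in simp,
        rule exI[of _ lam], rule conjI, rule lam)
       (use b1 b2 le in \<open>meson min.boundedE order_trans\<close>)
qed

lemma V_L1_add: "f \<in> V_L1 \<Longrightarrow> g \<in> V_L1 \<Longrightarrow> f + g \<in> V_L1"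
  and V_L1_scaleR: "f \<in> V_L1 \<Longrightarrow> c *\<^sub>R f \<in> V_L1"
  by (simp_all add: V_L1_def mean_add mean_scaleR)

text \<open>With \<open>w = \<delta> * W (h0 + g)\<close>, the deviation of one step from
  \<open>L g\<close> is exactly \<open>w\<close> times \<open>\<psi> (h0 + g) - h0 - L g\<close>.
  The bracket stays bounded, and \<open>w\<close> is quadratic in \<open>g\<close>.\<close>

lemma (in expanding_circle_map) exponentially_attracting_invariant_density:
  assumes h0: "h0 \<in> Sobolev 1" "mean h0 = 1" "L h0 = h0" "W h0 = 0"
    and \<delta>: "\<delta> \<ge> 0" and K: "K \<ge> 0"
    and \<psi>: "\<And>\<phi>. \<psi> \<phi> \<in> Sobolev 1" "\<And>\<phi>. mean (\<psi> \<phi>) = 1"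
    and Lip: "\<And>g. g \<in> V_L1 \<Longrightarrow> Sobolev_norm 1 (\<psi> (h0 + g) - \<psi> h0) \<le> K * norm g"
  shows "exponentially_attracting (L_self T \<delta> \<psi>) h0"
proof -
  let ?X = "Sobolev 1 \<inter> V_L1"
  let ?F = "\<lambda>g. L_self T \<delta> \<psi> (h0 + g) - h0"
  obtain N where N: "N > 0"
    "\<And>f. f \<in> Sobolev 1 \<Longrightarrow> mean f = 0 \<Longrightarrow> Sobolev_norm 1 ((L ^^ N) f) \<le> Sobolev_norm 1 f / 2"
    using transfer_spectral_gap by blast
  \<comment> \<open>The three summands bound, for perturbations of norm at most 1, the parts
    \<open>\<psi> (h0 + g) - \<psi> h0\<close>, \<open>\<psi> h0 - h0\<close> and \<open>L g\<close>
    of the bracket.\<close>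
  define R where "R = K + Sobolev_norm 1 (\<psi> h0 - h0) + (1 + \<beta>)"
  have R: "R \<ge> 0" using K \<beta>_pos Sobolev_norm_nonneg[of 1 "\<psi> h0 - h0"] by (simp add: R_def)
  \<comment> \<open>This radius keeps \<open>w \<le> 1\<close>, so that the first branch of
    \<open>L_fam\<close> applies.\<close>
  define r0 where "r0 = min 1 (1 / (2 * \<delta> + 1))"
  have r0: "r0 > 0" using \<delta> by (simp add: r0_def)
  have F: "?F g \<in> ?X \<and> ?F g - L g \<in> ?X \<and> Sobolev_norm 1 (?F g - L g) \<le> 2 * \<delta> * R * (Sobolev_norm 1 g)\<^sup>2"
    if g: "g \<in> ?X" "Sobolev_norm 1 g \<le> r0" for g
  proof -
    define w where "w = \<delta> * W (h0 + g)"
    define s where "s = Sobolev_norm 1 g"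
    have s: "0 \<le> s" "s \<le> 1" "s \<le> 1 / (2 * \<delta> + 1)" "norm g \<le> s"
      using g(2) Sobolev_norm_nonneg[of 1 g] norm_le_Sobolev_norm[of g] by (auto simp: s_def r0_def)
    have Lg: "L g \<in> ?X"
      using g by (auto simp: V_L1_def mean_transfer simp del: One_nat_def intro: Sobolev_1_transfer)
    have w0: "0 \<le> w" using \<delta> W_nonneg by (simp add: w_def)
    have "W (h0 + g) \<le> 2 * s\<^sup>2"
      using W_add_le[OF h0(4), of g] power_mono[OF s(4), of 2] by simp
    then have w_le: "w \<le> 2 * \<delta> * s\<^sup>2" using mult_left_mono[of "W (h0 + g)" "2 * s\<^sup>2" \<delta>] \<delta> by (simp add: w_def)
    have "2 * \<delta> * s\<^sup>2 \<le> 2 * \<delta> * (1 / (2 * \<delta> + 1))"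
    proof (rule mult_left_mono)
      have "s\<^sup>2 \<le> s" using s by (simp add: power2_eq_square mult_left_le)
      then show "s\<^sup>2 \<le> 1 / (2 * \<delta> + 1)" using s by simp
    qed (use \<delta> in simp)
    also have "\<dots> \<le> 1" using \<delta> by simp
    finally have w1: "w \<le> 1" using w_le by simp
    have m: "mean (h0 + g) = 1" using g h0 by (simp add: mean_add V_L1_def)
    define d where "d = \<psi> (h0 + g) - h0 - L g"
    have Fw: "?F g - L g = w *\<^sub>R d"
      using w1 unfolding L_self_def L_fam_def w_def[symmetric] m d_def
      by (simp add: transfer_add h0(3) algebra_simps)
    have d: "d \<in> ?X"
      using Lg h0 \<psi> g unfolding d_def
      by (auto intro!: Sobolev_1_diff simp: V_L1_def mean_diff simp del: One_nat_def)
    have wd: "w *\<^sub>R d \<in> ?X" using d by (auto intro: Sobolev_1_scaleR V_L1_scaleR simp del: One_nat_def)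
    have "?F g = L g + w *\<^sub>R d" using Fw by (simp add: algebra_simps)
    then have FX: "?F g \<in> ?X" using Lg wd by (auto intro: Sobolev_1_add V_L1_add simp del: One_nat_def)
    have "Sobolev_norm 1 d \<le> Sobolev_norm 1 (\<psi> (h0 + g) - h0) + Sobolev_norm 1 (L g)"
      unfolding d_def using Lg h0 \<psi> by (intro Sobolev_norm_diff Sobolev_1_diff) auto
    also have "Sobolev_norm 1 (\<psi> (h0 + g) - h0) \<le> Sobolev_norm 1 (\<psi> (h0 + g) - \<psi> h0) + Sobolev_norm 1 (\<psi> h0 - h0)"
      using Sobolev_norm_add[OF Sobolev_1_diff[OF \<psi>(1) \<psi>(1)] Sobolev_1_diff[OF \<psi>(1) h0(1)], of "h0 + g" h0 h0]
      by simp
    also have "Sobolev_norm 1 (\<psi> (h0 + g) - \<psi> h0) \<le> K * 1"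
      using Lip[of g] g s K by (intro order_trans[OF Lip mult_left_mono]) auto
    also have "Sobolev_norm 1 (L g) \<le> (1 + \<beta>) * 1"
      using Sobolev_norm_transfer[of g] g s \<beta>_pos
      by (intro order_trans[OF Sobolev_norm_transfer mult_left_mono]) (auto simp: s_def)
    finally have dR: "Sobolev_norm 1 d \<le> R" by (simp add: R_def)
    have "Sobolev_norm 1 (?F g - L g) = w * Sobolev_norm 1 d"
      unfolding Fw using d w0 by (simp add: Sobolev_norm_scaleR del: One_nat_def)
    also have "\<dots> \<le> 2 * \<delta> * s\<^sup>2 * R"
      using w_le dR w0 \<delta> by (intro mult_mono Sobolev_norm_nonneg) auto
    finally show ?thesis using FX wd by (simp add: Fw s_def mult_ac del: One_nat_def)
  qed
  have X_L: "L f \<in> ?X" if "f \<in> ?X" for f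
    using that by (auto simp: V_L1_def mean_transfer simp del: One_nat_def intro: Sobolev_1_transfer)
  have M: "0 \<le> 2 * \<delta> * R" using \<delta> R by simp
  obtain r C \<kappa> where "r > 0" "C > 0" "0 < \<kappa>" "\<kappa> < 1"
    "\<And>g n. g \<in> ?X \<Longrightarrow> Sobolev_norm 1 g \<le> r \<Longrightarrow>
      (?F ^^ n) g \<in> ?X \<and> Sobolev_norm 1 ((?F ^^ n) g) \<le> C * \<kappa> ^ n * Sobolev_norm 1 g"
  proof (rule quadratic_perturbation_stable[where p = "Sobolev_norm 1" and X = ?X and A = L and F = ?F
        and K = "1 + \<beta>" and N = N and ?r0.0 = r0 and M = "2 * \<delta> * R"])
    show "Sobolev_norm 1 (f + g) \<le> Sobolev_norm 1 f + Sobolev_norm 1 g" if "f \<in> ?X" "g \<in> ?X" for f g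
      using that by (intro Sobolev_norm_add) auto
    show "Sobolev_norm 1 (L f) \<le> (1 + \<beta>) * Sobolev_norm 1 f" if "f \<in> ?X" for f
      using that by (intro Sobolev_norm_transfer) auto
    show "Sobolev_norm 1 ((L ^^ N) f) \<le> Sobolev_norm 1 f / 2" if "f \<in> ?X" for f
      using that by (intro N(2)) (auto simp: V_L1_def)
  qed (use X_L F N(1) r0 M \<beta>_pos Sobolev_norm_nonneg transfer_add in \<open>auto simp del: One_nat_def\<close>)
  then show ?thesis by (rule exponentially_attractingI)
qed

text \<open>On a small ball the second branch of \<open>L_fam\<close> stays active, so one step from
  a perturbation of mean zero is just \<open>\<psi>\<close>. Its linear part contracts by
  \<open>k\<close>, and differentiability leaves a remainder of at most \<open>\<kappa> - k\<close>
  times the L1 norm.\<close>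

lemma exponentially_attracting_strong_coupling:
  fixes \<psi> :: "L1 \<Rightarrow> L1"
  assumes \<psi>: "\<And>\<phi>. \<psi> \<phi> \<in> Sobolev 1" "\<And>\<phi>. mean (\<psi> \<phi>) = 1"
    and \<delta>: "\<delta> \<ge> 0" and W: "\<delta> * W \<phi>t > 1" and fixed: "\<psi> \<phi>t = \<phi>t"
    and A: "\<And>g. A g \<in> Sobolev 1" "\<And>g. Sobolev_norm 1 (A g) \<le> k * norm g" "0 \<le> k" "k < 1"
    and lim: "((\<lambda>g. Sobolev_norm 1 (\<psi> (\<phi>t + g) - \<psi> \<phi>t - A g) / norm g) \<longlongrightarrow> 0) (at 0 within V_L1)"
  shows "exponentially_attracting (L_self T \<delta> \<psi>) \<phi>t"
proof -
  let ?X = "Sobolev 1 \<inter> V_L1"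
  let ?F = "\<lambda>g. L_self T \<delta> \<psi> (\<phi>t + g) - \<phi>t"
  have mean_\<phi>t: "mean \<phi>t = 1" using \<psi>(2)[of \<phi>t] fixed by simp
  define \<kappa> where "\<kappa> = (1 + k) / 2"
  have \<kappa>: "0 < \<kappa>" "\<kappa> < 1" using A(3,4) by (auto simp: \<kappa>_def)
  have "\<forall>\<^sub>F g in at 0 within V_L1. Sobolev_norm 1 (\<psi> (\<phi>t + g) - \<psi> \<phi>t - A g) / norm g < \<kappa> - k"
    using A(4) by (intro order_tendstoD(2)[OF lim]) (simp add: \<kappa>_def)
  then obtain e where e: "e > 0" "\<And>g. g \<in> V_L1 \<Longrightarrow> g \<noteq> 0 \<Longrightarrow> norm g < e \<Longrightarrow>
      Sobolev_norm 1 (\<psi> (\<phi>t + g) - \<psi> \<phi>t - A g) / norm g < \<kappa> - k"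
    unfolding eventually_at by (auto simp: dist_norm)
  define c where "c = 4 * \<delta> * norm \<phi>t"
  have c: "c \<ge> 0" using \<delta> by (simp add: c_def)
  \<comment> \<open>\<open>c * norm g\<close> bounds the loss in \<open>\<delta> * W\<close>. The
    halves turn both requirements into strict inequalities, and \<open>c + 1\<close> covers the case
    \<open>c = 0\<close>.\<close>
  define r where "r = min (e / 2) ((\<delta> * W \<phi>t - 1) / (2 * (c + 1)))"
  have r: "r > 0" "r < e" "c * r < \<delta> * W \<phi>t - 1"
  proof -
    show pos: "r > 0" using e(1) W c by (simp add: r_def)
    show "r < e" using e(1) by (simp add: r_def)
    have "(c + 1) * r \<le> (c + 1) * ((\<delta> * W \<phi>t - 1) / (2 * (c + 1)))"
      using c by (intro mult_left_mono) (auto simp: r_def)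
    also have "\<dots> = (\<delta> * W \<phi>t - 1) / 2" using c by (simp add: divide_simps)
    also have "\<dots> < \<delta> * W \<phi>t - 1" using W by simp
    finally show "c * r < \<delta> * W \<phi>t - 1" using pos by (simp add: algebra_simps)
  qed
  have step: "?F g \<in> ?X \<and> Sobolev_norm 1 (?F g) \<le> \<kappa> * Sobolev_norm 1 g"
    if g: "g \<in> ?X" "Sobolev_norm 1 g \<le> r" for g
  proof -
    have ng: "norm g \<le> r" using g(2) norm_le_Sobolev_norm[of g] by simp
    have m: "mean (\<phi>t + g) = 1" using g mean_\<phi>t by (simp add: mean_add V_L1_def)
    have "c * norm g \<le> c * r" using ng c by (rule mult_left_mono)
    moreover have "\<delta> * (W \<phi>t - 4 * norm \<phi>t * norm g) \<le> \<delta> * W (\<phi>t + g)"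
      by (rule mult_left_mono[OF W_add_ge \<delta>])
    ultimately have "1 < \<delta> * W (\<phi>t + g)"
      using r(3) by (simp add: c_def algebra_simps)
    then have Fg: "?F g = \<psi> (\<phi>t + g) - \<psi> \<phi>t"
      by (simp add: L_self_def L_fam_def m fixed)
    have FX: "?F g \<in> ?X"
      unfolding Fg using \<psi> by (auto intro!: Sobolev_1_diff simp: V_L1_def mean_diff simp del: One_nat_def)
    have "Sobolev_norm 1 (\<psi> (\<phi>t + g) - \<psi> \<phi>t) \<le> \<kappa> * norm g"
    proof (cases "g = 0")
      case True
      have "Sobolev_norm 1 (0 *\<^sub>R \<psi> \<phi>t) = 0" unfolding Sobolev_norm_scaleR[OF \<psi>(1)] by simp
      then show ?thesis using True by simp
    next
      case False
      let ?d = "\<psi> (\<phi>t + g) - \<psi> \<phi>t - A g"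
      have "?d \<in> Sobolev 1" by (intro Sobolev_1_diff \<psi> A)
      then have "Sobolev_norm 1 (?d + A g) \<le> Sobolev_norm 1 ?d + Sobolev_norm 1 (A g)"
        by (rule Sobolev_norm_add[OF _ A(1)])
      also have "Sobolev_norm 1 ?d \<le> (\<kappa> - k) * norm g"
        using e(2)[of g] False g ng r(2) by (simp add: divide_less_eq split: if_splits)
      also have "Sobolev_norm 1 (A g) \<le> k * norm g" by (rule A(2))
      finally show ?thesis by (simp add: algebra_simps)
    qed
    also have "\<dots> \<le> \<kappa> * Sobolev_norm 1 g" using \<kappa> norm_le_Sobolev_norm by (intro mult_left_mono) auto
    finally show ?thesis using FX Fg by simp
  qed
  show ?thesis
  proof (rule exponentially_attractingI[OF r(1) zero_less_one \<kappa>])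
    fix g n assume "g \<in> ?X" "Sobolev_norm 1 g \<le> r"
    then show "(?F ^^ n) g \<in> ?X \<and> Sobolev_norm 1 ((?F ^^ n) g) \<le> 1 * \<kappa> ^ n * Sobolev_norm 1 g"
      using local_contraction_iterate[of ?X "Sobolev_norm 1" r ?F \<kappa> g n] step \<kappa> Sobolev_norm_nonneg
      by (simp del: One_nat_def)
  qed
qed

text \<open>A real supremum bounds its members only once the range is known to be bounded above; the
  bound in the stronger norm of order \<open>k\<close> supplies this.\<close>

lemma Sobolev_onorm_bound:
  assumes A: "bounded_linear_into_Sobolev k A" and "j \<le> k"
  shows "Sobolev_norm j (A f) \<le> Sobolev_onorm j A * norm f" and "0 \<le> Sobolev_onorm j A"
proof -
  obtain K where K: "\<And>f. Sobolev_norm k (A f) \<le> K * norm f"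
    using A by (auto simp: bounded_linear_into_Sobolev_def)
  have "Sobolev_norm j (A f) / norm f \<le> \<bar>K\<bar>" for f
  proof (cases "f = 0")
    case False
    have "Sobolev_norm j (A f) \<le> K * norm f"
      using Sobolev_norm_mono[OF assms(2), of "A f"] K[of f] by linarith
    also have "\<dots> \<le> \<bar>K\<bar> * norm f" by (intro mult_right_mono) auto
    finally show ?thesis using False by (simp add: divide_le_eq)
  qed simp
  then have "bdd_above (range (\<lambda>f. Sobolev_norm j (A f) / norm f))"
    by (intro bdd_aboveI[of _ "\<bar>K\<bar>"]) auto
  then have upper: "Sobolev_norm j (A f) / norm f \<le> Sobolev_onorm j A" for f
    unfolding Sobolev_onorm_def by (intro cSUP_upper) auto
  show "0 \<le> Sobolev_onorm j A" using upper[of 0] by simp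
  show "Sobolev_norm j (A f) \<le> Sobolev_onorm j A * norm f"
  proof (cases "f = 0")
    case True
    \<comment> \<open>At \<open>f = 0\<close> the quotient is 0 by convention and says nothing about
      the numerator, so the original bound \<open>K\<close> is used.\<close>
    have "Sobolev_norm j (A f) \<le> K * norm f"
      using Sobolev_norm_mono[OF assms(2), of "A f"] K[of f] by linarith
    then show ?thesis using True by simp
  next
    case False
    then show ?thesis using upper[of f] by (simp add: divide_le_eq)
  qed
qed

theorem proposition16:
  fixes T :: "real \<Rightarrow> real"
    and h0 \<phi>t :: L1
    and \<delta> C\<psi> :: real
    and \<psi> d\<psi> :: "L1 \<Rightarrow> L1"
  assumes T_C4: "C4_circle_lift T"
    and T_exp: "uniformly_expanding T"
    and h0_density: "h0 \<in> Pw"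
    and h0_reg: "h0 \<in> Sobolev 3"
    and h0_inv: "transfer_op T h0 = h0"
    and h0_W: "W h0 = 0"
    and \<delta>: "\<delta> \<ge> 0"
    and \<psi>_density: "\<And>\<phi>. \<psi> \<phi> \<in> Pw"
    and \<psi>_reg: "\<And>\<phi>. \<psi> \<phi> \<in> Sobolev 2"
    and \<psi>_bdd: "bdd_above ((\<lambda>\<phi>. Sobolev_norm 2 (\<psi> \<phi>)) ` Pw)"
    and C\<psi>: "C\<psi> \<ge> 0"
    and \<psi>_Lip: "\<And>\<phi> g. \<phi> \<in> Pw \<Longrightarrow> g \<in> V_L1 \<Longrightarrow>
           Sobolev_norm 1 (\<psi> (\<phi> + g) - \<psi> \<phi>) \<le> C\<psi> * \<delta> * norm g"
    and \<phi>t_W: "\<delta> * W \<phi>t > 1"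
    and \<phi>t_self: "\<psi> \<phi>t = \<phi>t"
    and d\<psi>_bl: "bounded_linear_into_Sobolev 2 d\<psi>"
    and d\<psi>_lim: "((\<lambda>g. Sobolev_norm 1 (\<psi> (\<phi>t + g) - \<psi> \<phi>t - d\<psi> g) / norm g) \<longlongrightarrow> 0)
           (at 0 within V_L1)"
    and d\<psi>_norm1: "Sobolev_onorm 1 d\<psi> < 1"
    and d\<psi>_norm2: "Sobolev_onorm 2 d\<psi> < 1"
  shows "stable_fixed_point (L_self T \<delta> \<psi>) h0 \<and>
    stable_fixed_point (L_self T \<delta> \<psi>) (\<psi> \<phi>t) \<and>
    (\<exists>r>0. \<exists>C>0. \<exists>lam>0. \<forall>g\<in>Sobolev 1. mean g = 0 \<longrightarrow> Sobolev_norm 1 g \<le> r \<longrightarrow>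
      (\<forall>n::nat.
         (L_self T \<delta> \<psi> ^^ n) (h0 + g) - h0 \<in> Sobolev 1 \<and>
         Sobolev_norm 1 ((L_self T \<delta> \<psi> ^^ n) (h0 + g) - h0) \<le> C * exp (- lam * real n) \<and>
         (L_self T \<delta> \<psi> ^^ n) (\<psi> \<phi>t + g) - \<psi> \<phi>t \<in> Sobolev 1 \<and>
         Sobolev_norm 1 ((L_self T \<delta> \<psi> ^^ n) (\<psi> \<phi>t + g) - \<psi> \<phi>t) \<le> C * exp (- lam * real n)))"
proof -
  obtain \<sigma> d where "expanding_circle_map T (deriv T) (deriv (deriv T)) \<sigma> d"
    using C4_uniformly_expanding_imp_locale[OF T_C4 T_exp] by blast
  then interpret expanding_circle_map T "deriv T" "deriv (deriv T)" \<sigma> d .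
  have \<psi>: "\<psi> \<phi> \<in> Sobolev 1" "mean (\<psi> \<phi>) = 1" for \<phi>
    using \<psi>_reg[of \<phi>] \<psi>_density[of \<phi>] Sobolev_mono[of 1 2] by (auto simp: Pw_def)
  have h0: "h0 \<in> Sobolev 1" "mean h0 = 1"
    using h0_reg h0_density Sobolev_mono[of 1 3] by (auto simp: Pw_def)
  have d\<psi>: "d\<psi> g \<in> Sobolev 1" for g
    using d\<psi>_bl Sobolev_mono[of 1 2] by (auto simp: bounded_linear_into_Sobolev_def)
  have attr_h0: "exponentially_attracting (L_self T \<delta> \<psi>) h0"
    by (rule exponentially_attracting_invariant_density[OF h0 h0_inv h0_W \<delta> _ \<psi> \<psi>_Lip[OF h0_density]])
       (use C\<psi> \<delta> in simp)
  have attr_\<phi>t: "exponentially_attracting (L_self T \<delta> \<psi>) (\<psi> \<phi>t)"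
    unfolding \<phi>t_self
    \<comment> \<open>The contraction factor \<open>k\<close> is
      \<open>Sobolev_onorm 1 d\<psi>\<close>.\<close>
    by (rule exponentially_attracting_strong_coupling[OF \<psi> \<delta> \<phi>t_W \<phi>t_self d\<psi>
          Sobolev_onorm_bound[OF d\<psi>_bl] d\<psi>_norm1 d\<psi>_lim]) simp_all
  have "L_self T \<delta> \<psi> h0 = h0"
    by (simp add: L_self_def L_fam_def h0_W h0_inv)
  moreover have "L_self T \<delta> \<psi> (\<psi> \<phi>t) = \<psi> \<phi>t"
    using \<phi>t_W \<psi>(2)[of \<phi>t] by (simp add: L_self_def L_fam_def \<phi>t_self)
  ultimately show ?thesis
    using exponentially_attracting_imp_stable attr_h0 attr_\<phi>t exponentially_attracting_common_rate[OF attr_h0 attr_\<phi>t]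
    by blast
qed

end
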